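(* For every integer $k\ge 3$, $$ i^{\lhd}_{\mathrm{SL}_k(\mathbb Z)}(n)\ \dot\sim\ i^{\max\lhd}_{\mathrm{SL}_k(\mathbb Z)}(n)\ \dot\sim\ e^{n^{1/(k^2-1)}},\qquad i^{\max}_{\mathrm{SL}_k(\mathbb Z)}(n)\ \dot\sim\ e^{n^{1/(k-1)}}.$$
   Context: For a group $\Gamma$ and a real number $n>0$: $i^{\lhd}_\Gamma(n)$ is the index in $\Gamma$ of the intersection of all normal subgroups of $\Gamma$ of index at most $n$; $i^{\max}_\Gamma(n)$ is the index in $\Gamma$ of the intersection of all maximal (proper) subgroups of $\Gamma$ of index at most $n$; $i^{\max\lhd}_\Gamma(n)$ is the index in $\Gamma$ of the intersection of all maximal normal subgroups (subgroups maximal among the proper normal subgroups) of $\Gamma$ of index at most $n$. An empty intersection is $\Gamma$. For functions $f,g$ write $f(n)\ \dot\sim\ g(n)$ if there exist constants $A,B,C,D>0$ such that $f(n)\le A\,g(Bn)$ and $g(n)\le C\,f(Dn)$ for all positive integers $n$. *)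

theory Defs
  imports
    "HOL-Algebra.Coset"
    "HOL-Library.Extended_Nonnegative_Real"
    "Jordan_Normal_Form.Determinant"
begin

definition SL :: "nat \<Rightarrow> int mat monoid" where
  "SL k = \<lparr>carrier = {A \<in> carrier_mat k k. det A = 1}, monoid.mult = (*), one = 1\<^sub>m k\<rparr>"

lemma group_SL: "group (SL k)"
proof (rule groupI)
  fix A assume "A \<in> carrier (SL k)"
  then have A: "A \<in> carrier_mat k k" and d: "det A = 1" by (auto simp: SL_def)
  have "adj_mat A \<in> carrier_mat k k" and inv: "adj_mat A * A = 1\<^sub>m k"
    using adj_mat[OF A] d by auto
  moreover from this have "det (adj_mat A) = 1"
    using det_mult[of "adj_mat A" k A] A d by simp
  ultimately show "\<exists>B\<in>carrier (SL k). B \<otimes>\<^bsub>SL k\<^esub> A = \<one>\<^bsub>SL k\<^esub>"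
    by (auto simp: SL_def)
qed (auto simp: SL_def det_mult)

(* The value is \<infinity> when the index is infinite, where card alone would give 0. *)
definition subgroup_index :: "('a, 'b) monoid_scheme \<Rightarrow> 'a set \<Rightarrow> ennreal" where
  "subgroup_index G H =
     (if finite (rcosets\<^bsub>G\<^esub> H) then of_nat (card (rcosets\<^bsub>G\<^esub> H)) else \<infinity>)"

definition maximal_subgroup :: "'a set \<Rightarrow> ('a, 'b) monoid_scheme \<Rightarrow> bool" where
  "maximal_subgroup H G \<longleftrightarrow>
     subgroup H G \<and> H \<noteq> carrier G \<and>
     (\<forall>K. subgroup K G \<and> H \<subseteq> K \<longrightarrow> K = H \<or> K = carrier G)"

definition maximal_normal_subgroup :: "'a set \<Rightarrow> ('a, 'b) monoid_scheme \<Rightarrow> bool" where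
  "maximal_normal_subgroup N G \<longleftrightarrow>
     N \<lhd> G \<and> N \<noteq> carrier G \<and>
     (\<forall>K. K \<lhd> G \<and> N \<subseteq> K \<longrightarrow> K = N \<or> K = carrier G)"

(* Intersecting with the carrier makes the empty intersection the whole group. *)
definition intersection_index ::
  "('a set \<Rightarrow> ('a, 'b) monoid_scheme \<Rightarrow> bool) \<Rightarrow> ('a, 'b) monoid_scheme \<Rightarrow> real \<Rightarrow> ennreal" where
  "intersection_index P G n =
     subgroup_index G (carrier G \<inter> \<Inter>{H. P H G \<and> subgroup_index G H \<le> ennreal n})"

definition i_normal :: "('a, 'b) monoid_scheme \<Rightarrow> real \<Rightarrow> ennreal" where
  "i_normal = intersection_index normal"

definition i_max :: "('a, 'b) monoid_scheme \<Rightarrow> real \<Rightarrow> ennreal" where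
  "i_max = intersection_index maximal_subgroup"

definition i_max_normal :: "('a, 'b) monoid_scheme \<Rightarrow> real \<Rightarrow> ennreal" where
  "i_max_normal = intersection_index maximal_normal_subgroup"

definition growth_equiv :: "(real \<Rightarrow> ennreal) \<Rightarrow> (real \<Rightarrow> ennreal) \<Rightarrow> bool"
    (infix "\<sim>\<^sub>g" 50) where
  "f \<sim>\<^sub>g g \<longleftrightarrow>
     (\<exists>A B C D :: real. A > 0 \<and> B > 0 \<and> C > 0 \<and> D > 0 \<and>
        (\<forall>n :: nat. n > 0 \<longrightarrow>
           f (real n) \<le> ennreal A * g (B * real n) \<and>
           g (real n) \<le> ennreal C * f (D * real n)))"

end

(* Write X(a) for the elementary matrix 1 + a e_01, and E(m) for the normal closure of X(m).

   Upper bounds. The index of E(m) is polynomial in m: modulo E(m) the congruence subgroup of level m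
   is carried by the SL_2 corner, whose image satisfies the Steinberg relations modulo m; for m = p^e
   the decomposition by the big cell, together with the fact that the Steinberg symbols are bimultiplicative and
   that the units modulo p^e are generated by two elements, bounds it by m^8. If H has index at most n
   then, for each g, the a with g X(a) g^-1 in H form a subgroup t Z with t <= n, so H contains E(m)
   for the least common multiple m of these t. A prime p dividing m satisfies p^(k-1) <= [G : H], and
   p^(k^2-1) <= O([G : H]) for normal H, since the normal subgroup is then scalar modulo p. With d the
   exponent of p, all t are x-smooth for x = O(n^(1/d)), so m divides a number of size at most
   n^pi(x) = exp(O(x)) by Chebyshev's bound.

   Lower bounds. For every prime p the congruence subgroup of level p has index O(p^(k^2-1)) and the
   stabilizer of a line modulo p has index O(p^(k-1)); each lies in a maximal (normal) subgroup, all
   of whose conjugates contain X(a) only if p divides a. Intersecting over p <= y gives an index of at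
   least the product of these primes, which is exp(Omega(y)). *)

theory Submission
  imports Defs "HOL-Number_Theory.Number_Theory" "HOL-Real_Asymp.Real_Asymp"
begin

section \<open>Steinberg groups of rank two modulo an integer\<close>

text \<open>For k \<ge> 3 the group \<open>E m\<close> is in fact the whole congruence subgroup, but
  a polynomial bound on its index is enough: raising the index to a power e multiplies the exponent
  x by a constant, and a constant inside the exponential moves into the argument of the growth
  function, as (c x)^d = c^d x^d. Modulo \<open>E m\<close> only the Steinberg relations are at
  hand, so what has to be counted is a priori a central extension of the matrix group over Z/m. Its
  kernel is controlled by Steinberg symbols, and a count that is too generous by a power of m does
  no harm.

  There is no relation between opposite roots. Rank two compensates for this: a root element is a
  commutator through the third index, and known actions on the two factors determine the action on
  it.

  For the bounds on [G : H] the level is an unknown integer. The prime p is detected by a pair pF, F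
  with \<open>X 0 1 (p F)\<close> inside the core of H and \<open>X 0 1 F\<close> outside, which
  avoids any assumption on the other prime factors of the level.\<close>

definition cj :: "'g::group_add \<Rightarrow> 'g \<Rightarrow> 'g" where "cj g x = g + x - g"

lemma cj_plus: "cj g (x + x') = cj g x + cj g x'"
  by (simp add: cj_def diff_conv_add_uminus add.assoc del: add_uminus_conv_diff)

lemma cj_cj: "cj (g + g') x = cj g (cj g' x)"
  by (simp add: cj_def diff_conv_add_uminus add.assoc minus_add del: add_uminus_conv_diff)

lemma cj_uminus: "cj g (- x) = - cj g x"
  by (simp add: cj_def diff_conv_add_uminus add.assoc minus_add del: add_uminus_conv_diff)

lemma cj_minus: "cj g (x - x') = cj g x - cj g x'"
  by (metis cj_plus cj_uminus diff_conv_add_uminus)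

lemma cj_eqD: "cj g x = z \<Longrightarrow> g + x = z + g"
  by (auto simp: cj_def)

lemma cj_self: "cj g g = g"
  by (simp add: cj_def)

lemma cj_id_iff: "cj g x = x \<longleftrightarrow> g + x = x + g"
  by (metis add_diff_cancel cj_def diff_add_cancel)

lemma comm_plus:
  fixes x :: "'a::monoid_add"
  assumes "x + a = a + x" "x + b = b + x"
  shows "x + (a + b) = (a + b) + x"
proof -
  have "x + (a + b) = a + (x + b)" using assms(1) by (simp add: add.assoc[symmetric])
  then show ?thesis using assms(2) by (simp add: add.assoc)
qed

definition tri :: "nat \<Rightarrow> nat \<Rightarrow> nat \<Rightarrow> bool" where
  "tri i j l \<longleftrightarrow> i < 3 \<and> j < 3 \<and> l < 3 \<and> i \<noteq> j \<and> j \<noteq> l \<and> i \<noteq> l"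

lemma tri_perm: "tri i j l \<Longrightarrow> tri j i l" "tri i j l \<Longrightarrow> tri i l j" "tri i j l \<Longrightarrow> tri l j i"
  "tri i j l \<Longrightarrow> tri j l i" "tri i j l \<Longrightarrow> tri l i j"
  by (auto simp: tri_def)

text \<open>The Steinberg relations of type \<open>A\<^sub>2\<close> for \<open>e\<^sub>i\<^sub>j(a) = y i j a\<close>, in an additively written
  (not necessarily commutative) group, so that the class \<open>group_add\<close> applies.\<close>

locale steinberg =
  fixes y :: "nat \<Rightarrow> nat \<Rightarrow> int \<Rightarrow> 'g::group_add" and q :: int
  assumes q_pos: "q > 0"
    and y_add: "tri i j l \<Longrightarrow> y i j (a + b) = y i j a + y i j b"
    and y_row: "tri i j l \<Longrightarrow> y i j a + y i l b = y i l b + y i j a"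
    and y_col: "tri i j l \<Longrightarrow> y i j a + y l j b = y l j b + y i j a"
    and y_comm: "tri i j l \<Longrightarrow> y i j a + y j l b = y i l (a * b) + y j l b + y i j a"
    and y_q: "tri i j l \<Longrightarrow> y i j q = 0"
begin

declare One_nat_def [simp del]

lemma y_0: assumes "tri i j l" shows "y i j 0 = 0"
proof -
  have "y i j 0 + y i j 0 = 0 + y i j 0" using y_add[OF assms, of 0 0] by simp
  then show ?thesis by (rule add_right_imp_eq)
qed

lemma y_minus: assumes "tri i j l" shows "y i j (- a) = - y i j a"
  using y_add[OF assms, of "-a" a] y_0[OF assms] by (simp add: eq_neg_iff_add_eq_0)

lemma y_mult_q: assumes "tri i j l" shows "y i j (q * t) = 0"
proof (induction t rule: int_induct[where k = 0])
  case base
  then show ?case using y_0[OF assms] by simp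
next
  case (step1 t)
  then show ?case using y_add[OF assms, of "q * t" q] y_q[OF assms] by (simp add: algebra_simps)
next
  case (step2 t)
  then show ?case using y_add[OF assms, of "q * t" "- q"] y_q[OF assms] y_minus[OF assms]
    by (simp add: algebra_simps)
qed

lemma y_cong: assumes "tri i j l" "[a = b] (mod q)" shows "y i j a = y i j b"
proof -
  obtain t where "a = b + q * t" using assms(2) by (metis cong_iff_lin cong_sym)
  then show ?thesis using y_add[OF assms(1), of b "q * t"] y_mult_q[OF assms(1)] by simp
qed

lemma cj_y1: "tri i j l \<Longrightarrow> cj (y i j a) (y j l b) = y i l (a * b) + y j l b"
  unfolding cj_def by (subst y_comm) auto

lemma cj_y2: assumes "tri i j l" shows "cj (y i j a) (y l i b) = y l j (- (a * b)) + y l i b"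
proof -
  have "y l i b + y i j a = y l j (b * a) + (y i j a + y l i b)"
    using y_comm[of l i j b a] assms by (simp add: tri_def add.assoc)
  then have "y i j a + y l i b = - y l j (b * a) + (y l i b + y i j a)"
    by simp
  then show ?thesis
    unfolding cj_def using y_minus[of l j i "a * b"] assms
    by (simp add: tri_def mult.commute) (simp add: add.assoc [symmetric])
qed

lemma cj_y3: assumes "tri i j l" shows "cj (y i j a) (y i l b) = y i l b"
  using y_row[OF assms] by (simp add: cj_id_iff)

lemma cj_y4: assumes "tri i j l" shows "cj (y i j a) (y l j b) = y l j b"
  using y_col[OF assms] by (simp add: cj_id_iff)

section \<open>Weyl elements and their action on root elements\<close>

text \<open>The Weyl element of the root (i, j); in matrices it has the entries \<open>u\<close> at
  (i, j) and -1/u at (j, i). The parameter \<open>v\<close> stands for 1/u: the formulas below use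
  only that \<open>u * v\<close> is 1 modulo \<open>q\<close>, and keeping it free lets signs and
  products of units be handled without choosing inverses.\<close>

definition w :: "nat \<Rightarrow> nat \<Rightarrow> int \<Rightarrow> int \<Rightarrow> 'g" where
  "w i j u v = y i j u + y j i (- v) + y i j u"

lemma cj_w: "cj (w i j u v) x = cj (y i j u) (cj (y j i (- v)) (cj (y i j u) x))"
  by (simp add: w_def cj_cj)

lemma mul_inv_cong:
  assumes "[u * v = 1] (mod q)"
  shows "[u * (v * b) = b] (mod q)" "[v * (u * b) = b] (mod q)"
        "[- (u * (v * b)) = - b] (mod q)" "[- (v * (u * b)) = - b] (mod q)"
proof -
  have *: "[u * v * b = 1 * b] (mod q)" by (rule cong_mult[OF assms cong_refl])
  then show "[u * (v * b) = b] (mod q)" "[v * (u * b) = b] (mod q)"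
    by (simp_all add: mult_ac)
  then show "[- (u * (v * b)) = - b] (mod q)" "[- (v * (u * b)) = - b] (mod q)"
    by (simp_all add: cong_minus_minus_iff)
qed

lemma cj_w_jl:
  assumes t: "tri i j l" and uv: "[u * v = 1] (mod q)"
  shows "cj (w i j u v) (y j l b) = y i l (u * b)"
proof -
  have 1: "cj (y j i (- v)) (y i l (u * b)) = y j l (- b) + y i l (u * b)"
    using cj_y1[of j i l "-v" "u * b"] y_cong[of j l i "- v * (u * b)" "- b"] t mul_inv_cong(4)[OF uv]
    by (simp add: tri_def)
  have 2: "cj (y j i (- v)) (y j l b) = y j l b"
    using cj_y3[of j i l] t by (simp add: tri_def)
  have 3: "y j l (- b) + y i l (u * b) + y j l b = y i l (u * b)"
    using y_col[of j l i "-b" "u * b"] t y_minus[of j l i b] by (simp add: tri_def add.assoc)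
  show ?thesis
    unfolding cj_w using t by (simp add: cj_y1 cj_plus 1 2 3 cj_y3)
qed

lemma cj_w_il:
  assumes t: "tri i j l" and uv: "[u * v = 1] (mod q)"
  shows "cj (w i j u v) (y i l b) = y j l (- (v * b))"
proof -
  have 1: "cj (y j i (- v)) (y i l b) = y j l (- (v * b)) + y i l b"
    using cj_y1[of j i l "-v" b] t by (simp add: tri_def)
  have 2: "cj (y i j u) (y j l (- (v * b))) = y i l (- b) + y j l (- (v * b))"
    using cj_y1[of i j l u "- (v * b)"] t y_cong[of i l j "- (u * (v * b))" "- b"] mul_inv_cong(3)[OF uv]
    by (simp add: tri_def)
  have 3: "y i l (- b) + y j l (- (v * b)) + y i l b = y j l (- (v * b))"
    using y_col[of i l j "-b" "- (v * b)"] t y_minus[of i l j b] by (simp add: tri_def add.assoc)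
  show ?thesis
    unfolding cj_w using t by (simp add: cj_y3 cj_plus 1 2 3)
qed

lemma cj_w_li:
  assumes t: "tri i j l" and uv: "[u * v = 1] (mod q)"
  shows "cj (w i j u v) (y l i b) = y l j (- (u * b))"
proof -
  have 1: "cj (y j i (- v)) (y l j (- (u * b))) = y l i (- b) + y l j (- (u * b))"
    using cj_y2[of j i l "-v" "- (u * b)"] t y_cong[of l i j "- (v * (u * b))" "- b"] mul_inv_cong(4)[OF uv]
    by (simp add: tri_def)
  have 2: "cj (y j i (- v)) (y l i b) = y l i b"
    using cj_y4[of j i l] t by (simp add: tri_def)
  have 3: "y l i (- b) + y l j (- (u * b)) + y l i b = y l j (- (u * b))"
    using y_row[of l i j "-b" "- (u * b)"] t y_minus[of l i j b] by (simp add: tri_def add.assoc)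
  show ?thesis
    unfolding cj_w using t by (simp add: cj_y2 cj_plus 1 2 3 cj_y4)
qed

lemma cj_w_lj:
  assumes t: "tri i j l" and uv: "[u * v = 1] (mod q)"
  shows "cj (w i j u v) (y l j b) = y l i (v * b)"
proof -
  have 1: "cj (y j i (- v)) (y l j b) = y l i (v * b) + y l j b"
    using cj_y2[of j i l "-v" b] t by (simp add: tri_def)
  have 2: "cj (y i j u) (y l i (v * b)) = y l j (- b) + y l i (v * b)"
    using cj_y2[of i j l u "v * b"] t y_cong[of l j i "- (u * (v * b))" "- b"] mul_inv_cong(3)[OF uv]
    by (simp add: tri_def)
  have 3: "y l j (- b) + y l i (v * b) + y l j b = y l i (v * b)"
    using y_row[of l j i "-b" "v * b"] t y_minus[of l j i b] by (simp add: tri_def add.assoc)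
  show ?thesis
    unfolding cj_w using t by (simp add: cj_y4 cj_plus 1 2 3)
qed

text \<open>Rank two enters here. Opposite roots satisfy no relation of their own; statements about
  them come from applying known actions to the two factors of this commutator.\<close>

lemma y_commutator: assumes "tri i j l" shows "y i j (a * b) = y i l a + y l j b - y i l a - y l j b"
  using y_comm[of i l j a b] assms by (simp add: tri_def diff_conv_add_uminus add.assoc del: add_uminus_conv_diff)

lemma cj_w_ij:
  assumes t: "tri i j l" and uv: "[u * v = 1] (mod q)"
  shows "cj (w i j u v) (y i j b) = y j i (- (v * v * b))"
proof -
  have "y i j b = y i l b + y l j 1 - y i l b - y l j 1"
    using y_commutator[OF t, of b 1] by simp
  then have "cj (w i j u v) (y i j b) = y j l (- (v * b)) + y l i v - y j l (- (v * b)) - y l i v"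
    using assms by (simp add: cj_plus cj_minus cj_w_il cj_w_lj)
  also have "\<dots> = y j i (- (v * b) * v)"
    using y_commutator[of j i l "- (v * b)" v] t by (simp add: tri_def)
  finally show ?thesis by (simp add: mult_ac)
qed

lemma cj_w_ji:
  assumes t: "tri i j l" and uv: "[u * v = 1] (mod q)"
  shows "cj (w i j u v) (y j i b) = y i j (- (u * u * b))"
proof -
  have "y j i b = y j l b + y l i 1 - y j l b - y l i 1"
    using y_commutator[of j i l b 1] t by (simp add: tri_def)
  then have "cj (w i j u v) (y j i b) = y i l (u * b) + y l j (- u) - y i l (u * b) - y l j (- u)"
    using assms by (simp add: cj_plus cj_minus cj_w_jl cj_w_li)
  also have "\<dots> = y i j (u * b * - u)"
    using y_commutator[of i j l "u * b" "- u"] t by (simp add: tri_def)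
  finally show ?thesis by (simp add: mult_ac)
qed

text \<open>An element is fixed by conjugation with itself, while conjugation by
  \<open>w i j u v\<close> exchanges the two root groups in its definition.\<close>

lemma w_flip:
  assumes t: "tri i j l" and uv: "[u * v = 1] (mod q)"
  shows "w i j u v = w j i (- v) (- u)"
proof -
  have "w i j u v = cj (w i j u v) (w i j u v)" by (simp add: cj_self)
  also have "\<dots> = y j i (- (v * v * u)) + y i j (u * u * v) + y j i (- (v * v * u))"
    using assms by (subst (2) w_def) (simp add: cj_plus cj_w_ij cj_w_ji)
  also have "y j i (- (v * v * u)) = y j i (- v)"
    using y_cong[of j i l "- (v * v * u)" "-v"] t mul_inv_cong(4)[OF uv, of v] by (simp add: tri_def mult_ac)
  also have "y i j (u * u * v) = y i j u"
    using y_cong[of i j l "u * u * v" u] t mul_inv_cong(1)[OF uv, of u] by (simp add: tri_def mult_ac)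
  finally show ?thesis by (simp add: w_def)
qed

lemma w_uminus: assumes t: "tri i j l" shows "w i j (- u) (- v) = - w i j u v"
  using assms by (simp add: w_def y_minus[of i j l] y_minus[of j i l] tri_def minus_add add.assoc diff_conv_add_uminus
      del: add_uminus_conv_diff)

section \<open>Torus elements and the Steinberg symbol\<close>

definition iv :: "int \<Rightarrow> int" where "iv u = (SOME v. [u * v = 1] (mod q))"

lemma iv: "coprime u q \<Longrightarrow> [u * iv u = 1] (mod q)"
  unfolding iv_def by (rule someI_ex) (rule cong_solve_coprime_int)

lemma iv': "coprime u q \<Longrightarrow> [iv u * u = 1] (mod q)"
  using iv[of u] by (simp add: mult.commute)

lemma unitI: "[u * v = 1] (mod q) \<Longrightarrow> coprime u q"
  using coprime_iff_invertible_int[of u q] by blast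

lemma coprime_iv: "coprime u q \<Longrightarrow> coprime (iv u) q"
  using unitI[OF iv'] .

lemma inverse_unique:
  assumes "[u * v = 1] (mod q)" "[u' * v' = 1] (mod q)" "[u = u'] (mod q)"
  shows "[v = v'] (mod q)"
proof -
  have "[u * v = u * v'] (mod q)"
    by (metis assms cong_mult cong_refl cong_sym cong_trans)
  then show ?thesis
    using unitI[OF assms(1)] cong_mult_lcancel by blast
qed

definition W :: "nat \<Rightarrow> nat \<Rightarrow> int \<Rightarrow> 'g" where "W i j u = w i j u (iv u)"

lemma W_eq:
  assumes t: "tri i j l" and "[u * v = 1] (mod q)" "[u = u'] (mod q)"
  shows "W i j u' = w i j u v"
proof -
  have "[u' * v = 1] (mod q)"
    using assms by (metis cong_mult cong_refl cong_sym cong_trans)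
  then have "[iv u' = v] (mod q)"
    using inverse_unique[OF iv _ cong_refl] unitI by blast
  then have "y j i (- iv u') = y j i (- v)"
    using y_cong[of j i l] t by (simp add: tri_def cong_minus_minus_iff)
  then show ?thesis
    using y_cong[OF t assms(3)] by (simp add: W_def w_def)
qed

lemma W_cong: "tri i j l \<Longrightarrow> coprime u q \<Longrightarrow> [u = u'] (mod q) \<Longrightarrow> W i j u = W i j u'"
  using W_eq[OF _ iv] W_def by metis

lemma W_uminus:
  assumes "tri i j l" "coprime u q" shows "W i j (- u) = - W i j u"
proof -
  have "W i j (- u) = w i j (- u) (- iv u)"
    using assms iv by (intro W_eq[OF assms(1)]) auto
  then show ?thesis using w_uminus[OF assms(1)] by (simp add: W_def)
qed

text \<open>In matrices the diagonal matrix with \<open>u\<close> and 1/u in the places i and j. The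
  second Weyl element normalises it to vanish at \<open>u = 1\<close>.\<close>

definition h :: "nat \<Rightarrow> nat \<Rightarrow> int \<Rightarrow> 'g" where "h i j u = W i j u + W i j (- 1)"

lemma W_m1: "tri i j l \<Longrightarrow> W i j (- 1) = w i j (- 1) (- 1)"
  by (rule W_eq) auto

lemma h_cong: "tri i j l \<Longrightarrow> coprime u q \<Longrightarrow> [u = u'] (mod q) \<Longrightarrow> h i j u = h i j u'"
  using W_cong by (metis h_def)

lemma h_one: assumes "tri i j l" shows "h i j 1 = 0"
  using W_uminus[OF assms, of 1] by (simp add: h_def)

lemma cj_h:
  assumes t: "tri i j l" and u: "coprime u q"
  shows "cj (h i j u) (y i j a) = y i j (u * u * a)"
    and "cj (h i j u) (y j i a) = y j i (iv u * iv u * a)"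
    and "cj (h i j u) (y i l a) = y i l (u * a)"
    and "cj (h i j u) (y j l a) = y j l (iv u * a)"
    and "cj (h i j u) (y l i a) = y l i (iv u * a)"
    and "cj (h i j u) (y l j a) = y l j (u * a)"
proof -
  have "[(- 1) * (- 1) = 1] (mod q)" by simp
  moreover have "cj (h i j u) x = cj (w i j u (iv u)) (cj (w i j (- 1) (- 1)) x)" for x
    using W_m1[OF t] by (simp add: h_def cj_cj W_def[of i j u])
  ultimately show "cj (h i j u) (y i j a) = y i j (u * u * a)"
    and "cj (h i j u) (y j i a) = y j i (iv u * iv u * a)"
    and "cj (h i j u) (y i l a) = y i l (u * a)"
    and "cj (h i j u) (y j l a) = y j l (iv u * a)"
    and "cj (h i j u) (y l i a) = y l i (iv u * a)"
    and "cj (h i j u) (y l j a) = y l j (u * a)"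
    using iv[OF u] t by (simp_all add: cj_w_ij cj_w_ji cj_w_il cj_w_jl cj_w_li cj_w_lj)
qed

text \<open>The Steinberg symbol, which measures the failure of \<open>h 0 1\<close> to be multiplicative.\<close>

definition c :: "int \<Rightarrow> int \<Rightarrow> 'g" where "c u v = - h 0 1 (u * v) + h 0 1 u + h 0 1 v"

text \<open>The centralizer of the root elements in the ambient group, which may be larger than the
  group they generate.\<close>

definition Cen :: "'g set" where "Cen = {x. \<forall>i j l a. tri i j l \<longrightarrow> x + y i j a = y i j a + x}"

lemma tri012: "tri 0 1 2" "tri 0 2 1" "tri 1 0 2"
  by (auto simp: tri_def)

lemma CenI:
  assumes "\<And>a. cj x (y 0 1 a) = y 0 1 a" "\<And>a. cj x (y 1 0 a) = y 1 0 a" "\<And>a. cj x (y 0 2 a) = y 0 2 a"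
    "\<And>a. cj x (y 1 2 a) = y 1 2 a" "\<And>a. cj x (y 2 0 a) = y 2 0 a" "\<And>a. cj x (y 2 1 a) = y 2 1 a"
  shows "x \<in> Cen"
proof -
  have "x + y i j a = y i j a + x" if "tri i j l" for i j l a
  proof -
    have "i = 0 \<and> j = 1 \<or> i = 1 \<and> j = 0 \<or> i = 0 \<and> j = 2 \<or> i = 1 \<and> j = 2 \<or> i = 2 \<and> j = 0 \<or> i = 2 \<and> j = 1"
      using that by (auto simp: tri_def less_Suc_eq numeral_3_eq_3)
    then show ?thesis using assms by (auto simp: cj_id_iff)
  qed
  then show ?thesis unfolding Cen_def by blast
qed

lemma cj_uminus_cj: "cj (- g) (cj g x) = x"
  by (simp flip: cj_cj) (simp add: cj_def)

lemma iv_mult: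
  assumes "coprime u q" "coprime v q" shows "[iv (u * v) = iv u * iv v] (mod q)"
proof (rule inverse_unique)
  show "[u * v * iv (u * v) = 1] (mod q)" using assms by (intro iv) auto
  show "[u * v * (iv u * iv v) = 1] (mod q)"
    using cong_mult[OF iv[OF assms(1)] iv[OF assms(2)]] by (simp add: mult_ac)
qed simp

text \<open>\<open>h 0 1 u + h 0 1 v\<close> and \<open>h 0 1 (u * v)\<close> scale each root
  element by the same unit, so their quotient commutes with all root elements.\<close>

lemma c_Cen:
  assumes u: "coprime u q" and v: "coprime v q"
  shows "c u v \<in> Cen"
proof -
  have uv: "coprime (u * v) q" using u v by simp
  have i1: "[iv u * (iv v * a) = iv (u * v) * a] (mod q)" for a
    using cong_sym[OF cong_mult[OF iv_mult[OF u v] cong_refl[of a]]] by (simp add: mult.assoc)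
  have i2: "[iv u * iv u * (iv v * iv v * a) = iv (u * v) * iv (u * v) * a] (mod q)" for a
    using cong_sym[OF cong_mult[OF cong_mult[OF iv_mult[OF u v] iv_mult[OF u v]] cong_refl[of a]]]
    by (simp add: mult_ac)
  note t = tri012(1)
  have "cj (c u v) x = x" if "cj (h 0 1 u) (cj (h 0 1 v) x) = cj (h 0 1 (u * v)) x" for x
    using that by (simp add: c_def cj_cj cj_uminus_cj)
  then have *: "cj (c u v) (y i j a) = y i j a"
    if "cj (h 0 1 u) (cj (h 0 1 v) (y i j a)) = cj (h 0 1 (u * v)) (y i j a)" for i j a
    using that by blast
  have "y 1 0 (iv u * iv u * (iv v * iv v * a)) = y 1 0 (iv (u * v) * iv (u * v) * a)"
    "y 1 2 (iv u * (iv v * a)) = y 1 2 (iv (u * v) * a)"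
    "y 2 0 (iv u * (iv v * a)) = y 2 0 (iv (u * v) * a)" for a
    using y_cong[OF tri012(3) i2] y_cong[OF _ i1, of 1 2 0] y_cong[OF _ i1, of 2 0 1]
    by (simp_all add: tri_def)
  moreover have "u * u * (v * v * a) = u * v * (u * v) * a" "u * (v * a) = u * v * a" for a
    by (simp_all only: mult_ac)
  ultimately show ?thesis
    by (intro CenI *) (simp_all only: cj_h[OF t u] cj_h[OF t v] cj_h[OF t uv])
qed

lemma Cen_plus: "x \<in> Cen \<Longrightarrow> x' \<in> Cen \<Longrightarrow> x + x' \<in> Cen"
  unfolding Cen_def by (simp add: add.assoc) (simp flip: add.assoc)

lemma Cen_0: "0 \<in> Cen" unfolding Cen_def by simp

lemma Cen_y: "x \<in> Cen \<Longrightarrow> tri i j l \<Longrightarrow> x + y i j a = y i j a + x"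
  unfolding Cen_def by blast

lemma comm_uminus:
  fixes x :: "'a::group_add"
  shows "x + a = a + x \<Longrightarrow> x + - a = - a + x"
proof -
  assume "x + a = a + x"
  then have "- a + (x + a) + - a = - a + (a + x) + - a" by simp
  then show ?thesis by (simp add: add.assoc del: add_uminus_conv_diff)
qed

lemma Cen_W: assumes "x \<in> Cen" "tri i j l" shows "x + W i j u = W i j u + x"
  using Cen_y[OF assms(1), of i j l] Cen_y[OF assms(1), of j i l] assms(2)
  by (auto simp: W_def w_def tri_def intro!: comm_plus)

lemma Cen_h: assumes "x \<in> Cen" "tri i j l" shows "x + h i j u = h i j u + x"
  using Cen_W[OF assms] by (auto simp: h_def intro!: comm_plus)

lemma Cen_c: assumes "x \<in> Cen" shows "x + c u v = c u v + x"
  using Cen_h[OF assms tri012(1)] by (auto simp: c_def intro!: comm_plus comm_uminus)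

lemma Cen_uminus: "x \<in> Cen \<Longrightarrow> - x \<in> Cen"
  unfolding Cen_def using comm_uminus[of "y i j a" x for i j a] by (auto simp del: add_uminus_conv_diff)

lemma h_h: "h 0 1 u + h 0 1 v = h 0 1 (u * v) + c u v"
  by (simp add: c_def add.assoc)

lemma cj_h2_W:
  assumes "coprime u q" "coprime v q"
  shows "cj (h 0 2 v) (W 0 1 u) = W 0 1 (v * u)"
proof -
  have "cj (h 0 2 v) (W 0 1 u) = w 0 1 (v * u) (iv v * iv u)"
    using cj_h[OF tri012(2) assms(2)] by (simp add: W_def w_def cj_plus)
  also have "\<dots> = W 0 1 (v * u)"
    using cong_mult[OF iv[OF assms(1)] iv[OF assms(2)]]
    by (intro W_eq[OF tri012(1), symmetric]) (simp_all add: mult_ac)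
  finally show ?thesis .
qed

text \<open>Up to sign the symbol is the commutator of torus elements along two different roots:
  \<open>h 0 2 v\<close> acts on \<open>W 0 1\<close> by multiplying its argument by
  \<open>v\<close>. This description of \<open>c\<close> is what makes it bimultiplicative.\<close>

lemma cj_h2_h:
  assumes u: "coprime u q" and v: "coprime v q"
  shows "cj (h 0 2 v) (h 0 1 u) = h 0 1 u - c u v"
proof -
  have "cj (h 0 2 v) (h 0 1 u) = W 0 1 (v * u) + W 0 1 (- v)"
    using cj_h2_W[OF u v] cj_h2_W[OF _ v, of "-1"] by (simp add: h_def cj_plus)
  also have "\<dots> = h 0 1 (v * u) - h 0 1 v"
    using W_uminus[OF tri012(1) v]
    by (simp add: h_def diff_conv_add_uminus minus_add add.assoc del: add_uminus_conv_diff)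
  also have "\<dots> = h 0 1 u + h 0 1 v - c u v - h 0 1 v"
    by (simp add: h_h mult.commute)
  also have "\<dots> = h 0 1 u + (- c u v + h 0 1 v) - h 0 1 v"
    using Cen_h[OF Cen_uminus[OF c_Cen[OF u v]] tri012(1), of v]
    by (simp add: diff_conv_add_uminus add.assoc del: add_uminus_conv_diff)
  finally show ?thesis by (simp add: diff_conv_add_uminus add.assoc del: add_uminus_conv_diff)
qed

text \<open>Conjugation by \<open>h 0 2 v\<close> is a homomorphism that fixes the central element
  \<open>c u u'\<close>; it is applied to both sides of \<open>h_h\<close> for \<open>u\<close> and
  \<open>u'\<close>.\<close>

lemma c_mult_left:
  assumes u: "coprime u q" and u': "coprime u' q" and v: "coprime v q"
  shows "c (u * u') v = c u v + c u' v"
proof -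
  let ?h = "h 0 1" and ?g = "cj (h 0 2 v)"
  have C: "c (u * u') v \<in> Cen" "c u v \<in> Cen" "c u' v \<in> Cen" "c u u' \<in> Cen"
    using assms by (simp_all add: c_Cen)
  have cc: "?g (c u u') = c u u'"
    using Cen_h[OF C(4) tri012(2)] by (simp add: cj_id_iff)
  have "?h (u * u') - c (u * u') v + c u u' = ?g (?h (u * u') + c u u')"
    using cj_h2_h[of "u * u'" v] assms by (simp add: cj_plus cc)
  also have "\<dots> = ?h u - c u v + (?h u' - c u' v)"
    using assms by (simp add: h_h[symmetric] cj_plus cj_h2_h)
  also have "\<dots> = ?h u + (- c u v + ?h u') - c u' v"
    by (simp add: diff_conv_add_uminus add.assoc del: add_uminus_conv_diff)
  also have "\<dots> = ?h (u * u') + c u u' - c u v - c u' v"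
    using Cen_h[OF Cen_uminus[OF C(2)] tri012(1), of u']
    by (simp add: h_h diff_conv_add_uminus add.assoc[symmetric] del: add_uminus_conv_diff)
  finally have "- c (u * u') v + c u u' = c u u' + (- c u v - c u' v)"
    by (simp add: diff_conv_add_uminus add.assoc del: add_uminus_conv_diff)
  also have "\<dots> = - c u v - c u' v + c u u'"
    using comm_plus[OF comm_uminus[OF Cen_c[OF C(4), of u v]] comm_uminus[OF Cen_c[OF C(4), of u' v]]]
    by (simp add: diff_conv_add_uminus del: add_uminus_conv_diff)
  finally have "- c (u * u') v = - c u v - c u' v" by simp
  then have "c (u * u') v = - (- c u v - c u' v)" by (metis minus_minus)
  also have "\<dots> = c u' v + c u v" by simp
  finally show ?thesis using Cen_c[OF C(2)] by simp
qed

text \<open>Conjugation by \<open>h 0 2 (v * v')\<close> and successive conjugation by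
  \<open>h 0 2 v'\<close> and \<open>h 0 2 v\<close> agree on \<open>W 0 1\<close>, hence on
  \<open>h 0 1 u\<close>, even where the torus elements themselves differ.\<close>

lemma c_mult_right:
  assumes u: "coprime u q" and v: "coprime v q" and v': "coprime v' q"
  shows "c u (v * v') = c u v + c u v'"
proof -
  have C: "c u v \<in> Cen" "c u v' \<in> Cen"
    using assms by (simp_all add: c_Cen)
  have cc: "cj (h 0 2 v) (c u v') = c u v'"
    using Cen_h[OF C(2) tri012(2)] by (simp add: cj_id_iff)
  have "cj (h 0 2 v) (cj (h 0 2 v') (W 0 1 a)) = cj (h 0 2 (v * v')) (W 0 1 a)" if "coprime a q" for a
    using assms that by (simp add: cj_h2_W mult_ac)
  then have "cj (h 0 2 (v * v')) (h 0 1 u) = cj (h 0 2 v) (cj (h 0 2 v') (h 0 1 u))"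
    using u by (simp add: h_def cj_plus)
  then have "h 0 1 u - c u (v * v') = h 0 1 u - c u v - c u v'"
    using assms by (simp add: cj_h2_h cj_minus cc)
  then have "- c u (v * v') = - c u v - c u v'"
    by (simp add: diff_conv_add_uminus add.assoc del: add_uminus_conv_diff)
  then have "c u (v * v') = - (- c u v - c u v')" by (metis minus_minus)
  also have "\<dots> = c u v' + c u v" by simp
  finally show ?thesis using Cen_c[OF C(1)] by simp
qed

lemma c_cong:
  assumes "coprime u q" "coprime v q" "[u = u'] (mod q)" "[v = v'] (mod q)"
  shows "c u v = c u' v'"
  using h_cong[OF tri012(1)] assms cong_mult[OF assms(3,4)] by (simp add: c_def)

lemma c_one: "c 1 v = 0" "c v 1 = 0"
  using h_one[OF tri012(1)] by (simp_all add: c_def)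

end

section \<open>Units modulo a prime power\<close>

text \<open>For odd \<open>p\<close> a primitive root together with 1; for \<open>p = 2\<close> the
  pair -1 and 5, the case that calls for two generators.\<close>

lemma units_two_generated:
  fixes p e :: nat
  assumes p: "prime p" and e: "e > 0"
  shows "\<exists>g g' :: int. coprime g (int (p ^ e)) \<and> coprime g' (int (p ^ e)) \<and>
    (\<forall>u. coprime u (int (p ^ e)) \<longrightarrow> (\<exists>i j. [u = g ^ i * g' ^ j] (mod int (p ^ e))))"
proof -
  let ?q = "p ^ e"
  have q1: "?q > 1" using one_less_power[OF prime_gt_1_nat[OF p] e] .
  then have q0: "int ?q > 0" by (simp only: of_nat_0_less_iff)
  have red: "\<exists>n. n \<in> totatives ?q \<and> [u = int n] (mod int ?q)" if u: "coprime u (int ?q)" for u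
  proof -
    define n where "n = nat (u mod int ?q)"
    have n: "int n = u mod int ?q" using pos_mod_sign[OF q0, of u] by (simp add: n_def del: of_nat_power)
    have "coprime (int n) (int ?q)" using u q0 by (simp add: n del: of_nat_power)
    then have c: "coprime n ?q" by simp
    moreover have "n \<le> ?q"
    proof -
      have "int n < int ?q" unfolding n by (rule pos_mod_bound[OF q0])
      then show ?thesis unfolding of_nat_less_iff by (rule less_imp_le)
    qed
    moreover have "n > 0" using c q1 by (cases "n = 0") auto
    ultimately show ?thesis using n by (intro exI[of _ n]) (auto simp: in_totatives_iff unique_euclidean_semiring_class.cong_def)
  qed
  show ?thesis
  proof (cases "odd p")
    case True
    obtain g where "\<forall>k>0. residue_primroot (p ^ k) g"
      using residue_primroot_odd_prime_power_exists[OF p True] by blast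
    then have g: "residue_primroot ?q g" using e by blast
    then have cg: "coprime g ?q" by (simp add: residue_primroot_def coprime_commute)
    have "\<exists>i. [u = int g ^ i * 1 ^ 0] (mod int ?q)" if u: "coprime u (int ?q)" for u
    proof -
      obtain n where n: "n \<in> totatives ?q" "[u = int n] (mod int ?q)" using red[OF u] by blast
      then have "n \<in> (\<lambda>i. g ^ i mod ?q) ` {..<totient ?q}"
        using bij_betw_imp_surj_on[OF residue_primroot_is_generator[OF q1 g]] by simp
      then obtain i where "n = g ^ i mod ?q" by blast
      then have "[n = g ^ i] (mod ?q)" by (simp add: unique_euclidean_semiring_class.cong_def)
      then have "[int n = int g ^ i] (mod int ?q)" by (metis cong_int_iff of_nat_power)
      then show ?thesis using cong_trans[OF n(2)] by auto
    qed
    then have "\<forall>u. coprime u (int ?q) \<longrightarrow> (\<exists>i j. [u = int g ^ i * 1 ^ j] (mod int ?q))"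
      by metis
    moreover have "coprime (int g) (int ?q)" using cg by simp
    moreover have "coprime (1 :: int) (int ?q)" by simp
    ultimately show ?thesis by metis
  next
    case False
    then have p2: "p = 2" using primes_dvd_imp_eq[of 2 p] p two_is_prime_nat by auto
    have c5: "coprime (5 :: int) (int ?q)" by (simp add: p2 coprime_power_right_iff)
    have cm: "coprime (- 1 :: int) (int ?q)" by simp
    have "\<exists>i j. [u = (- 1) ^ i * 5 ^ j] (mod int ?q)" if u: "coprime u (int ?q)" for u
    proof -
      have odd: "odd u" using u e by (simp add: p2 coprime_power_right_iff)
      consider "e = 1" | "e = 2" | "e \<ge> 3" using e by linarith
      then show ?thesis
      proof cases
        case 1
        then show ?thesis using odd by (intro exI[of _ 0]) (simp add: p2 unique_euclidean_semiring_class.cong_def odd_iff_mod_2_eq_one)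
      next
        case 2
        have "u mod 4 = 1 \<or> u mod 4 = 3" using odd by presburger
        then show ?thesis
        proof
          assume "u mod 4 = 1"
          then show ?thesis using 2 by (intro exI[of _ 0]) (simp add: p2 unique_euclidean_semiring_class.cong_def)
        next
          assume "u mod 4 = 3"
          then show ?thesis using 2 by (intro exI[of _ 1] exI[of _ 0]) (simp add: p2 unique_euclidean_semiring_class.cong_def)
        qed
      next
        case 3
        \<comment> \<open>The powers of 5 are congruent to 1 modulo 4, and there are 2^(e-2) of
          them, as many as there are such residues. So they exhaust these residues, and the factor
          -1 accounts for the residues 3 modulo 4.\<close>
        let ?A = "(\<lambda>j. 5 ^ j mod ?q) ` {..<2 ^ (e - 2)}"
        have o: "ord ?q 5 = 2 ^ (e - 2)" using ord_twopow_3_5[OF 3, of 5] by (simp add: p2)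
        have "coprime ?q 5" by (simp add: p2)
        then have inj: "inj_on (\<lambda>j. 5 ^ j mod ?q) {..<2 ^ (e - 2)}"
          using inj_power_mod[of ?q 5] by (simp add: o)
        let ?B = "{n. n < ?q \<and> n mod 4 = 1}"
        have m4: "4 dvd ?q" using 3 le_imp_power_dvd[of 2 e "2::nat"] by (simp add: p2)
        have "?B \<subseteq> (\<lambda>t. 4 * t + 1) ` {..<2 ^ (e - 2)}"
        proof
          fix n assume n: "n \<in> ?B"
          then have "n = 4 * (n div 4) + 1" by auto presburger
          moreover have "n div 4 < 2 ^ (e - 2)"
          proof -
            have "2 + (e - 2) = e" using 3 by linarith
            then have "(2::nat) ^ e = 2 ^ (2 + (e - 2))" by (simp only:)
            also have "\<dots> = 4 * 2 ^ (e - 2)" by (simp only: power_add) simp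
            finally have "?q = 4 * 2 ^ (e - 2)" by (simp only: p2)
            then show ?thesis using n by auto
          qed
          ultimately show "n \<in> (\<lambda>t. 4 * t + 1) ` {..<2 ^ (e - 2)}" by blast
        qed
        from surj_card_le[OF finite_lessThan this] have cB: "card ?B \<le> 2 ^ (e - 2)" by simp
        have fB: "finite ?B" by simp
        have sub: "?A \<subseteq> ?B"
        proof
          fix n assume "n \<in> ?A"
          then obtain j where j: "n = 5 ^ j mod ?q" by blast
          have "n mod 4 = 5 ^ j mod 4" using j m4 by (simp add: mod_mod_cancel)
          also have "\<dots> = (5 mod 4) ^ j mod 4" by (simp only: power_mod)
          finally have "n mod 4 = 1" by simp
          moreover have "n < ?q" unfolding j by (rule mod_less_divisor) (use q1 in linarith)
          ultimately show "n \<in> ?B" by simp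
        qed
        have AB: "?A = ?B"
          using card_image[OF inj] cB by (intro card_seteq[OF fB sub]) simp
        have key: "\<exists>j. [v = 5 ^ j] (mod int ?q)" if v: "v mod 4 = 1" for v :: int
        proof -
          define n where "n = nat (v mod int ?q)"
          have n: "int n = v mod int ?q" using pos_mod_sign[OF q0, of v] by (simp add: n_def del: of_nat_power)
          have "int n mod 4 = 1"
          proof -
            have "int 4 dvd int ?q" using m4 by (simp only: of_nat_dvd_iff)
            from mod_mod_cancel[OF this, of v] show ?thesis using v n by simp
          qed
          then have "n mod 4 = 1" by presburger
          moreover have "n < ?q"
          proof -
            have "int n < int ?q" unfolding n by (rule pos_mod_bound[OF q0])
            then show ?thesis unfolding of_nat_less_iff .
          qed
          ultimately have "n \<in> ?A" unfolding AB by blast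
          then obtain j where "n = 5 ^ j mod ?q" by blast
          then have "int n = 5 ^ j mod int ?q" by (simp add: of_nat_mod)
          then show ?thesis using n by (metis unique_euclidean_semiring_class.cong_def)
        qed
        have "u mod 4 = 1 \<or> u mod 4 = 3" using odd by presburger
        then show ?thesis
        proof
          assume "u mod 4 = 1"
          then obtain j where "[u = 5 ^ j] (mod int ?q)" using key by blast
          then show ?thesis by (intro exI[of _ 0] exI[of _ j]) simp
        next
          assume "u mod 4 = 3"
          then have "(- u) mod 4 = 1" by presburger
          then obtain j where "[- u = 5 ^ j] (mod int ?q)" using key by blast
          then have "[u = - (5 ^ j)] (mod int ?q)"
            by (metis cong_minus_minus_iff minus_minus)
          then show ?thesis by (intro exI[of _ 1] exI[of _ j]) simp
        qed
      qed
    qed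
    then have "\<forall>u. coprime u (int ?q) \<longrightarrow> (\<exists>i j. [u = (- 1) ^ i * 5 ^ j] (mod int ?q))"
      by blast
    with c5 cm show ?thesis by metis
  qed
qed

lemma euler_int:
  fixes u :: int and m :: nat
  assumes "coprime u (int m)" "m > 0"
  shows "[u ^ totient m = 1] (mod int m)"
proof -
  define n where "n = nat (u mod int m)"
  have n: "int n = u mod int m" using assms by (simp add: n_def)
  have "coprime (int n) (int m)" using assms by (simp add: n)
  then have "coprime n m" by simp
  then have "[n ^ totient m = 1] (mod m)" by (rule euler_theorem)
  then have "[int n ^ totient m = 1] (mod int m)"
    by (metis cong_int_iff of_nat_1 of_nat_power)
  moreover have "[u = int n] (mod int m)" by (simp add: n unique_euclidean_semiring_class.cong_def)
  ultimately show ?thesis using cong_pow cong_trans by blast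
qed

section \<open>Multiples and sums of sets in a noncommutative monoid\<close>

primrec nat_scale :: "nat \<Rightarrow> 'a::monoid_add \<Rightarrow> 'a" where
  "nat_scale 0 x = 0"
| "nat_scale (Suc n) x = x + nat_scale n x"

lemma nat_scale_add: "nat_scale (m + n) x = nat_scale m x + nat_scale n x"
  by (induction m) (simp_all add: add.assoc)

lemma nat_scale_mod: "nat_scale N x = 0 \<Longrightarrow> nat_scale (n mod N) x = nat_scale n x"
proof -
  assume "nat_scale N x = 0"
  then have "nat_scale (N * t) x = 0" for t by (induction t) (simp_all add: nat_scale_add)
  then show ?thesis using nat_scale_add[of "N * (n div N)" "n mod N" x] by simp
qed

lemma nat_scale_commute: "x + z = z + x \<Longrightarrow> nat_scale n x + z = z + nat_scale n x"
  by (induction n) (simp_all add: add.assoc, metis add.assoc)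

lemma card_multiples:
  fixes x :: "'a::monoid_add"
  assumes "nat_scale N x = 0" "N > 0"
  shows "finite (range (\<lambda>n. nat_scale n x)) \<and> card (range (\<lambda>n. nat_scale n x)) \<le> N"
proof -
  have "range (\<lambda>n. nat_scale n x) \<subseteq> (\<lambda>n. nat_scale n x) ` {..<N}"
    using nat_scale_mod[OF assms(1)] assms(2) by (metis (no_types, lifting) image_eqI image_subsetI lessThan_iff mod_less_divisor)
  from finite_surj[OF _ this] surj_card_le[OF _ this] show ?thesis by simp
qed

definition sumset :: "'a::plus set \<Rightarrow> 'a set \<Rightarrow> 'a set" where
  "sumset A B = (\<lambda>(a, b). a + b) ` (A \<times> B)"

lemma sumsetI: "a \<in> A \<Longrightarrow> b \<in> B \<Longrightarrow> a + b \<in> sumset A B"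
  by (auto simp: sumset_def)

lemma sumsetE: assumes "x \<in> sumset A B" obtains a b where "a \<in> A" "b \<in> B" "x = a + b"
  using assms by (auto simp: sumset_def)

lemma finite_sumset: "finite A \<Longrightarrow> finite B \<Longrightarrow> finite (sumset A B)"
  by (simp add: sumset_def)

lemma card_sumset:
  assumes "finite A" "finite B" "card A \<le> m" "card B \<le> n" shows "card (sumset A B) \<le> m * n"
proof -
  have "card (sumset A B) \<le> card (A \<times> B)" unfolding sumset_def using assms by (intro card_image_le) simp
  also have "\<dots> \<le> m * n" using assms by (simp add: card_cartesian_product mult_le_mono)
  finally show ?thesis .
qed

lemma sumset_commuting_closed:
  fixes A B :: "'a::monoid_add set"
  assumes "\<And>a a'. a \<in> A \<Longrightarrow> a' \<in> A \<Longrightarrow> a + a' \<in> A" "\<And>b b'. b \<in> B \<Longrightarrow> b' \<in> B \<Longrightarrow> b + b' \<in> B"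
    and comm: "\<And>a b. a \<in> A \<Longrightarrow> b \<in> B \<Longrightarrow> a + b = b + a"
    and "x \<in> sumset A B" "x' \<in> sumset A B"
  shows "x + x' \<in> sumset A B"
proof -
  obtain a b where x: "a \<in> A" "b \<in> B" "x = a + b" using assms(4) by (rule sumsetE)
  obtain a' b' where x': "a' \<in> A" "b' \<in> B" "x' = a' + b'" using assms(5) by (rule sumsetE)
  have "x + x' = a + (b + a') + b'" unfolding x x' by (simp add: add.assoc)
  also have "\<dots> = (a + a') + (b + b')" unfolding comm[OF x'(1) x(2), symmetric] by (simp add: add.assoc)
  finally show ?thesis using assms(1)[OF x(1) x'(1)] assms(2)[OF x(2) x'(2)] by (simp add: sumsetI)
qed

section \<open>Prime power modulus: the finite group of symbols\<close>

locale steinberg_prime_power = steinberg +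
  fixes p e :: nat
  assumes prime_p: "prime p" and e_pos: "e > 0" and q_eq: "q = int (p ^ e)"
begin

declare One_nat_def [simp del]

lemma unit_iff: "coprime u q \<longleftrightarrow> \<not> int p dvd u"
proof -
  have "coprime u q \<longleftrightarrow> coprime u (int p)" using e_pos by (simp add: q_eq)
  also have "\<dots> \<longleftrightarrow> \<not> int p dvd u"
    using prime_p by (metis coprime_commute prime_nat_int_transfer prime_imp_coprime coprime_absorb_left not_prime_unit)
  finally show ?thesis .
qed

definition \<phi> :: nat where "\<phi> = totient (p ^ e)"

lemma phi: "0 < \<phi>" "\<phi> \<le> nat q"
  using prime_gt_0_nat[OF prime_p] by (simp_all add: \<phi>_def q_eq totient_le del: of_nat_power)

lemma unit_power: "coprime u q \<Longrightarrow> [u ^ \<phi> = 1] (mod q)"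
  unfolding \<phi>_def q_eq using prime_gt_0_nat[OF prime_p] by (intro euler_int) auto

lemma c_power_left: assumes "coprime u q" "coprime v q" shows "c (u ^ n) v = nat_scale n (c u v)"
  using assms by (induction n) (simp_all add: c_one c_mult_left)

lemma c_power_right: assumes "coprime u q" "coprime v q" shows "c u (v ^ n) = nat_scale n (c u v)"
  using assms by (induction n) (simp_all add: c_one c_mult_right)

lemma nat_scale_phi: assumes "coprime u q" "coprime v q" shows "nat_scale \<phi> (c u v) = 0"
  using c_cong[of "u ^ \<phi>" v 1 v] unit_power[OF assms(1)] assms
  by (simp add: c_power_left[symmetric] c_one)

text \<open>Two generators of the units leave four symbols, each of order at most \<open>\<phi>(q)\<close>.\<close>

lemma symbol_group:
  obtains K where "finite K" "card K \<le> nat q ^ 4" "0 \<in> K" "K \<subseteq> Cen"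
    "\<And>x x'. x \<in> K \<Longrightarrow> x' \<in> K \<Longrightarrow> x + x' \<in> K"
    "\<And>x. x \<in> K \<Longrightarrow> - x \<in> K"
    "\<And>u v. coprime u q \<Longrightarrow> coprime v q \<Longrightarrow> c u v \<in> K"
proof -
  obtain g g' where g: "coprime g q" "coprime g' q"
    and gen: "\<And>u. coprime u q \<Longrightarrow> \<exists>i j. [u = g ^ i * g' ^ j] (mod q)"
    using units_two_generated[OF prime_p e_pos] unfolding q_eq by blast
  define R where "R x = range (\<lambda>n. nat_scale n x)" for x :: 'a
  \<comment> \<open>All four summands are central, so the sumset is closed under addition although
    the ambient group need not be commutative.\<close>
  define K where "K = sumset (sumset (R (c g g)) (R (c g g'))) (sumset (R (c g' g)) (R (c g' g')))"
  have Rplus: "a + b \<in> R x" if ab: "a \<in> R x" "b \<in> R x" for a b x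
  proof -
    obtain m n where "a = nat_scale m x" "b = nat_scale n x" using ab by (auto simp: R_def)
    then have "a + b = nat_scale (m + n) x" by (simp add: nat_scale_add)
    then show ?thesis by (simp add: R_def)
  qed
  have R0: "0 \<in> R x" for x using rangeI[of "\<lambda>n. nat_scale n x" 0] by (simp add: R_def)
  have R1: "nat_scale n x \<in> R x" for n x by (simp add: R_def)
  have RCen: "R (c u v) \<subseteq> Cen" if "coprime u q" "coprime v q" for u v
  proof -
    have "nat_scale n (c u v) \<in> Cen" for n
      using c_Cen[OF that] by (induction n) (simp_all add: Cen_0 Cen_plus)
    then show ?thesis by (auto simp: R_def)
  qed
  have comm_R: "x + z = z + x" if xz: "x \<in> R (c u v)" "z \<in> Cen" for x z u v
  proof -
    obtain n where n: "x = nat_scale n (c u v)" using xz(1) by (auto simp: R_def)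
    show ?thesis unfolding n using Cen_c[OF xz(2), of u v] by (intro nat_scale_commute) simp
  qed
  have finR: "finite (R (c u v))" "card (R (c u v)) \<le> nat q" if "coprime u q" "coprime v q" for u v
    using card_multiples[OF nat_scale_phi[OF that] phi(1)] phi(2) by (auto simp: R_def)
  have sCen: "sumset A B \<subseteq> Cen" if "A \<subseteq> Cen" "B \<subseteq> Cen" for A B
    using that Cen_plus by (auto simp: sumset_def)
  have KCen: "K \<subseteq> Cen" unfolding K_def by (intro sCen RCen g)
  have comm_RR: "x + z = z + x" if "x \<in> sumset (R (c u v)) (R (c u' v'))" "z \<in> Cen" for x z u v u' v'
    using that(1) by (elim sumsetE) (metis comm_R comm_plus that(2))
  have plus_RR: "x + x' \<in> sumset (R (c u v)) (R (c u' v'))"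
    if "x \<in> sumset (R (c u v)) (R (c u' v'))" "x' \<in> sumset (R (c u v)) (R (c u' v'))"
      "coprime u' q" "coprime v' q" for x x' u v u' v'
    using that(1,2) by (intro sumset_commuting_closed) (use Rplus comm_R RCen[OF that(3,4)] in blast)+
  have comm_K: "x + z = z + x" if "x \<in> K" "z \<in> Cen" for x z
    using that(1) unfolding K_def by (elim sumsetE[of x]) (metis comm_RR comm_plus that(2))
  have plus: "x + x' \<in> K" if "x \<in> K" "x' \<in> K" for x x'
    using that unfolding K_def
  proof (rule sumset_commuting_closed[rotated 3])
    fix a b assume ab: "a \<in> sumset (R (c g g)) (R (c g g'))" "b \<in> sumset (R (c g' g)) (R (c g' g'))"
    then have "b \<in> Cen" using sCen[OF RCen RCen] g by blast
    then show "a + b = b + a" using comm_RR[OF ab(1)] by blast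
  next
    fix a a' assume "a \<in> sumset (R (c g g)) (R (c g g'))" "a' \<in> sumset (R (c g g)) (R (c g g'))"
    then show "a + a' \<in> sumset (R (c g g)) (R (c g g'))" by (rule plus_RR) (rule g)+
  next
    fix a a' assume "a \<in> sumset (R (c g' g)) (R (c g' g'))" "a' \<in> sumset (R (c g' g)) (R (c g' g'))"
    then show "a + a' \<in> sumset (R (c g' g)) (R (c g' g'))" by (rule plus_RR) (rule g)+
  qed
  have nat_scale_in: "nat_scale n x \<in> K" if "x \<in> K" for n x
  proof (induction n)
    case 0
    show ?case using R0 sumsetI[of 0 _ 0] unfolding K_def by (metis add_0 nat_scale.simps(1))
  qed (simp add: plus that)
  have basic: "c a b \<in> K" if "a \<in> {g, g'}" "b \<in> {g, g'}" for a b
  proof -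
    have R1': "x \<in> R x" for x using R1[of "Suc 0" x] by simp
    have z: "0 \<in> sumset (R x) (R x')" for x x' using sumsetI[OF R0 R0, of x x'] by simp
    have "x \<in> sumset (R x) (R x')" for x x'
      using sumsetI[OF R1' R0, of x x'] by simp
    moreover have "x' \<in> sumset (R x) (R x')" for x x'
      using sumsetI[OF R0[of x] R1'[of x']] by simp
    ultimately have "x \<in> K" if "x \<in> {c g g, c g g', c g' g, c g' g'}" for x
      using that sumsetI[OF _ z, of x _ "c g' g" "c g' g'"] sumsetI[OF z, of x _ "c g g" "c g g'"]
      unfolding K_def by auto
    then show ?thesis using that by blast
  qed
  have cK: "c u v \<in> K" if u: "coprime u q" and v: "coprime v q" for u v
  proof -
    obtain i j where ij: "[u = g ^ i * g' ^ j] (mod q)" using gen[OF u] by blast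
    obtain k l where kl: "[v = g ^ k * g' ^ l] (mod q)" using gen[OF v] by blast
    have cop: "coprime (g ^ i) q" "coprime (g' ^ j) q" "coprime (g ^ k) q" "coprime (g' ^ l) q"
      using g by simp_all
    have *: "c a (g ^ k * g' ^ l) \<in> K" if a: "a \<in> {g, g'}" for a
    proof -
      have a': "coprime a q" using a g by auto
      have "c a (g ^ k * g' ^ l) = nat_scale k (c a g) + nat_scale l (c a g')"
        using a' g cop by (simp add: c_mult_right c_power_right)
      then show ?thesis using a by (auto intro!: plus nat_scale_in basic)
    qed
    have "c u v = c (g ^ i * g' ^ j) (g ^ k * g' ^ l)" using c_cong[OF u v ij kl] .
    also have "\<dots> = nat_scale i (c g (g ^ k * g' ^ l)) + nat_scale j (c g' (g ^ k * g' ^ l))"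
      using g cop by (simp add: c_mult_left c_power_left)
    also have "\<dots> \<in> K" using * by (auto intro!: plus nat_scale_in)
    finally show ?thesis .
  qed
  have "finite K" unfolding K_def by (intro finite_sumset finR g)
  moreover have "card K \<le> (nat q * nat q) * (nat q * nat q)"
    unfolding K_def by (intro card_sumset finite_sumset finR g)
  \<comment> \<open>A finite set closed under addition is closed under negation: some positive
    multiple of \<open>x\<close> vanishes, and the multiple before it is the negative of
    \<open>x\<close>.\<close>
  moreover have "- x \<in> K" if x: "x \<in> K" for x
  proof -
    have "\<exists>n. 0 < n \<and> nat_scale n x = 0"
    proof -
      have "\<not> inj (\<lambda>n. nat_scale n x)"
        using finite_imageD[of "\<lambda>n. nat_scale n x" UNIV] \<open>finite K\<close> nat_scale_in[OF x] finite_subset[of "range (\<lambda>n. nat_scale n x)" K]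
        by (metis image_subsetI infinite_UNIV_nat)
      then obtain m n where mn: "m < n" "nat_scale m x = nat_scale n x"
        unfolding inj_def by (metis nat_neq_iff)
      have "nat_scale m x + nat_scale (n - m) x = nat_scale m x + 0"
        using mn nat_scale_add[of m "n - m" x] by simp
      then have "nat_scale (n - m) x = 0" by (rule add_left_imp_eq)
      then show ?thesis using mn(1) by (intro exI[of _ "n - m"]) auto
    qed
    then obtain n where "nat_scale (Suc n) x = 0" by (metis gr0_implies_Suc)
    then have "- x = nat_scale n x" by (simp add: neg_eq_iff_add_eq_0)
    then show ?thesis using nat_scale_in[OF x] by simp
  qed
  moreover have "0 \<in> K" using nat_scale_in[OF basic, of g g 0] by simp
  ultimately show ?thesis
    using that[of K] KCen plus cK by (simp add: power4_eq_xxxx mult.assoc)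
qed

abbreviation U :: "int \<Rightarrow> 'a" where "U \<equiv> y 0 1"
abbreviation V :: "int \<Rightarrow> 'a" where "V \<equiv> y 1 0"

lemma U_add: "U (a + b) = U a + U b" and V_add: "V (a + b) = V a + V b"
  using y_add[OF tri012(1)] y_add[OF tri012(3)] by auto

lemma W01_V: assumes "coprime u q" shows "W 0 1 u + V b = U (- (u * u * b)) + W 0 1 u"
  using cj_eqD[OF cj_w_ji[OF tri012(1) iv[OF assms], of b]] by (simp add: W_def)

lemma W01_U: assumes "coprime u q" shows "W 0 1 u + U b = V (- (iv u * iv u * b)) + W 0 1 u"
  using cj_eqD[OF cj_w_ij[OF tri012(1) iv[OF assms], of b]] by (simp add: W_def)

lemma V_W01:
  assumes "coprime u q" shows "\<exists>b'. V b + W 0 1 u = W 0 1 u + U b'"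
proof -
  have "[- (iv u * iv u * (- (u * u * b))) = b] (mod q)"
    using cong_mult[OF cong_mult[OF iv[OF assms] iv[OF assms]] cong_refl[of b]] by (simp add: mult_ac)
  then have "W 0 1 u + U (- (u * u * b)) = V b + W 0 1 u"
    using W01_U[OF assms, of "- (u * u * b)"] y_cong[OF tri012(3)] by metis
  then show ?thesis by metis
qed

text \<open>Solves the definition of the Weyl element for its middle factor: the Bruhat
  decomposition of a lower unipotent with a unit entry.\<close>

lemma V_unit: assumes "coprime u q" shows "V u = U (iv u) + W 0 1 (- iv u) + U (iv u)"
proof -
  have "W 0 1 (- iv u) = w 0 1 (- iv u) (- u)"
    using iv'[OF assms] by (intro W_eq[OF tri012(1)]) auto
  also have "\<dots> = - U (iv u) + V u + - U (iv u)"
    using y_minus[OF tri012(1)] by (simp add: w_def del: add_uminus_conv_diff)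
  finally show ?thesis by (simp add: add.assoc del: add_uminus_conv_diff)
qed

lemma U_unit: assumes "coprime u q" shows "U u = V (iv u) + W 0 1 u + V (iv u)"
proof -
  have "W 0 1 u = w 1 0 (- iv u) (- u)"
    using w_flip[OF tri012(1) iv[OF assms]] by (simp add: W_def)
  also have "\<dots> = - V (iv u) + U u + - V (iv u)"
    using y_minus[OF tri012(3)] by (simp add: w_def del: add_uminus_conv_diff)
  finally show ?thesis by (simp add: add.assoc del: add_uminus_conv_diff)
qed

end

section \<open>The rank one group and its big cell\<close>

text \<open>The image of the SL_2 corner. In a Steinberg group the root groups are closed under
  negation, so sums alone give the generated group.\<close>

inductive_set gen :: "(nat \<Rightarrow> nat \<Rightarrow> int \<Rightarrow> 'g::monoid_add) \<Rightarrow> 'g set" for y where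
  gen_0: "0 \<in> gen y"
| gen_U: "x \<in> gen y \<Longrightarrow> y 0 1 a + x \<in> gen y"
| gen_V: "x \<in> gen y \<Longrightarrow> y 1 0 a + x \<in> gen y"

text \<open>Fixes one group of symbols, as provided by \<open>symbol_group\<close>, on which the
  definitions of the torus and of the cell can depend.\<close>

locale steinberg_torus = steinberg_prime_power +
  fixes K :: "'a set"
  assumes K: "finite K" "card K \<le> nat q ^ 4" "0 \<in> K" "K \<subseteq> Cen"
    and K_plus: "\<And>x x'. x \<in> K \<Longrightarrow> x' \<in> K \<Longrightarrow> x + x' \<in> K"
    and K_uminus: "\<And>x. x \<in> K \<Longrightarrow> - x \<in> K"
    and K_c: "\<And>u v. coprime u q \<Longrightarrow> coprime v q \<Longrightarrow> c u v \<in> K"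
begin

declare One_nat_def [simp del]

text \<open>A lift of the diagonal torus of SL_2. The symbols are included because
  \<open>h 0 1\<close> is multiplicative only up to them.\<close>

definition T :: "'a set" where "T = {h 0 1 u + x | u x. coprime u q \<and> x \<in> K}"

lemma TI: "coprime u q \<Longrightarrow> x \<in> K \<Longrightarrow> h 0 1 u + x \<in> T"
  unfolding T_def by blast

lemma h_T: "coprime u q \<Longrightarrow> h 0 1 u \<in> T"
  using TI[OF _ K(3)] by simp

lemma T_0: "0 \<in> T"
  using h_T[of 1] h_one[OF tri012(1)] by simp

lemma K_comm: assumes "x \<in> K" shows "x + h 0 1 u = h 0 1 u + x"
  using Cen_h[OF _ tri012(1)] K(4) assms by blast

lemma T_plus: assumes "t \<in> T" "t' \<in> T" shows "t + t' \<in> T"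
proof -
  obtain u x where 1: "t = h 0 1 u + x" "coprime u q" "x \<in> K" using assms(1) unfolding T_def by blast
  obtain u' x' where 2: "t' = h 0 1 u' + x'" "coprime u' q" "x' \<in> K" using assms(2) unfolding T_def by blast
  have "t + t' = h 0 1 u + (x + h 0 1 u') + x'" by (simp add: 1 2 add.assoc)
  also have "\<dots> = (h 0 1 u + h 0 1 u') + (x + x')" by (simp add: K_comm[OF 1(3)] add.assoc)
  also have "\<dots> = h 0 1 (u * u') + (c u u' + (x + x'))" by (simp add: h_h add.assoc)
  finally show ?thesis using 1 2 by (simp add: TI K_plus K_c)
qed

lemma uminus_h: assumes "coprime u q" shows "- h 0 1 u = h 0 1 (iv u) - c u (iv u)"
proof -
  have "h 0 1 (u * iv u) = h 0 1 1"
    using assms iv[OF assms] coprime_iv[OF assms] by (intro h_cong[OF tri012(1)]) auto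
  then have "h 0 1 u + h 0 1 (iv u) = c u (iv u)"
    using h_h[of u "iv u"] h_one[OF tri012(1)] by simp
  then have "h 0 1 u + h 0 1 (iv u) - c u (iv u) = 0" by simp
  then have "h 0 1 u + (h 0 1 (iv u) - c u (iv u)) = 0"
    by (simp add: diff_conv_add_uminus add.assoc del: add_uminus_conv_diff)
  then show ?thesis by (simp add: neg_eq_iff_add_eq_0)
qed

lemma uminus_h_T: assumes "coprime u q" shows "- h 0 1 u \<in> T"
  using TI[OF coprime_iv[OF assms] K_uminus[OF K_c[OF assms coprime_iv[OF assms]]]]
  by (simp add: uminus_h[OF assms])

lemma T_uminus: assumes "t \<in> T" shows "- t \<in> T"
proof -
  obtain u x where 1: "t = h 0 1 u + x" "coprime u q" "x \<in> K" using assms unfolding T_def by blast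
  have "- t = - x + - h 0 1 u" by (simp add: 1 minus_add)
  also have "- x + - h 0 1 u = - h 0 1 u + - x"
    using comm_uminus[OF K_comm[OF K_uminus[OF 1(3)]], of u] by simp
  also have "\<dots> \<in> T"
  proof -
    have "- x \<in> T" using TI[of 1 "- x"] h_one[OF tri012(1)] K_uminus[OF 1(3)] by simp
    then show ?thesis using T_plus[OF uminus_h_T[OF 1(2)]] by blast
  qed
  finally show ?thesis .
qed

lemma WW_T: assumes "coprime u q" "coprime v q" shows "W 0 1 u + W 0 1 v \<in> T"
proof -
  have "W 0 1 u + W 0 1 v = h 0 1 u + - h 0 1 (- v)"
  proof -
    have "W 0 1 (- (- 1)) = - W 0 1 (- 1)" using W_uminus[OF tri012(1), of "- 1"] by simp
    moreover have "W 0 1 (- v) = - W 0 1 v" using W_uminus[OF tri012(1) assms(2)] .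
    ultimately show ?thesis by (simp add: h_def minus_add add.assoc del: add_uminus_conv_diff)
  qed
  then show ?thesis using T_plus[OF h_T uminus_h_T] assms by simp
qed

lemma U_T: assumes "t \<in> T" shows "\<exists>a'. U a + t = t + U a'"
proof -
  obtain u x where 1: "t = h 0 1 u + x" "coprime u q" "x \<in> K" using assms unfolding T_def by blast
  let ?a = "iv u * iv u * a"
  have x: "x + U a' = U a' + x" for a' using Cen_y[OF _ tri012(1)] 1(3) K(4) by blast
  have "[u * u * ?a = a] (mod q)"
    using cong_mult[OF cong_mult[OF iv[OF 1(2)] iv[OF 1(2)]] cong_refl[of a]] by (simp add: mult_ac)
  then have "U (u * u * ?a) = U a" by (rule y_cong[OF tri012(1)])
  then have hU: "h 0 1 u + U ?a = U a + h 0 1 u"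
    using cj_eqD[OF cj_h(1)[OF tri012(1) 1(2), of ?a]] by simp
  have "t + U ?a = h 0 1 u + U ?a + x" by (simp only: 1(1) add.assoc x)
  also have "\<dots> = U a + t" by (simp only: hU 1(1) add.assoc)
  finally show ?thesis by metis
qed

lemma T_V: assumes "t \<in> T" shows "\<exists>a'. t + V a = V a' + t"
proof -
  obtain u x where 1: "t = h 0 1 u + x" "coprime u q" "x \<in> K" using assms unfolding T_def by blast
  have x: "x + V a' = V a' + x" for a' using Cen_y[OF _ tri012(3)] 1(3) K(4) by blast
  have hV: "h 0 1 u + V a = V (iv u * iv u * a) + h 0 1 u"
    using cj_eqD[OF cj_h(2)[OF tri012(1) 1(2), of a]] .
  have "t + V a = h 0 1 u + V a + x" by (simp only: 1(1) add.assoc x)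
  also have "\<dots> = V (iv u * iv u * a) + t" by (simp only: hV 1(1) add.assoc)
  finally show ?thesis by blast
qed

definition VTU :: "'a set" where "VTU = {V b + (t + U a) | b t a. t \<in> T}"

lemma VTU_I: "t \<in> T \<Longrightarrow> V b + (t + U a) \<in> VTU"
  unfolding VTU_def by blast

lemma VTU_U: assumes "x \<in> VTU" shows "x + U a \<in> VTU"
proof -
  obtain b t a' where "x = V b + (t + U a')" "t \<in> T" using assms unfolding VTU_def by blast
  then have "x + U a = V b + (t + U (a' + a))" "t \<in> T" by (simp_all add: U_add add.assoc)
  then show ?thesis by (simp add: VTU_I)
qed

lemma VTU_T: assumes "x \<in> VTU" "t' \<in> T" shows "x + t' \<in> VTU"
proof -
  obtain b t a where x: "x = V b + (t + U a)" "t \<in> T" using assms unfolding VTU_def by blast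
  obtain a' where "U a + t' = t' + U a'" using U_T[OF assms(2)] by blast
  then have "x + t' = V b + ((t + t') + U a')" by (simp add: x add.assoc)
  then show ?thesis using T_plus[OF x(2) assms(2)] by (simp add: VTU_I)
qed

lemma V_VTU: assumes "x \<in> VTU" shows "V b' + x \<in> VTU"
proof -
  obtain b t a where x: "x = V b + (t + U a)" "t \<in> T" using assms unfolding VTU_def by blast
  have "V b' + x = V (b' + b) + (t + U a)" by (simp add: x V_add add.assoc)
  then show ?thesis using x(2) by (simp add: VTU_I)
qed

text \<open>In matrices the upper left entry of the product is 1 + s v, and the big cell asks for it
  to be a unit. After expanding \<open>V v\<close> by \<open>V_unit\<close> the left factor has the
  argument s + 1/v = (1 + s v)/v, again a unit, so \<open>U_unit\<close> expands it in turn; the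
  inner V crosses the Weyl element and becomes a U.\<close>

lemma UV_right_unit:
  assumes v: "coprime v q" and sv: "coprime (1 + s * v) q"
  shows "U s + V v \<in> VTU"
proof -
  let ?r = "s + iv v"
  have "[v * ?r = 1 + s * v] (mod q)"
    using cong_add[OF cong_refl iv[OF v], of "s * v"] by (simp add: algebra_simps)
  then have "coprime (v * ?r) q" using sv cong_imp_coprime cong_sym by blast
  then have r: "coprime ?r q" by simp
  have mv: "coprime (- iv v) q" using coprime_iv[OF v] by simp
  obtain b where b: "V (iv ?r) + W 0 1 (- iv v) = W 0 1 (- iv v) + U b" using V_W01[OF mv] by blast
  have "U s + V v = U ?r + (W 0 1 (- iv v) + U (iv v))"
    by (simp add: V_unit[OF v] U_add add.assoc)
  also have "\<dots> = V (iv ?r) + W 0 1 ?r + (V (iv ?r) + W 0 1 (- iv v)) + U (iv v)"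
    by (subst U_unit[OF r]) (simp add: add.assoc)
  also have "\<dots> = V (iv ?r) + ((W 0 1 ?r + W 0 1 (- iv v)) + U (b + iv v))"
    by (simp add: b U_add add.assoc)
  finally show ?thesis using WW_T[OF r mv] by (simp add: VTU_I)
qed

text \<open>The mirror image of the previous case, with \<open>U s\<close> expanded first. The
  coordinate of the V factor, which is v/(1 + s v) modulo \<open>q\<close>, stays explicit because
  \<open>UV\<close> has to see that \<open>p\<close> divides it when \<open>p\<close> divides
  \<open>v\<close>.\<close>

lemma UV_left_unit_explicit:
  assumes s: "coprime s q" and sv: "coprime (1 + s * v) q"
  shows "\<exists>t\<in>T. \<exists>a r. [r * (iv s + v) = 1] (mod q) \<and> U s + V v = V (iv s - iv s * iv s * r) + (t + U a)"
proof -
  let ?r = "iv s + v"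
  have "[s * ?r = 1 + s * v] (mod q)"
    using cong_add[OF iv[OF s] cong_refl[of "s * v"]] by (simp add: algebra_simps)
  then have "coprime (s * ?r) q" using sv cong_imp_coprime cong_sym by blast
  then have r: "coprime ?r q" by simp
  have mr: "coprime (- iv ?r) q" using coprime_iv[OF r] by simp
  have "U s + V v = V (iv s) + (W 0 1 s + V ?r)"
    by (subst U_unit[OF s]) (simp add: V_add add.assoc)
  also have "\<dots> = V (iv s) + (W 0 1 s + U (iv ?r)) + W 0 1 (- iv ?r) + U (iv ?r)"
    by (subst V_unit[OF r]) (simp add: add.assoc)
  also have "\<dots> = V (iv s) + V (- (iv s * iv s * iv ?r)) + ((W 0 1 s + W 0 1 (- iv ?r)) + U (iv ?r))"
    by (simp add: W01_U[OF s] add.assoc)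
  also have "V (iv s) + V (- (iv s * iv s * iv ?r)) = V (iv s - iv s * iv s * iv ?r)"
    by (simp add: V_add[symmetric])
  finally show ?thesis using WW_T[OF s mr] iv'[OF r] by metis
qed

lemma UV_left_unit:
  assumes "coprime s q" "coprime (1 + s * v) q" shows "U s + V v \<in> VTU"
  using UV_left_unit_explicit[OF assms] VTU_I by metis

lemma UV:
  assumes sv: "coprime (1 + s * v) q" shows "U s + V v \<in> VTU"
proof (cases "coprime s q \<or> coprime v q")
  case True
  then show ?thesis using UV_left_unit UV_right_unit sv by blast
next
  case False
  \<comment> \<open>Neither parameter is a unit. Splitting \<open>U s\<close> as
    \<open>U (s - 1) + U 1\<close> repairs this: \<open>U 1 + V v\<close> lies in the cell with a V
    coordinate still divisible by \<open>p\<close>, and then \<open>s - 1\<close> is a unit facing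
    that coordinate.\<close>
  then have ps: "int p dvd s" and pv: "int p dvd v" by (simp_all add: unit_iff)
  have p1: "\<not> int p dvd 1" using prime_p by simp
  have u1: "coprime (1 + 1 * v) q"
    using p1 pv dvd_add_left_iff[of "int p" v 1] by (simp add: unit_iff)
  obtain t a r where t: "t \<in> T" "[r * (iv 1 + v) = 1] (mod q)"
      "U 1 + V v = V (iv 1 - iv 1 * iv 1 * r) + (t + U a)"
    using UV_left_unit_explicit[OF _ u1] by auto
  have iv1: "[iv 1 = 1] (mod q)" using iv[of 1] by simp
  let ?v = "iv 1 - iv 1 * iv 1 * r"
  have pq: "int p dvd q" using e_pos by (simp add: q_eq dvd_power)
  have "int p dvd ?v"
  proof -
    have i1: "[iv 1 = 1] (mod int p)" using iv1 pq cong_dvd_modulus by blast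
    have v0: "[v = 0] (mod int p)" using pv by (simp add: cong_0_iff)
    have "[r * (iv 1 + v) = r * (1 + 0)] (mod int p)"
      by (intro cong_mult cong_add cong_refl i1 v0)
    moreover have "[r * (iv 1 + v) = 1] (mod int p)" using t(2) pq cong_dvd_modulus by blast
    ultimately have r: "[r = 1] (mod int p)" using cong_sym cong_trans by (metis add_0_right mult_1_right)
    have "[?v = 1 - 1 * 1 * 1] (mod int p)" by (intro cong_diff cong_mult i1 r)
    then show ?thesis by (simp add: cong_0_iff)
  qed
  then have u2: "coprime (1 + (s - 1) * ?v) q"
    using p1 dvd_add_left_iff[of "int p" "(s - 1) * ?v" 1] by (simp add: unit_iff)
  have u3: "coprime (s - 1) q"
    using p1 ps dvd_diff_right_iff[of "int p" s 1] by (simp add: unit_iff)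
  have "U s + V v = U (s - 1) + (U 1 + V v)"
    by (simp add: U_add[symmetric] add.assoc[symmetric])
  also have "\<dots> = (U (s - 1) + V ?v) + t + U a"
    by (simp add: t(3) add.assoc)
  finally show ?thesis using VTU_U[OF VTU_T[OF UV_left_unit[OF u3 u2] t(1)]] by simp
qed

text \<open>Over a local ring the union of the translates of the big cell \<open>V T U\<close> by \<open>U\<close> is stable under \<open>V\<close> too,
  so it exhausts the group generated by \<open>U\<close> and \<open>V\<close>.\<close>

definition S :: "'a set" where "S = {U a + x | a x. x \<in> VTU}"

lemma S_I: "x \<in> VTU \<Longrightarrow> U a + x \<in> S"
  unfolding S_def by blast

lemma VTU_S: "x \<in> VTU \<Longrightarrow> x \<in> S"
  using S_I[of x 0] y_0[OF tri012(1)] by simp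

lemma S_0: "0 \<in> S"
  using VTU_S[OF VTU_I[OF T_0, of 0 0]] y_0[OF tri012(1)] y_0[OF tri012(3)] by simp

lemma S_U: assumes "x \<in> S" shows "U a + x \<in> S"
proof -
  obtain a' z where "x = U a' + z" "z \<in> VTU" using assms unfolding S_def by blast
  then have "U a + x = U (a + a') + z" by (simp add: U_add add.assoc)
  then show ?thesis using S_I[OF \<open>z \<in> VTU\<close>] by simp
qed

text \<open>The product \<open>V x + U s + V v\<close> has to be re-sorted. One of its two adjacent
  pairs can be rewritten by \<open>UV\<close> unless \<open>p\<close> divides both 1 + s v and 1 + x
  s; in that case \<open>s\<close> is -1/x modulo \<open>p\<close>, and shifting \<open>s\<close> by
  1/x helps.\<close>

lemma S_V: assumes "z \<in> S" shows "V x + z \<in> S"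
proof -
  obtain s v t a where z: "z = U s + (V v + (t + U a))" "t \<in> T"
    using assms unfolding S_def VTU_def by blast
  have eq: "V x + z = V x + (U s + V v) + t + U a" "V x + z = (V x + U s) + (V v + (t + U a))"
    by (simp_all add: z add.assoc)
  consider "coprime (1 + s * v) q" | "coprime (1 + x * s) q"
    | "\<not> coprime (1 + s * v) q" "\<not> coprime (1 + x * s) q" by blast
  then show ?thesis
  proof cases
    case 1
    show ?thesis
      unfolding eq(1) by (rule VTU_S VTU_U VTU_T V_VTU UV 1 z)+
  next
    \<comment> \<open>Negation reverses the order of the summands, so \<open>UV\<close> applies to
      the negative of \<open>V x + U s\<close>.\<close>
    case 2
    then have "U (- s) + V (- x) \<in> VTU" by (intro UV) (simp add: mult.commute)
    then obtain b t' d where t': "U (- s) + V (- x) = V b + (t' + U d)" "t' \<in> T"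
      unfolding VTU_def by blast
    have "V x + U s = - (U (- s) + V (- x))"
      by (simp add: minus_add y_minus[OF tri012(1)] y_minus[OF tri012(3)])
    also have "\<dots> = U (- d) + (- t' + V (- b))"
      unfolding t'(1) by (simp only: minus_add y_minus[OF tri012(1)] y_minus[OF tri012(3)] add.assoc)
    finally have VU: "V x + U s = U (- d) + (- t' + V (- b))" .
    obtain b' where b': "- t' + V (- b + v) = V b' + - t'" using T_V[OF T_uminus[OF t'(2)]] by blast
    have b'': "- t' + (V (- b + v) + x) = V b' + (- t' + x)" for x
      by (simp only: add.assoc[symmetric] b')
    have "V x + z = U (- d) + (- t' + (V (- b + v) + (t + U a)))"
      by (simp only: eq(2) VU V_add add.assoc)
    also have "\<dots> = U (- d) + (V b' + ((- t' + t) + U a))"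
      by (simp only: b'' add.assoc)
    finally show ?thesis using S_I[OF VTU_I[OF T_plus[OF T_uminus[OF t'(2)] z(2)]]] by simp
  next
    case 3
    have p1: "\<not> int p dvd 1" using unit_iff[of 1] by simp
    have d: "int p dvd 1 + s * v" "int p dvd 1 + x * s" using 3 by (simp_all add: unit_iff)
    have "\<not> int p dvd x" using d(2) p1 by (metis dvd_add_left_iff dvd_mult2)
    \<comment> \<open>Here \<open>x\<close> is a unit and \<open>p\<close> divides 1/x + s.
      Expanding \<open>V x\<close> as U W U gives the next pair the arguments 1/x + s and
      \<open>v\<close>, which \<open>UV\<close> accepts; the Weyl element turns the resulting V into
      a U and is itself expanded back into U V U at the end.\<close>
    then have x: "coprime x q" by (simp add: unit_iff)
    have mx: "coprime (- iv x) q" using coprime_iv[OF x] by simp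
    have pq: "int p dvd q" using e_pos by (simp add: q_eq dvd_power)
    have "[1 = x * iv x] (mod int p)" using iv[OF x] pq cong_dvd_modulus cong_sym by blast
    then have "[0 = x * iv x + x * s] (mod int p)"
      using cong_trans[OF _ cong_add[OF _ cong_refl[of "x * s"]]] d(2) by (metis cong_0_iff cong_sym)
    then have "int p dvd x * (iv x + s)" by (metis cong_0_iff cong_sym distrib_left)
    then have "int p dvd iv x + s"
      using \<open>\<not> int p dvd x\<close> prime_p by (metis prime_dvd_multD prime_nat_int_transfer)
    then have "coprime (1 + (iv x + s) * v) q"
      using p1 unit_iff dvd_add_left_iff[of "int p" "(iv x + s) * v" 1] by (simp add: add.commute)
    then have "U (iv x + s) + V v \<in> VTU" by (rule UV)
    from VTU_U[OF VTU_T[OF this z(2)]] have "(U (iv x + s) + V v) + t + U a \<in> VTU" .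
    then obtain b t' d where t': "(U (iv x + s) + V v) + t + U a = V b + (t' + U d)" "t' \<in> T"
      unfolding VTU_def by blast
    obtain d' where d': "U (- iv x) + t' = t' + U d'" using U_T[OF t'(2)] by blast
    let ?b = "- (- iv x * - iv x * b)"
    have W: "W 0 1 (- iv x) = U (- iv x) + (V x + U (- iv x))"
      using V_unit[OF x] by (simp add: y_minus[OF tri012(1)] add.assoc del: add_uminus_conv_diff)
    have "V x + z = U (iv x) + W 0 1 (- iv x) + ((U (iv x + s) + V v) + t + U a)"
      by (subst V_unit[OF x, THEN arg_cong[where f = "\<lambda>x. x + _"]]) (simp add: z U_add add.assoc)
    also have "\<dots> = U (iv x) + (W 0 1 (- iv x) + V b) + t' + U d"
      unfolding t'(1) by (simp only: add.assoc)
    also have "\<dots> = U (iv x) + U ?b + W 0 1 (- iv x) + t' + U d"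
      by (simp only: W01_V[OF mx] add.assoc)
    also have "\<dots> = U (iv x) + U ?b + U (- iv x) + V x + (U (- iv x) + t') + U d"
      by (simp only: W add.assoc)
    also have "\<dots> = U (iv x + ?b + - iv x) + (V x + (t' + U (d' + d)))"
      by (simp only: d' U_add add.assoc)
    finally show ?thesis using S_I[OF VTU_I[OF t'(2)]] by metis
  qed
qed

lemma gen_subset_S: "gen y \<subseteq> S"
proof
  fix x assume "x \<in> gen y"
  then show "x \<in> S" by induction (simp_all add: S_0 S_U S_V)
qed

lemma card_T: "finite T" "card T \<le> nat q * nat q ^ 4"
proof -
  let ?I = "{0..<q}"
  have "T \<subseteq> sumset (h 0 1 ` ?I) K"
  proof
    fix t assume "t \<in> T"
    then obtain u x where 1: "t = h 0 1 u + x" "coprime u q" "x \<in> K" unfolding T_def by blast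
    have "h 0 1 u = h 0 1 (u mod q)"
      using 1(2) by (intro h_cong[OF tri012(1)]) (simp_all add: unique_euclidean_semiring_class.cong_def)
    moreover have "u mod q \<in> ?I" using q_pos by simp
    ultimately show "t \<in> sumset (h 0 1 ` ?I) K" using 1 by (metis image_eqI sumsetI)
  qed
  moreover have "card (h 0 1 ` ?I) \<le> nat q" using card_image_le[of ?I "h 0 1"] by simp
  ultimately show "finite T" "card T \<le> nat q * nat q ^ 4"
    using finite_sumset[of "h 0 1 ` ?I" K] card_sumset[of "h 0 1 ` ?I" K "nat q" "nat q ^ 4"] K(1,2)
      card_mono[of "sumset (h 0 1 ` ?I) K" T] finite_subset[of T]
    by auto
qed

text \<open>The exponent 8 collects one factor \<open>q\<close> for each of the three root factors
  U, V, U, one for \<open>h\<close> and four for the symbols.\<close>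

lemma card_gen_torus: "finite (gen y) \<and> card (gen y) \<le> nat q ^ 8"
proof -
  let ?I = "{0..<q}"
  have I: "finite (y i j ` ?I)" "card (y i j ` ?I) \<le> nat q" for i j
    using card_image_le[of ?I "y i j"] by auto
  have m: "y i j a \<in> y i j ` ?I" if "tri i j l" for i j l a
  proof -
    have "y i j a = y i j (a mod q)" using that by (rule y_cong) (simp add: unique_euclidean_semiring_class.cong_def)
    then show ?thesis using q_pos by simp
  qed
  let ?S = "sumset (U ` ?I) (sumset (V ` ?I) (sumset T (U ` ?I)))"
  have "S \<subseteq> ?S"
    unfolding S_def VTU_def using m[OF tri012(1)] m[OF tri012(3)] by (auto intro!: sumsetI)
  then have "gen y \<subseteq> ?S" using gen_subset_S by blast
  moreover have "finite ?S" by (intro finite_sumset I card_T)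
  moreover have "card ?S \<le> nat q * (nat q * ((nat q * nat q ^ 4) * nat q))"
    by (intro card_sumset finite_sumset I card_T)
  moreover have "nat q * (nat q * ((nat q * nat q ^ 4) * nat q)) = nat q ^ 8"
    by (simp add: power_numeral_reduce mult_ac)
  ultimately show ?thesis using finite_subset card_mono le_trans by metis
qed

end

lemma (in steinberg_prime_power) card_gen: "finite (gen y) \<and> card (gen y) \<le> nat q ^ 8"
proof -
  obtain K where "finite K" "card K \<le> nat q ^ 4" "0 \<in> K" "K \<subseteq> Cen"
    "\<And>x x'. x \<in> K \<Longrightarrow> x' \<in> K \<Longrightarrow> x + x' \<in> K"
    "\<And>x. x \<in> K \<Longrightarrow> - x \<in> K"
    "\<And>u v. coprime u q \<Longrightarrow> coprime v q \<Longrightarrow> c u v \<in> K"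
    by (rule symbol_group) blast
  then interpret steinberg_torus y q p e K by unfold_locales
  show ?thesis by (rule card_gen_torus)
qed

section \<open>Chinese remainder reduction to prime powers\<close>

lemma gen_commute:
  fixes y :: "nat \<Rightarrow> nat \<Rightarrow> int \<Rightarrow> 'g::monoid_add"
  assumes "x \<in> gen y" "\<And>a. z + y 0 1 a = y 0 1 a + z" "\<And>a. z + y 1 0 a = y 1 0 a + z"
  shows "z + x = x + z"
  using assms(1)
proof induction
  case (gen_U x a)
  then show ?case using comm_plus[OF assms(2)] by simp
next
  case (gen_V x a)
  then show ?case using comm_plus[OF assms(3)] by simp
qed simp

text \<open>For an idempotent \<open>e\<close> modulo \<open>q\<close> this is the projection to one Chinese remainder factor.\<close>

lemma (in steinberg) steinberg_scale:
  assumes e: "[e * e = e] (mod q)" and q': "[e * q' = 0] (mod q)" "q' > 0"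
  shows "steinberg (\<lambda>i j a. y i j (e * a)) q'"
proof
  fix i j l a b assume t: "tri i j l"
  then have t': "tri i l j" by (auto simp: tri_def)
  have "[e * a * (e * b) = e * (a * b)] (mod q)"
    using cong_mult[OF e cong_refl[of "a * b"]] by (simp add: mult_ac)
  from y_cong[OF t' this]
  show "y i j (e * a) + y j l (e * b) = y i l (e * (a * b)) + y j l (e * b) + y i j (e * a)"
    using y_comm[OF t, of "e * a" "e * b"] by simp
  show "y i j (e * q') = 0"
    using y_cong[OF t q'(1)] y_0[OF t] by simp
  show "y i j (e * (a + b)) = y i j (e * a) + y i j (e * b)"
    by (simp add: distrib_left y_add[OF t])
qed (use q' y_row y_col in auto)

text \<open>The bound is multiplicative over coprime factors of the modulus. One prime power is
  split off by idempotents; the two scaled families commute, so the group lies in the sum of the two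
  smaller ones.\<close>

theorem card_gen_le:
  assumes "steinberg y (int m)"
  shows "finite (gen y) \<and> card (gen y) \<le> m ^ 8"
  using assms
proof (induction m arbitrary: y rule: less_induct)
  case (less m)
  interpret steinberg y "int m" by fact
  have m0: "m > 0" using q_pos by simp
  show ?case
  proof (cases "m = 1")
    case True
    have "y i j a = 0" if "tri i j l" for i j l a
      using y_cong[OF that, of a 0] y_0[OF that] True by simp
    then have "y 0 1 a = 0" "y 1 0 a = 0" for a using tri012 by blast+
    then have "gen y \<subseteq> {0}"
      by (auto elim: gen.induct)
    then show ?thesis using True finite_subset card_mono[of "{0}" "gen y"] by auto
  next
    case False
    then obtain p where p: "prime p" "p dvd m" using prime_factor_nat by blast
    define e where "e = multiplicity p m"
    have "m \<noteq> 0" "\<not> is_unit p" using m0 p(1) by auto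
    from multiplicity_decompose'[OF this] obtain m' where m': "m = p ^ e * m'" "\<not> p dvd m'"
      unfolding e_def by blast
    have e0: "e > 0" using m' p(2) by (cases e) auto
    have m'0: "m' > 0" using m' m0 by (cases m') auto
    have pe1: "p ^ e > 1" using one_less_power[OF prime_gt_1_nat[OF p(1)] e0] .
    have less': "m' < m" using m'(1) pe1 m'0 by simp
    have "coprime (p ^ e) m'" using m'(2) p(1) by (simp add: prime_imp_coprime)
    then have cop: "coprime (int (p ^ e)) (int m')" using coprime_int_iff by blast
    then obtain u v where uv: "u * int (p ^ e) + v * int m' = 1"
      using bezout_int[of "int (p ^ e)" "int m'"] by (metis coprime_imp_gcd_eq_1)
    \<comment> \<open>The Chinese remainder idempotents: \<open>c1\<close> is 1 modulo
      \<open>p ^ e\<close> and 0 modulo \<open>m'\<close>, and \<open>c2\<close> is the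
      reverse.\<close>
    define c1 where "c1 = v * int m'"
    define c2 where "c2 = u * int (p ^ e)"
    have c12: "c1 + c2 = 1" using uv by (simp add: c1_def c2_def)
    have mm: "int m = int (p ^ e) * int m'" using m'(1) by (simp only: of_nat_mult)
    have zero: "[c1 * c2 = 0] (mod int m)" "[c1 * int (p ^ e) = 0] (mod int m)" "[c2 * int m' = 0] (mod int m)"
      unfolding c1_def c2_def mm cong_0_iff by (simp_all add: mult_ac del: of_nat_power)
    have idem: "[c1 * c1 = c1] (mod int m)" "[c2 * c2 = c2] (mod int m)"
    proof -
      have "c1 * c1 + c1 * c2 = c1" "c2 * c2 + c1 * c2 = c2"
        using c12 by (metis distrib_left mult.right_neutral, metis distrib_left mult.right_neutral add.commute mult.commute)
      then show "[c1 * c1 = c1] (mod int m)" "[c2 * c2 = c2] (mod int m)"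
        using cong_add[OF cong_refl zero(1), of "c1 * c1"] cong_add[OF cong_refl zero(1), of "c2 * c2"]
        by (simp_all add: cong_sym)
    qed
    define y1 where "y1 = (\<lambda>i j a. y i j (c1 * a))"
    define y2 where "y2 = (\<lambda>i j a. y i j (c2 * a))"
    have st1: "steinberg y1 (int (p ^ e))"
      unfolding y1_def using prime_gt_0_nat[OF p(1)] by (intro steinberg_scale idem zero) (simp del: of_nat_power)
    have st2: "steinberg y2 (int m')"
      unfolding y2_def using m'0 by (intro steinberg_scale idem zero) simp
    have "steinberg_prime_power y1 (int (p ^ e)) p e"
      using st1 p(1) e0 by (intro steinberg_prime_power.intro steinberg_prime_power_axioms.intro) auto
    from steinberg_prime_power.card_gen[OF this]
    have c1: "finite (gen y1)" "card (gen y1) \<le> (p ^ e) ^ 8" by (simp_all add: nat_power_eq)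
    have c2: "finite (gen y2)" "card (gen y2) \<le> m' ^ 8" using less.IH[OF less' st2] by auto
    have split: "y i j a = y1 i j a + y2 i j a" if "tri i j l" for i j l a
      using y_add[OF that, of "c1 * a" "c2 * a"] c12
      by (simp add: y1_def y2_def distrib_right[symmetric])
    have same: "y2 i j a + y1 i j b = y1 i j b + y2 i j a" if "tri i j l" for i j l a b
      using y_add[OF that, of "c1 * b" "c2 * a"] y_add[OF that, of "c2 * a" "c1 * b"]
      by (simp add: y1_def y2_def add.commute)
    \<comment> \<open>For want of a relation between opposite roots, \<open>y1 i j a\<close> is
      written as a commutator through \<open>l\<close>. Conjugation by \<open>y2 j i b\<close>
      changes its two factors only by root elements whose argument is a multiple of
      \<open>c1 * c2\<close>, and these vanish.\<close>
    have opp: "y2 j i b + y1 i j a = y1 i j a + y2 j i b" if t: "tri i j l" for i j l a b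
    proof -
      have tr: "tri j i l" "tri i l j" "tri l j i" "tri j l i" using t by (auto simp: tri_def)
      have z: "[c2 * b * (c1 * x) = 0] (mod int m)" for x
        using cong_mult[OF zero(1) cong_refl[of "b * x"]] by (simp add: mult_ac)
      have z': "[- (c2 * b * c1) = 0] (mod int m)"
        using z[of 1] by (simp add: cong_0_iff)
      have 1: "cj (y2 j i b) (y i l (c1 * a)) = y i l (c1 * a)"
        using cj_y1[OF tr(1), of "c2 * b" "c1 * a"] y_cong[OF tr(4) z[of a]] y_0[OF tr(4)] by (simp add: y2_def)
      have 2: "cj (y2 j i b) (y l j c1) = y l j c1"
        using cj_y2[OF tr(1), of "c2 * b" c1] y_cong[OF tr(3)[THEN tri_perm(2)], of "- (c2 * b * c1)" 0]
          y_0[OF tr(3)[THEN tri_perm(2)]] z' by (simp add: y2_def)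
      have "[c1 * a * c1 = c1 * a] (mod int m)"
        using cong_mult[OF idem(1) cong_refl[of a]] by (simp add: mult_ac)
      then have "y1 i j a = y i j (c1 * a * c1)"
        unfolding y1_def using y_cong[OF t] cong_sym by blast
      also have "\<dots> = y i l (c1 * a) + y l j c1 - y i l (c1 * a) - y l j c1"
        by (rule y_commutator[OF t])
      finally have "cj (y2 j i b) (y1 i j a) = y1 i j a"
        by (simp add: cj_plus cj_minus 1 2)
      then show ?thesis by (simp add: cj_id_iff)
    qed
    have "gen y \<subseteq> sumset (gen y1) (gen y2)"
    proof
      fix x assume "x \<in> gen y"
      then show "x \<in> sumset (gen y1) (gen y2)"
      proof induction
        case gen_0
        then show ?case using sumsetI[OF gen.gen_0[of y1] gen.gen_0[of y2]] by simp
      next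
        case (gen_U x a)
        then obtain s s' where s: "s \<in> gen y1" "s' \<in> gen y2" "x = s + s'" by (auto elim: sumsetE)
        have "y2 0 1 a + s = s + y2 0 1 a"
          using s(1) by (rule gen_commute) (use same tri012 opp[OF tri012(3)] in blast)+
        then have "y 0 1 a + x = (y1 0 1 a + s) + (y2 0 1 a + s')"
          unfolding split[OF tri012(1), of a] s(3) by (metis add.assoc)
        then show ?case using s by (metis sumsetI gen.gen_U)
      next
        case (gen_V x a)
        then obtain s s' where s: "s \<in> gen y1" "s' \<in> gen y2" "x = s + s'" by (auto elim: sumsetE)
        have "y2 1 0 a + s = s + y2 1 0 a"
          using s(1) by (rule gen_commute) (use same tri012 opp[OF tri012(1)] in blast)+
        then have "y 1 0 a + x = (y1 1 0 a + s) + (y2 1 0 a + s')"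
          unfolding split[OF tri012(3), of a] s(3) by (metis add.assoc)
        then show ?case using s by (metis sumsetI gen.gen_V)
      qed
    qed
    moreover have "finite (sumset (gen y1) (gen y2))" using c1 c2 by (simp add: finite_sumset)
    moreover have "card (sumset (gen y1) (gen y2)) \<le> (p ^ e) ^ 8 * m' ^ 8"
      using c1 c2 by (simp add: card_sumset)
    ultimately show ?thesis
      unfolding m'(1) power_mult_distrib using finite_subset card_mono le_trans by metis
  qed
qed

section \<open>Chebyshev bounds\<close>

definition primes_le :: "nat \<Rightarrow> nat set" where "primes_le x = {p. prime p \<and> p \<le> x}"

lemma finite_primes_le [simp]: "finite (primes_le x)"
  by (rule finite_subset[of _ "{..x}"]) (auto simp: primes_le_def)

definition floor_exp :: "nat \<Rightarrow> nat \<Rightarrow> nat" where "floor_exp p n = Max {e. p ^ e \<le> n}"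

lemma finite_exps: assumes "p > 1" shows "finite {e. p ^ e \<le> (n::nat)}"
proof (rule finite_subset[of _ "{..n}"])
  have "e \<le> n" if "p ^ e \<le> n" for e
  proof -
    have "e < 2 ^ e" by (rule less_exp)
    also have "2 ^ e \<le> p ^ e" using assms by (intro power_mono) auto
    finally show ?thesis using that by simp
  qed
  then show "{e. p ^ e \<le> n} \<subseteq> {..n}" by auto
qed simp

lemma power_floor_exp_le: assumes "p > 1" "n > 0" shows "p ^ floor_exp p n \<le> n"
proof -
  have "0 \<in> {e. p ^ e \<le> n}" using assms by simp
  then have "floor_exp p n \<in> {e. p ^ e \<le> n}"
    unfolding floor_exp_def using finite_exps[OF assms(1)] by (metis Max_in empty_iff)
  then show ?thesis by simp
qed

lemma le_floor_exp: "p > 1 \<Longrightarrow> p ^ e \<le> n \<Longrightarrow> e \<le> floor_exp p n"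
  unfolding floor_exp_def by (intro Max_ge finite_exps) auto

text \<open>For \<open>n > 0\<close> this is the least common multiple of the
  \<open>x\<close>-smooth numbers up to \<open>n\<close>, in a form from which its size can be read
  off.\<close>

definition smooth_lcm :: "nat \<Rightarrow> nat \<Rightarrow> nat" where
  "smooth_lcm x n = (\<Prod>p\<in>primes_le x. p ^ floor_exp p n)"

lemma smooth_lcm_pos: "smooth_lcm x n > 0"
  unfolding smooth_lcm_def by (rule prod_pos) (auto simp: primes_le_def prime_gt_0_nat)

lemma smooth_lcm_le: assumes "n > 0" shows "smooth_lcm x n \<le> n ^ card (primes_le x)"
proof -
  have "smooth_lcm x n \<le> (\<Prod>p\<in>primes_le x. n)"
    unfolding smooth_lcm_def using assms
    by (intro prod_mono) (auto simp: primes_le_def intro!: power_floor_exp_le dest: prime_gt_1_nat)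
  then show ?thesis by simp
qed

lemma dvd_smooth_lcm:
  assumes "t > 0" "t \<le> n" "\<And>p. prime p \<Longrightarrow> p dvd t \<Longrightarrow> p \<le> x"
  shows "t dvd smooth_lcm x n"
proof -
  have sub: "prime_factors t \<subseteq> primes_le x"
    using assms by (auto simp: primes_le_def prime_factors_dvd)
  have "t = (\<Prod>p\<in>prime_factors t. p ^ multiplicity p t)"
    using assms(1) by (simp add: prime_factorization_nat)
  also have "\<dots> dvd (\<Prod>p\<in>prime_factors t. p ^ floor_exp p n)"
  proof (rule prod_dvd_prod)
    fix p assume p: "p \<in> prime_factors t"
    have "p ^ multiplicity p t \<le> t" using assms(1) by (simp add: dvd_imp_le multiplicity_dvd)
    then have "multiplicity p t \<le> floor_exp p n"
      using assms prime_gt_1_nat[OF in_prime_factors_imp_prime[OF p]] by (intro le_floor_exp) auto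
    then show "p ^ multiplicity p t dvd p ^ floor_exp p n" by (rule le_imp_power_dvd)
  qed
  also have "\<dots> dvd smooth_lcm x n"
    unfolding smooth_lcm_def using sub by (intro prod_dvd_prod_subset) auto
  finally show ?thesis .
qed

section \<open>Lower bounds for prime counting and primorials\<close>

text \<open>The addition rule of Leibniz's harmonic triangle, whose entries are the numbers 1/(m (n
  choose m)).\<close>

lemma leibniz_triangle:
  assumes "1 \<le> m" "m < n"
  shows "1 / (real (Suc m) * real (n choose Suc m)) = 1 / (real m * real ((n - 1) choose m)) - 1 / (real m * real (n choose m))"
proof -
  obtain n' where n: "n = Suc n'" using assms by (cases n) auto
  have a: "real (Suc m) * real (n choose Suc m) = real (n - m) * real (n choose m)"
  proof -
    have "Suc m * (n choose Suc m) = (n - m) * (n choose m)"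
      using binomial_absorb_comp[of n m] binomial_absorption[of m n] by simp
    then show ?thesis by (metis of_nat_mult)
  qed
  have b: "real (n - m) * real (n choose m) = real n * real ((n - 1) choose m)"
    using binomial_absorb_comp[of n m] by (metis of_nat_mult)
  have pos: "real (n choose m) > 0" "real ((n - 1) choose m) > 0" "real (n - m) > 0" "real m > 0" "real n > 0"
    using assms by auto
  have c: "real ((n - 1) choose m) = real (n - m) * real (n choose m) / real n"
    using b pos by (simp add: field_simps)
  have "real n = real (n - m) + real m" using assms by simp
  then have "1 / (real (n - m) * real (n choose m)) = 1 / (real m * (real (n - m) * real (n choose m) / real n)) - 1 / (real m * real (n choose m))"
    using pos by (simp add: field_simps)
  then show ?thesis unfolding a c .
qed

text \<open>The first column of the harmonic triangle consists of the numbers 1/n, which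
  \<open>L\<close> clears; the addition rule carries integrality from one column to the
  next.\<close>

lemma binomial_dvd_common_multiple:
  assumes "1 \<le> m" "m \<le> n" "\<And>i. 1 \<le> i \<Longrightarrow> i \<le> n \<Longrightarrow> i dvd L"
  shows "m * (n choose m) dvd L"
proof -
  have "real L / (real m * real (n choose m)) \<in> \<int>"
    using assms
  proof (induction m arbitrary: n rule: nat_induct_at_least[of 1, consumes 1])
    case base
    then have "n dvd L" by simp
    then obtain t where "L = n * t" ..
    then show ?case using base by simp
  next
    case (Suc m)
    have 1: "real L / (real m * real ((n - 1) choose m)) \<in> \<int>"
      using Suc.prems by (intro Suc.IH) auto
    have 2: "real L / (real m * real (n choose m)) \<in> \<int>"
      using Suc.prems by (intro Suc.IH) auto
    have "real L / (real (Suc m) * real (n choose Suc m)) =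
        real L * (1 / (real m * real ((n - 1) choose m)) - 1 / (real m * real (n choose m)))"
    proof -
      have "m < n" using Suc.prems by simp
      from leibniz_triangle[OF Suc.hyps this] show ?thesis by (metis times_divide_eq_right mult.right_neutral)
    qed
    also have "\<dots> = real L / (real m * real ((n - 1) choose m)) - real L / (real m * real (n choose m))"
      by (simp add: right_diff_distrib)
    finally show ?case using 1 2 by simp
  qed
  then obtain z :: int where z: "real L / (real m * real (n choose m)) = of_int z" by (auto elim: Ints_cases)
  have pos: "real m * real (n choose m) > 0" using assms by simp
  then have "real L = of_int z * (real m * real (n choose m))" using z by (metis nonzero_eq_divide_eq less_irrefl)
  then have "of_int (int L) = (of_int (z * (int m * int (n choose m))) :: real)" by simp
  then have "int L = z * (int m * int (n choose m))" by (simp only: of_int_eq_iff)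
  then have "int (m * (n choose m)) dvd int L" by simp
  then show ?thesis by (simp only: of_nat_dvd_iff)
qed

text \<open>With both arguments equal to 2n, smoothness is no restriction, so
  \<open>smooth_lcm\<close> is a common multiple of 1, ..., 2n and exceeds the central binomial
  coefficient, while each of its prime power factors is at most 2n.\<close>

lemma card_primes_lower:
  assumes "n > 0" shows "4 ^ n / (2 * real n) \<le> real (2 * n) ^ card (primes_le (2 * n))"
proof -
  let ?L = "smooth_lcm (2 * n) (2 * n)"
  have "n * (2 * n choose n) dvd ?L"
  proof (rule binomial_dvd_common_multiple)
    fix i assume i: "1 \<le> i" "i \<le> 2 * n"
    show "i dvd ?L"
    proof (rule dvd_smooth_lcm)
      fix p assume "prime p" "p dvd i"
      then have "p \<le> i" using i by (intro dvd_imp_le) auto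
      then show "p \<le> 2 * n" using i by simp
    qed (use i in auto)
  qed (use assms in auto)
  then have "n * (2 * n choose n) \<le> ?L" using smooth_lcm_pos by (rule dvd_imp_le)
  then have "2 * n choose n \<le> ?L" using assms by (metis le_trans mult_le_mono1 One_nat_def Suc_leI nat_mult_1)
  also have "?L \<le> (2 * n) ^ card (primes_le (2 * n))" using assms by (intro smooth_lcm_le) simp
  finally have "real (2 * n choose n) \<le> real ((2 * n) ^ card (primes_le (2 * n)))" by (rule of_nat_mono)
  then show ?thesis using central_binomial_lower_bound[OF assms] by simp
qed

text \<open>Passes from counting primes to summing their logarithms. Primes up to sqrt y are
  discarded and each other one contributes at least half of ln y, which leaves a main term y ln 2 /
  2, at least y/4; lowering it to y/8 absorbs the error terms for large y.\<close>

lemma primorial_lower: "\<exists>C. \<forall>y. exp (real y / 8 - C) \<le> real (\<Prod>(primes_le y))"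
proof -
  define \<theta> where "\<theta> y = (\<Sum>p\<in>primes_le y. ln (real p))" for y
  have th: "real (\<Prod>(primes_le y)) = exp (\<theta> y)" for y
    unfolding \<theta>_def using prime_gt_0_nat by (simp add: exp_sum primes_le_def)
  have th0: "\<theta> y \<ge> 0" for y
    unfolding \<theta>_def by (intro sum_nonneg) (auto simp: primes_le_def dest: prime_ge_1_nat)
  have mono: "\<theta> x \<le> \<theta> y" if "x \<le> y" for x y
    unfolding \<theta>_def using that by (intro sum_mono2) (auto simp: primes_le_def dest: prime_ge_1_nat)
  have even_bound: "real y * ln 2 / 2 - ln (real y) / 2 - sqrt (real y) * ln (real y) / 2 \<le> \<theta> y"
    if y: "even y" "y > 0" for y
  proof -
    obtain n where n: "y = 2 * n" using y(1) by blast
    have n0: "n > 0" using y n by simp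
    let ?P = "primes_le y"
    let ?A = "{p \<in> ?P. sqrt (real y) < real p}"
    let ?B = "{p \<in> ?P. real p \<le> sqrt (real y)}"
    have "real n * ln 4 - ln (real y) = ln (4 ^ n / (2 * real n))"
      using n0 n by (simp add: ln_div ln_realpow)
    also have "\<dots> \<le> ln (real y ^ card ?P)"
      using card_primes_lower[OF n0] n0 by (subst ln_le_cancel_iff) (simp_all add: n)
    also have "\<dots> = real (card ?P) * ln (real y)" using y by (simp add: ln_realpow)
    finally have 1: "real n * ln 4 - ln (real y) \<le> real (card ?P) * ln (real y)" .
    have "?P = ?A \<union> ?B" by auto
    then have "card ?P \<le> card ?A + card ?B" by (metis card_Un_le)
    moreover have "real (card ?B) \<le> sqrt (real y)"
    proof -
      have "?B \<subseteq> {1..nat \<lfloor>sqrt (real y)\<rfloor>}"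
        by (auto simp: primes_le_def le_nat_floor dest: prime_ge_1_nat)
      then have "card ?B \<le> nat \<lfloor>sqrt (real y)\<rfloor>" using card_mono[of "{1..nat \<lfloor>sqrt (real y)\<rfloor>}" ?B] by simp
      moreover have "real (nat \<lfloor>sqrt (real y)\<rfloor>) \<le> sqrt (real y)" by simp
      ultimately show ?thesis by linarith
    qed
    ultimately have 2: "real (card ?P) - sqrt (real y) \<le> real (card ?A)" by linarith
    have lny: "ln (real y) \<ge> 0" using y by simp
    have "real (card ?A) * (ln (real y) / 2) = (\<Sum>p\<in>?A. ln (real y) / 2)" by simp
    also have "\<dots> \<le> (\<Sum>p\<in>?A. ln (real p))"
    proof (rule sum_mono)
      fix p assume p: "p \<in> ?A"
      have "0 < real p" using p by (simp add: primes_le_def prime_gt_0_nat)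
      with p y have "ln (sqrt (real y)) \<le> ln (real p)" by (subst ln_le_cancel_iff) auto
      then show "ln (real y) / 2 \<le> ln (real p)" using y by (simp add: ln_sqrt)
    qed
    also have "\<dots> \<le> \<theta> y"
      unfolding \<theta>_def by (intro sum_mono2) (auto simp: primes_le_def dest: prime_ge_1_nat)
    finally have 3: "real (card ?A) * (ln (real y) / 2) \<le> \<theta> y" .
    have "(real (card ?P) - sqrt (real y)) * (ln (real y) / 2) \<le> real (card ?A) * (ln (real y) / 2)"
      using 2 lny by (intro mult_right_mono) auto
    then have "real (card ?P) * ln (real y) / 2 - sqrt (real y) * ln (real y) / 2 \<le> \<theta> y"
      using 3 by (simp add: left_diff_distrib)
    moreover have "real n * ln 4 = real y * ln 2"
    proof -
      have "ln (4::real) = 2 * ln 2" using ln_realpow[of 2 2] by simp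
      then show ?thesis by (simp add: n)
    qed
    ultimately show ?thesis using 1 by (simp add: field_simps)
  qed
  have "\<forall>\<^sub>F y::nat in at_top. real y / 8 \<le> real y / 4 - ln (real y) / 2 - sqrt (real y) * ln (real y) / 2"
    by real_asymp
  then obtain N where N0: "\<And>y. y \<ge> N \<Longrightarrow> real y / 8 \<le> real y / 4 - ln (real y) / 2 - sqrt (real y) * ln (real y) / 2"
    unfolding eventually_at_top_linorder by blast
  have "exp (1 / 2) ^ 2 = exp (1::real)" by (simp flip: exp_of_nat_mult)
  then have "exp (1 / 2 :: real) ^ 2 \<le> 2 ^ 2" using exp_le by simp
  then have "exp (1 / 2 :: real) \<le> 2" by (rule power2_le_imp_le) simp
  then have ln2: "1 / 2 \<le> ln (2::real)" by (subst ln_ge_iff) auto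
  have N: "real y / 8 \<le> real y * ln 2 / 2 - ln (real y) / 2 - sqrt (real y) * ln (real y) / 2" if "y \<ge> N" for y
  proof -
    have "real y / 4 \<le> real y * ln 2 / 2"
      using mult_left_mono[OF ln2, of "real y"] by simp
    then show ?thesis using N0[OF that] by linarith
  qed
  \<comment> \<open>The constant N + 1 makes the left side negative for small \<open>y\<close>, and
    it also covers the passage from an odd \<open>y\<close> to y - 1.\<close>
  have "real y / 8 - (real N + 1) \<le> \<theta> y" for y
  proof (cases "y \<ge> N + 2")
    case True
    define z where "z = (if even y then y else y - 1)"
    have z: "even z" "z > 0" "z \<ge> N" "z \<le> y" "real y \<le> real z + 1" using True by (auto simp: z_def)
    have "real z / 8 \<le> \<theta> z" using N[OF z(3)] even_bound[OF z(1,2)] by linarith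
    then show ?thesis using mono[OF z(4)] z(5) by linarith
  next
    case False
    then show ?thesis using th0[of y] by linarith
  qed
  then have "exp (real y / 8 - (real N + 1)) \<le> real (\<Prod>(primes_le y))" for y
    unfolding th by simp
  then show ?thesis by blast
qed

section \<open>Upper bound for prime counting\<close>

lemma card_primes_le_bound: "card (primes_le x) \<le> x"
proof -
  have "primes_le x \<subseteq> {1..x}" by (auto simp: primes_le_def dest: prime_ge_1_nat)
  then show ?thesis using card_mono[of "{1..x}" "primes_le x"] by simp
qed

lemma prod_primes_dvd:
  fixes N :: nat
  assumes "finite A" "\<And>p. p \<in> A \<Longrightarrow> prime p \<and> p dvd N"
  shows "\<Prod>A dvd N"
  using assms
proof (induction A)
  case (insert p A)
  then have "coprime p (\<Prod>A)" by (intro prod_coprime_right) (metis insertI1 insertI2 primes_coprime)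
  then show ?case using insert by (simp add: divides_mult)
qed simp

text \<open>Primes above 2^k and up to 2^(k+1) divide the central binomial coefficient, which is at
  most 4^(2^k). So the induction adds 2 to the constant 6 and, for k \<ge> 2, the passage from the
  factor k to k + 1 costs at most 3/2; the constant 6 solves (6 + 2) 3/2 = 2 * 6.\<close>

lemma card_primes_dyadic: "k * card (primes_le (2 ^ k)) \<le> 6 * 2 ^ k"
proof (induction k)
  case (Suc k)
  let ?n = "2 ^ k :: nat"
  let ?A = "primes_le (2 * ?n) - primes_le ?n"
  have fA: "finite ?A" by simp
  have "\<Prod>?A dvd (2 * ?n choose ?n)"
  proof (rule prod_primes_dvd[OF fA])
    fix p assume "p \<in> ?A"
    then have p: "prime p" "p \<le> 2 * ?n" "\<not> p \<le> ?n" by (auto simp: primes_le_def)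
    have "fact ?n * fact ?n * (2 * ?n choose ?n) = (fact (2 * ?n) :: nat)"
      using binomial_fact_lemma[of ?n "2 * ?n"] by simp
    moreover have "p dvd fact (2 * ?n)" "\<not> p dvd fact ?n" using p by (simp_all add: prime_dvd_fact_iff)
    ultimately show "prime p \<and> p dvd (2 * ?n choose ?n)"
      using p(1) by (metis prime_dvd_mult_iff)
  qed
  then have "\<Prod>?A \<le> 2 * ?n choose ?n" by (intro dvd_imp_le) auto
  also have "\<dots> \<le> 2 ^ (2 * ?n)" by (rule binomial_le_pow2)
  finally have "\<Prod>?A \<le> 2 ^ (2 * ?n)" .
  moreover have "?n ^ card ?A \<le> \<Prod>?A"
  proof -
    have "(\<Prod>p\<in>?A. ?n) \<le> \<Prod>?A" by (intro prod_mono) (auto simp: primes_le_def)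
    then show ?thesis by simp
  qed
  ultimately have "2 ^ (k * card ?A) \<le> (2::nat) ^ (2 * ?n)" by (simp add: power_mult)
  then have A: "k * card ?A \<le> 2 * ?n" by (rule power_le_imp_le_exp[rotated]) simp
  have "primes_le ?n \<subseteq> primes_le (2 * ?n)" by (auto simp: primes_le_def)
  then have "card (primes_le (2 * ?n)) = card ?A + card (primes_le ?n)"
    by (metis card_Diff_subset card_mono finite_primes_le le_add_diff_inverse2)
  then have 1: "k * card (primes_le (2 * ?n)) \<le> 8 * ?n"
    using A Suc.IH by (simp add: distrib_left)
  consider "k = 0" | "k = 1" | "k \<ge> 2" by linarith
  then show ?case
  proof cases
    case 1
    then show ?thesis using card_primes_le_bound[of 2] by simp
  next
    case 2
    then show ?thesis using card_primes_le_bound[of 4] by simp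
  next
    case 3
    let ?c = "card (primes_le (2 * ?n))"
    have "2 * ?c \<le> k * ?c" using 3 by (rule mult_right_mono) simp
    moreover have "Suc k * ?c = ?c + k * ?c" by simp
    ultimately have "Suc k * ?c \<le> 12 * ?n" using 1 by linarith
    then show ?thesis by simp
  qed
qed simp

text \<open>\<open>x\<close> is rounded up to a power of two that is at most 2x, which doubles the
  dyadic constant.\<close>

lemma card_primes_upper: "real (card (primes_le x)) * ln (real x) \<le> 12 * real x"
proof (cases "x \<le> 1")
  case True
  then consider "x = 0" | "x = 1" by linarith
  then show ?thesis by cases simp_all
next
  case False
  define k where "k = nat \<lceil>log 2 (real x)\<rceil>"
  have l0: "log 2 (real x) > 0" using False by simp
  have k1: "log 2 (real x) \<le> real k" "real k < log 2 (real x) + 1"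
    using l0 unfolding k_def by linarith+
  have x1: "x \<le> 2 ^ k"
  proof -
    have "real x = 2 powr log 2 (real x)" using False by simp
    also have "\<dots> \<le> 2 powr real k" using k1 by simp
    finally have "real x \<le> real (2 ^ k)" by (simp add: powr_realpow)
    then show ?thesis by (simp only: of_nat_le_iff)
  qed
  have x2: "2 ^ k \<le> 2 * real x"
  proof -
    have "2 powr real k \<le> 2 powr (log 2 (real x) + 1)" using k1 by simp
    also have "\<dots> = 2 * real x" using False by (simp add: powr_add)
    finally show ?thesis by (simp add: powr_realpow)
  qed
  have "primes_le x \<subseteq> primes_le (2 ^ k)" using x1 by (auto simp: primes_le_def)
  then have "card (primes_le x) \<le> card (primes_le (2 ^ k))" by (intro card_mono) auto
  then have "k * card (primes_le x) \<le> 6 * 2 ^ k"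
    using card_primes_dyadic[of k] by (meson le_trans mult_le_mono2)
  then have "real (k * card (primes_le x)) \<le> real (6 * 2 ^ k)" by (rule of_nat_mono)
  then have 1: "real k * real (card (primes_le x)) \<le> 12 * real x" using x2 by simp
  have "ln (real x) \<le> log 2 (real x)"
  proof -
    have "ln (2::real) \<le> 1" using ln_2_less_1 by simp
    then have "ln (real x) * ln 2 \<le> ln (real x)" using False by (intro mult_left_le) auto
    then show ?thesis by (simp add: log_def field_simps)
  qed
  then have "ln (real x) \<le> real k" using k1 by linarith
  then have "real (card (primes_le x)) * ln (real x) \<le> real (card (primes_le x)) * real k"
    by (rule mult_left_mono) simp
  then show ?thesis using 1 by (simp add: mult.commute)
qed

section \<open>Subgroup index and permutation representations\<close>

context group begin

lemma rcos_eq_iff: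
  assumes "subgroup H G" "a \<in> carrier G" "b \<in> carrier G"
  shows "H #> a = H #> b \<longleftrightarrow> a \<otimes> inv b \<in> H"
proof
  interpret H: subgroup H G by fact
  assume "H #> a = H #> b"
  then have "a \<in> H #> b" using rcos_self[OF assms(2,1)] by simp
  then obtain h where "h \<in> H" "a = h \<otimes> b" unfolding r_coset_def by blast
  then show "a \<otimes> inv b \<in> H" using assms by (simp add: m_assoc)
next
  assume h: "a \<otimes> inv b \<in> H"
  have "a = (a \<otimes> inv b) \<otimes> b" using assms by (simp add: m_assoc)
  then have "a \<in> H #> b" using h unfolding r_coset_def by blast
  then show "H #> a = H #> b" using repr_independence[OF _ assms(3,1)] by simp
qed

lemma card_le_subgroup_index:
  assumes H: "subgroup H G" and S: "S \<subseteq> carrier G"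
    and inj: "\<And>a b. a \<in> S \<Longrightarrow> b \<in> S \<Longrightarrow> a \<otimes> inv b \<in> H \<Longrightarrow> a = b"
  shows "of_nat (card S) \<le> subgroup_index G H"
proof (cases "finite (rcosets H)")
  case True
  have "inj_on (\<lambda>a. H #> a) S"
  proof (rule inj_onI)
    fix a b assume ab: "a \<in> S" "b \<in> S" "H #> a = H #> b"
    from iffD1[OF rcos_eq_iff[OF H subsetD[OF S ab(1)] subsetD[OF S ab(2)]] ab(3)]
    show "a = b" by (rule inj[OF ab(1,2)])
  qed
  moreover have "(\<lambda>a. H #> a) ` S \<subseteq> rcosets H"
    using S by (auto simp: RCOSETS_def)
  ultimately have "card S \<le> card (rcosets H)" using card_inj_on_le[OF _ _ True] by blast
  then show ?thesis using True by (simp add: subgroup_index_def)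
qed (simp add: subgroup_index_def)

lemma subgroup_index_le_card:
  assumes H: "subgroup H G" and F: "finite F" and f: "f ` carrier G \<subseteq> F"
    and inj: "\<And>a b. a \<in> carrier G \<Longrightarrow> b \<in> carrier G \<Longrightarrow> f a = f b \<Longrightarrow> a \<otimes> inv b \<in> H"
  shows "finite (rcosets H)" "subgroup_index G H \<le> of_nat (card F)"
proof -
  define r where "r C = (SOME a. a \<in> carrier G \<and> C = H #> a)" for C
  have r: "r C \<in> carrier G \<and> C = H #> r C" if "C \<in> rcosets H" for C
  proof -
    have "\<exists>a. a \<in> carrier G \<and> C = H #> a" using that unfolding RCOSETS_def by blast
    then show ?thesis unfolding r_def by (rule someI_ex)
  qed
  have inj': "inj_on (f \<circ> r) (rcosets H)"
  proof (rule inj_onI)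
    fix C D assume CD: "C \<in> rcosets H" "D \<in> rcosets H" "(f \<circ> r) C = (f \<circ> r) D"
    then have "r C \<otimes> inv r D \<in> H" using inj r by simp
    then have "H #> r C = H #> r D" using r CD rcos_eq_iff[OF H] by blast
    then show "C = D" using r CD(1,2) by blast
  qed
  have sub: "(f \<circ> r) ` (rcosets H) \<subseteq> F" using r f by auto
  show fin: "finite (rcosets H)" using inj_on_finite[OF inj' sub F] .
  then show "subgroup_index G H \<le> of_nat (card F)"
    using card_inj_on_le[OF inj' sub F] by (simp add: subgroup_index_def)
qed

lemma subgroup_index_antimono:
  assumes "subgroup H G" "subgroup K G" "H \<subseteq> K" shows "subgroup_index G K \<le> subgroup_index G H"
proof (cases "finite (rcosets H)")
  case True
  have "subgroup_index G K \<le> of_nat (card (rcosets H))"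
    using assms rcos_eq_iff[OF assms(1)]
    by (intro subgroup_index_le_card(2)[of K "rcosets H" "\<lambda>a. H #> a"] True) (auto simp: RCOSETS_def)
  then show ?thesis using True by (simp add: subgroup_index_def)
qed (simp add: subgroup_index_def)

text \<open>An overgroup is a union of cosets of \<open>H\<close>, hence given by a subset of a
  finite set.\<close>

lemma finite_overgroups:
  assumes H: "subgroup H G" and fin: "finite (rcosets H)"
  shows "finite {K. subgroup K G \<and> H \<subseteq> K}"
proof (rule finite_subset)
  show "{K. subgroup K G \<and> H \<subseteq> K} \<subseteq> Union ` Pow (rcosets H)"
  proof
    fix K assume "K \<in> {K. subgroup K G \<and> H \<subseteq> K}"
    then have K: "subgroup K G" "H \<subseteq> K" by auto
    interpret K: subgroup K G by fact
    have "K = \<Union>((\<lambda>a. H #> a) ` K)"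
    proof
      show "K \<subseteq> \<Union>((\<lambda>a. H #> a) ` K)" using rcos_self[OF _ H] K.subset by blast
      show "\<Union>((\<lambda>a. H #> a) ` K) \<subseteq> K" using K(2) by (auto simp: r_coset_def)
    qed
    moreover have "(\<lambda>a. H #> a) ` K \<subseteq> rcosets H" using K.subset by (auto simp: RCOSETS_def)
    ultimately show "K \<in> Union ` Pow (rcosets H)" by blast
  qed
  show "finite (Union ` Pow (rcosets H))" using fin by simp
qed

lemma ex_maximal_subgroup:
  assumes H: "subgroup H G" "H \<noteq> carrier G" and fin: "finite (rcosets H)"
  shows "\<exists>M. maximal_subgroup M G \<and> H \<subseteq> M"
proof -
  let ?S = "{K. subgroup K G \<and> H \<subseteq> K} - {carrier G}"
  have "finite ?S" "H \<in> ?S" using finite_overgroups[OF H(1) fin] H by auto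
  from finite_has_maximal2[OF this] obtain M where M: "M \<in> ?S" "H \<subseteq> M" "\<forall>b\<in>?S. M \<subseteq> b \<longrightarrow> M = b" by blast
  have "K = M \<or> K = carrier G" if "subgroup K G" "M \<subseteq> K" for K
    using M that by blast
  then show ?thesis using M(1) unfolding maximal_subgroup_def by blast
qed

lemma ex_maximal_normal_subgroup:
  assumes H: "H \<lhd> G" "H \<noteq> carrier G" and fin: "finite (rcosets H)"
  shows "\<exists>M. maximal_normal_subgroup M G \<and> H \<subseteq> M"
proof -
  let ?S = "{K. K \<lhd> G \<and> H \<subseteq> K} - {carrier G}"
  have "?S \<subseteq> {K. subgroup K G \<and> H \<subseteq> K}" using normal_imp_subgroup by blast
  then have "finite ?S" by (rule finite_subset) (rule finite_overgroups[OF normal_imp_subgroup[OF H(1)] fin])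
  moreover have "H \<in> ?S" using H by blast
  ultimately have "finite ?S" "H \<in> ?S" .
  from finite_has_maximal2[OF this] obtain M where M: "M \<in> ?S" "H \<subseteq> M" "\<forall>b\<in>?S. M \<subseteq> b \<longrightarrow> M = b" by blast
  have "K = M \<or> K = carrier G" if "K \<lhd> G" "M \<subseteq> K" for K
    using M that by blast
  then show ?thesis using M(1) unfolding maximal_normal_subgroup_def by blast
qed

lemma subgroup_Inter_carrier:
  assumes "\<And>H. H \<in> S \<Longrightarrow> subgroup H G" shows "subgroup (carrier G \<inter> \<Inter>S) G"
  using assms by (intro subgroupI) (auto simp: subgroup.m_inv_closed subgroup.m_closed subgroup.one_closed)

lemma normal_Inter_carrier:
  assumes "\<And>H. H \<in> S \<Longrightarrow> H \<lhd> G" shows "(carrier G \<inter> \<Inter>S) \<lhd> G"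
  using subgroup_Inter_carrier[of S] assms
  by (auto simp: normal_inv_iff)

end

text \<open>Embeds an arbitrary group into an instance of \<open>group_add\<close>.\<close>

typedef 'a sym = "{f :: 'a \<Rightarrow> 'a. bij f}" by (rule exI[of _ id]) simp

setup_lifting type_definition_sym

instantiation sym :: (type) group_add
begin

lift_definition zero_sym :: "'a sym" is id by simp
lift_definition plus_sym :: "'a sym \<Rightarrow> 'a sym \<Rightarrow> 'a sym" is comp by (rule bij_comp)
lift_definition uminus_sym :: "'a sym \<Rightarrow> 'a sym" is "inv_into UNIV" by (rule bij_imp_bij_inv)
definition minus_sym :: "'a sym \<Rightarrow> 'a sym \<Rightarrow> 'a sym" where "minus_sym f g = f + - g"

instance
proof
  fix a b c :: "'a sym"
  show "a + b + c = a + (b + c)" by transfer (simp add: comp_assoc)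
  show "0 + a = a" "a + 0 = a" by (transfer, simp)+
  show "- a + a = 0" by transfer (simp add: bij_is_inj)
  show "a + - b = a - b" by (simp add: minus_sym_def)
qed

end

lemma (in group) cayley:
  "\<exists>\<phi> :: 'a \<Rightarrow> 'a sym. inj_on \<phi> (carrier G) \<and>
     (\<forall>a\<in>carrier G. \<forall>b\<in>carrier G. \<phi> (a \<otimes> b) = \<phi> a + \<phi> b)"
proof -
  \<comment> \<open>Left multiplication, extended by the identity outside the carrier so that it is
    a bijection of the whole type.\<close>
  define f where "f a x = (if x \<in> carrier G then a \<otimes> x else x)" for a x
  have comp: "f a \<circ> f b = f (a \<otimes> b)" if "a \<in> carrier G" "b \<in> carrier G" for a b
    using that by (auto simp: f_def m_assoc fun_eq_iff)
  have one: "f \<one> = id" by (auto simp: f_def fun_eq_iff)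
  have bij: "bij (f a)" if "a \<in> carrier G" for a
    using comp[of a "inv a"] comp[of "inv a" a] that one by (intro o_bij[of "f (inv a)"]) auto
  define \<phi> where "\<phi> a = Abs_sym (f a)" for a
  have rep: "Rep_sym (\<phi> a) = f a" if "a \<in> carrier G" for a
    using bij[OF that] by (simp add: \<phi>_def Abs_sym_inverse)
  have "inj_on \<phi> (carrier G)"
  proof (rule inj_onI)
    fix a b assume ab: "a \<in> carrier G" "b \<in> carrier G" "\<phi> a = \<phi> b"
    then have "f a = f b" using rep by metis
    then have "f a \<one> = f b \<one>" by simp
    then show "a = b" using ab by (simp add: f_def)
  qed
  moreover have "\<phi> (a \<otimes> b) = \<phi> a + \<phi> b" if "a \<in> carrier G" "b \<in> carrier G" for a b
    using that by (intro Rep_sym_inject[THEN iffD1]) (simp add: rep plus_sym.rep_eq comp)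
  ultimately show ?thesis by blast
qed

text \<open>\<open>c\<close> is a commutator of \<open>x\<close> and \<open>g\<close> in one order
  or the other. Writing this without inverses lets relations between elementary matrices be inserted
  as they stand.\<close>

lemma (in group) normal_commutator:
  assumes N: "N \<lhd> G" and "x \<in> N" "g \<in> carrier G" "c \<in> carrier G"
    and eq: "x \<otimes> g = c \<otimes> g \<otimes> x \<or> g \<otimes> x = c \<otimes> x \<otimes> g"
  shows "c \<in> N"
proof -
  interpret N: normal N G by fact
  have x: "x \<in> carrier G" using assms(2) N.mem_carrier by blast
  from eq show ?thesis
  proof
    assume e: "x \<otimes> g = c \<otimes> g \<otimes> x"
    have "x \<otimes> (g \<otimes> inv x \<otimes> inv g) = (x \<otimes> g) \<otimes> inv x \<otimes> inv g" using assms x by (simp add: m_assoc)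
    also have "\<dots> = c" unfolding e using assms x by (simp add: m_assoc)
    finally show ?thesis using assms N.inv_op_closed2[of g "inv x"] by (metis N.m_closed N.m_inv_closed)
  next
    assume e: "g \<otimes> x = c \<otimes> x \<otimes> g"
    have "(g \<otimes> x \<otimes> inv g) \<otimes> inv x = c" unfolding e using assms x by (simp add: m_assoc)
    then show ?thesis using assms N.inv_op_closed2[of g x] by (metis N.m_closed N.m_inv_closed)
  qed
qed

section \<open>Elementary matrices\<close>

lemma SL_mult [simp]: "A \<otimes>\<^bsub>SL k\<^esub> B = A * B" by (simp add: SL_def)
lemma SL_one [simp]: "\<one>\<^bsub>SL k\<^esub> = 1\<^sub>m k" by (simp add: SL_def)
lemma SL_carrier: "A \<in> carrier (SL k) \<longleftrightarrow> A \<in> carrier_mat k k \<and> det A = 1" by (simp add: SL_def)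

lemma det_cong:
  assumes "A \<in> carrier_mat n n" "B \<in> carrier_mat n n" "\<And>i j. i < n \<Longrightarrow> j < n \<Longrightarrow> [A $$ (i, j) = B $$ (i, j)] (mod m)"
  shows "[det A = det B] (mod (m::int))"
  unfolding det_def'[OF assms(1)] det_def'[OF assms(2)]
proof (intro cong_sum cong_mult cong_refl cong_prod)
  fix \<pi> i assume "\<pi> \<in> {\<pi>. \<pi> permutes {0..<n}}" "i \<in> {0..<n}"
  then have "i < n" "\<pi> i < n" using permutes_in_image[of \<pi> "{0..<n}" i] by auto
  then show "[A $$ (i, \<pi> i) = B $$ (i, \<pi> i)] (mod m)" by (rule assms(3))
qed

lemma int_subgroup_generator:
  fixes I :: "int set"
  assumes diff: "\<And>a b. a \<in> I \<Longrightarrow> b \<in> I \<Longrightarrow> a - b \<in> I" and n: "n > 0" "int n \<in> I"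
  obtains t :: nat where "0 < t" "t \<le> n" "\<And>a. a \<in> I \<longleftrightarrow> int t dvd a"
proof -
  define t where "t = (LEAST t. 0 < t \<and> int t \<in> I)"
  have t: "0 < t" "int t \<in> I" unfolding t_def using n LeastI[of "\<lambda>t. 0 < t \<and> int t \<in> I" n] by auto
  have least: "t \<le> s" if "0 < s" "int s \<in> I" for s unfolding t_def using that by (intro Least_le) auto
  have zero: "0 \<in> I" using diff[OF t(2) t(2)] by simp
  have add: "a + b \<in> I" if "a \<in> I" "b \<in> I" for a b
    using diff[OF that(1) diff[OF zero that(2)]] by simp
  have mult: "c * int t \<in> I" for c
  proof (induction c rule: int_induct[where k = 0])
    case base
    then show ?case using zero by simp
  next
    case (step1 i)
    then show ?case using add[OF step1(2) t(2)] by (simp add: algebra_simps)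
  next
    case (step2 i)
    then show ?case using diff[OF step2(2) t(2)] by (simp add: algebra_simps)
  qed
  have "a \<in> I \<longleftrightarrow> int t dvd a" for a
  proof
    assume a: "a \<in> I"
    have "a mod int t = a - (a div int t) * int t" by (simp add: minus_div_mult_eq_mod)
    then have "a mod int t \<in> I" using diff[OF a mult] by simp
    moreover have "0 \<le> a mod int t" "a mod int t < int t" using t(1) by auto
    ultimately have "a mod int t = 0"
      using least[of "nat (a mod int t)"] by (cases "a mod int t = 0") auto
    then show "int t dvd a" by auto
  next
    assume "int t dvd a"
    then show "a \<in> I" using mult by (auto elim!: dvdE simp: mult.commute)
  qed
  then show thesis using that t(1) least[OF n] by blast
qed

locale SLk = fixes k :: nat assumes k_ge_3: "k \<ge> 3"
begin

sublocale group "SL k" by (rule group_SL)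

lemma SL_mat: "A \<in> carrier (SL k) \<Longrightarrow> A \<in> carrier_mat k k" by (simp add: SL_carrier)

lemma SL_dim [simp]: "A \<in> carrier (SL k) \<Longrightarrow> dim_row A = k" "A \<in> carrier (SL k) \<Longrightarrow> dim_col A = k"
  by (auto simp: SL_carrier)

lemma SL_closed [simp]: "A \<in> carrier (SL k) \<Longrightarrow> B \<in> carrier (SL k) \<Longrightarrow> A * B \<in> carrier (SL k)"
  using m_closed by simp

lemma SL_assoc: "A \<in> carrier (SL k) \<Longrightarrow> B \<in> carrier (SL k) \<Longrightarrow> C \<in> carrier (SL k) \<Longrightarrow> A * B * C = A * (B * C)"
  using m_assoc by simp

lemma SL_1 [simp]: "1\<^sub>m k \<in> carrier (SL k)" using one_closed by simp

lemma SL_inv_l [simp]: "A \<in> carrier (SL k) \<Longrightarrow> inv\<^bsub>SL k\<^esub> A * A = 1\<^sub>m k" using l_inv by simp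
lemma SL_inv_r [simp]: "A \<in> carrier (SL k) \<Longrightarrow> A * inv\<^bsub>SL k\<^esub> A = 1\<^sub>m k" using r_inv by simp

lemma SL_one_mult [simp]: "A \<in> carrier (SL k) \<Longrightarrow> 1\<^sub>m k * A = A" "A \<in> carrier (SL k) \<Longrightarrow> A * 1\<^sub>m k = A"
  using l_one r_one by simp_all

definition X :: "nat \<Rightarrow> nat \<Rightarrow> int \<Rightarrow> int mat" where "X i j a = addrow_mat k a i j"

lemma X_mat [simp]: "X i j a \<in> carrier_mat k k" by (simp add: X_def)

lemma X_dim [simp]: "dim_row (X i j a) = k" "dim_col (X i j a) = k" by (simp_all add: X_def)

lemma X_index: "r < k \<Longrightarrow> c < k \<Longrightarrow> i \<noteq> j \<Longrightarrow> X i j a $$ (r, c) = (if r = c then 1 else if r = i \<and> c = j then a else 0)"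
  by (auto simp: X_def)

lemma X_SL [simp]: "i \<noteq> j \<Longrightarrow> X i j a \<in> carrier (SL k)"
  by (simp add: SL_carrier X_def det_addrow_mat)

lemma X_mult_index:
  assumes "B \<in> carrier_mat k n" "j < k" "r < k" "c < n"
  shows "(X i j a * B) $$ (r, c) = B $$ (r, c) + (if r = i then a * B $$ (j, c) else 0)"
  using addrow_mat[OF assms(1,2), of a i] assms by (simp add: X_def flip: addrow_mat)

lemma mult_X_index:
  assumes "B \<in> carrier_mat n k" "i < k" "i \<noteq> j" "r < n" "c < k"
  shows "(B * X i j a) $$ (r, c) = B $$ (r, c) + (if c = j then a * B $$ (r, i) else 0)"
proof -
  have "(B * X i j a) $$ (r, c) = (\<Sum>t\<in>{0..<k}. B $$ (r, t) * X i j a $$ (t, c))"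
    using assms by (simp add: times_mat_def scalar_prod_def)
  also have "\<dots> = (\<Sum>t\<in>{0..<k}. (if t = c then B $$ (r, t) else 0) + (if t = i then (if c = j then a * B $$ (r, i) else 0) else 0))"
    using assms by (intro sum.cong) (auto simp: X_index)
  also have "\<dots> = B $$ (r, c) + (if c = j then a * B $$ (r, i) else 0)"
    using assms by (simp add: sum.distrib)
  finally show ?thesis .
qed

lemma X_add: assumes "i \<noteq> j" "i < k" "j < k" shows "X i j a * X i j b = X i j (a + b)"
  using assms by (intro eq_matI) (simp_all add: X_mult_index[of _ k] X_index del: index_mult_mat(1))

lemma X_0: assumes "i \<noteq> j" shows "X i j 0 = 1\<^sub>m k"
  using assms by (intro eq_matI) (simp_all add: X_index)

lemma X_inv: assumes "i \<noteq> j" "i < k" "j < k" shows "inv\<^bsub>SL k\<^esub> X i j a = X i j (- a)"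
  using assms X_add[of i j "- a" a] by (intro inv_equality) (simp_all add: X_0)

lemma X_row: assumes "i \<noteq> j" "i \<noteq> l" "i < k" "j < k" "l < k"
  shows "X i j a * X i l b = X i l b * X i j a"
  using assms by (intro eq_matI) (simp_all add: X_mult_index[of _ k] X_index del: index_mult_mat(1))

lemma X_col: assumes "i \<noteq> j" "l \<noteq> j" "i < k" "j < k" "l < k"
  shows "X i j a * X l j b = X l j b * X i j a"
  using assms by (intro eq_matI) (simp_all add: X_mult_index[of _ k] X_index del: index_mult_mat(1))

lemma X_comm: assumes "i \<noteq> j" "j \<noteq> l" "i \<noteq> l" "i < k" "j < k" "l < k"
  shows "X i j a * X j l b = X i l (a * b) * X j l b * X i j a"
proof -
  have "X i l (a * b) * X j l b * X i j a = X i l (a * b) * (X j l b * X i j a)"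
    using assms by (simp add: SL_assoc)
  also have "\<dots> = X i j a * X j l b"
    using assms by (intro eq_matI)
      (simp_all add: X_mult_index[of _ k] X_index mult_carrier_mat[of _ k k _ k] del: index_mult_mat(1))
  finally show ?thesis by simp
qed

section \<open>Elementary matrices in normal subgroups\<close>

lemma normal_X_row:
  assumes "N \<lhd> SL k" "X i j a \<in> N" "i \<noteq> j" "j \<noteq> l" "i \<noteq> l" "i < k" "j < k" "l < k"
  shows "X i l (a * b) \<in> N"
proof (rule normal_commutator[OF assms(1,2)])
  show "X i j a \<otimes>\<^bsub>SL k\<^esub> X j l b = X i l (a * b) \<otimes>\<^bsub>SL k\<^esub> X j l b \<otimes>\<^bsub>SL k\<^esub> X i j a \<or>
      X j l b \<otimes>\<^bsub>SL k\<^esub> X i j a = X i l (a * b) \<otimes>\<^bsub>SL k\<^esub> X i j a \<otimes>\<^bsub>SL k\<^esub> X j l b"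
    unfolding SL_mult using X_comm[OF assms(3-8)] by blast
qed (use assms in simp_all)

lemma normal_X_col:
  assumes "N \<lhd> SL k" "X j l b \<in> N" "i \<noteq> j" "j \<noteq> l" "i \<noteq> l" "i < k" "j < k" "l < k"
  shows "X i l (a * b) \<in> N"
proof (rule normal_commutator[OF assms(1,2)])
  show "X j l b \<otimes>\<^bsub>SL k\<^esub> X i j a = X i l (a * b) \<otimes>\<^bsub>SL k\<^esub> X i j a \<otimes>\<^bsub>SL k\<^esub> X j l b \<or>
      X i j a \<otimes>\<^bsub>SL k\<^esub> X j l b = X i l (a * b) \<otimes>\<^bsub>SL k\<^esub> X j l b \<otimes>\<^bsub>SL k\<^esub> X i j a"
    unfolding SL_mult using X_comm[OF assms(3-8)] by blast
qed (use assms in simp_all)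

lemma third_index: assumes "i < k" "j < k" obtains l where "l < k" "l \<noteq> i" "l \<noteq> j"
proof -
  have "\<exists>l \<in> {0, 1, 2}. l \<noteq> i \<and> l \<noteq> j" by auto
  then obtain l where "l \<in> {0, 1, 2}" "l \<noteq> i" "l \<noteq> j" by blast
  moreover from this have "l < k" using k_ge_3 by auto
  ultimately show thesis using that by blast
qed

text \<open>A commutator with an elementary matrix of entry 1 changes one index of the position; the
  detour over a third index \<open>t\<close> keeps the intermediate positions off the
  diagonal.\<close>

lemma normal_X_transfer:
  assumes N: "N \<lhd> SL k" and X: "X i j a \<in> N" and ij: "i \<noteq> j" "i < k" "j < k"
    and rs: "r \<noteq> s" "r < k" "s < k"
  shows "X r s a \<in> N"
proof -
  have row: "X i l a \<in> N" if "X i j a \<in> N" "i \<noteq> j" "i \<noteq> l" "i < k" "j < k" "l < k" for i j l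
    using normal_X_row[OF N that(1), of l 1] that by (cases "j = l") auto
  have col: "X i l a \<in> N" if "X j l a \<in> N" "i \<noteq> l" "j \<noteq> l" "i < k" "j < k" "l < k" for i j l
    using normal_X_col[OF N that(1), of i 1] that by (cases "i = j") auto
  obtain t where t: "t < k" "t \<noteq> i" "t \<noteq> r" using third_index[OF ij(2) rs(2)] by blast
  have 1: "X i t a \<in> N" using row[OF X, of t] ij t by auto
  have 2: "X r t a \<in> N" using col[OF 1, of r] ij t rs by auto
  show ?thesis using row[OF 2, of s] t rs by auto
qed

lemma normal_X_mult:
  assumes N: "N \<lhd> SL k" and X: "X i j a \<in> N" and ij: "i \<noteq> j" "i < k" "j < k"
  shows "X i j (a * b) \<in> N"
proof -
  obtain t where t: "t < k" "t \<noteq> i" "t \<noteq> j" using third_index[OF ij(2,3)] by blast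
  have "X i t a \<in> N" using normal_X_transfer[OF N X ij, of i t] t ij by auto
  then show ?thesis using normal_X_row[OF N, of i t a j b] t ij by auto
qed

section \<open>Generation by elementary matrices\<close>

inductive_set elem :: "nat \<Rightarrow> int mat set" for n where
  elem_1: "1\<^sub>m k \<in> elem n"
| elem_X: "g \<in> elem n \<Longrightarrow> i < n \<Longrightarrow> j < n \<Longrightarrow> i \<noteq> j \<Longrightarrow> X i j a * g \<in> elem n"

lemma elem_SL: "g \<in> elem n \<Longrightarrow> g \<in> carrier (SL k)"
  by (induction rule: elem.induct) auto

lemma elem_mult: "g \<in> elem n \<Longrightarrow> h \<in> elem n \<Longrightarrow> g * h \<in> elem n"
  by (induction rule: elem.induct) (auto simp: elem_SL SL_assoc intro: elem_X)

lemma X_elem: "i < n \<Longrightarrow> j < n \<Longrightarrow> i \<noteq> j \<Longrightarrow> X i j a \<in> elem n"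
  using elem_X[OF elem_1, of i n j a] by simp

lemma elem_inv: assumes "n \<le> k" "g \<in> elem n" shows "inv\<^bsub>SL k\<^esub> g \<in> elem n"
  using assms(2)
proof induction
  case elem_1
  then show ?case using inv_one elem.elem_1 by simp
next
  case (elem_X g i j a)
  then have "inv\<^bsub>SL k\<^esub> (X i j a * g) = inv\<^bsub>SL k\<^esub> g * X i j (- a)"
    using inv_mult_group[of "X i j a" g] elem_SL[of g n] assms(1) by (simp add: X_inv)
  then show ?case using elem_mult[OF elem_X.IH X_elem] elem_X by simp
qed

lemma elem_mono: "g \<in> elem m \<Longrightarrow> m \<le> n \<Longrightarrow> g \<in> elem n"
  by (induction rule: elem.induct) (auto intro: elem.intros)

lemma elem_subgroup:
  assumes "subgroup H (SL k)" "\<And>i j a. i < n \<Longrightarrow> j < n \<Longrightarrow> i \<noteq> j \<Longrightarrow> X i j a \<in> H" "g \<in> elem n"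
  shows "g \<in> H"
  using assms(3)
  by induction (use assms subgroup.one_closed[OF assms(1)] subgroup.m_closed[OF assms(1)] in auto)

definition block :: "nat \<Rightarrow> int mat \<Rightarrow> bool" where
  "block n A \<longleftrightarrow> (\<forall>i<k. \<forall>j<k. n \<le> i \<or> n \<le> j \<longrightarrow> A $$ (i, j) = (if i = j then 1 else 0))"

lemma elem_mult_index:
  assumes "g \<in> elem n" "n \<le> k" "B \<in> carrier_mat k m" "c < m"
  shows "r < k \<Longrightarrow> n \<le> r \<Longrightarrow> (g * B) $$ (r, c) = B $$ (r, c)"
    and "(\<And>i. i < n \<Longrightarrow> B $$ (i, c) = 0) \<Longrightarrow> r < k \<Longrightarrow> (g * B) $$ (r, c) = B $$ (r, c)"
  using assms(1)
proof (induction arbitrary: r)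
  case elem_1
  { case 1 then show ?case using assms by simp }
  { case 2 then show ?case using assms by simp }
next
  case (elem_X g i j a)
  have gB: "g * B \<in> carrier_mat k m" using SL_mat[OF elem_SL[OF elem_X.hyps(1)]] assms(3) by simp
  have assoc: "X i j a * g * B = X i j a * (g * B)"
    using SL_mat[OF elem_SL[OF elem_X.hyps(1)]] assms(3) by (intro assoc_mult_mat[of _ k k _ k]) auto
  { case 1 then show ?case
      using elem_X assms gB by (simp add: assoc X_mult_index[OF gB] del: index_mult_mat(1)) }
  { case 2 then show ?case
      using elem_X assms gB by (simp add: assoc X_mult_index[OF gB] del: index_mult_mat(1)) }
qed

lemma elem_block: assumes "g \<in> elem n" "n \<le> k" shows "block n g"
  unfolding block_def
proof (intro allI impI)
  fix i j assume ij: "i < k" "j < k" "n \<le> i \<or> n \<le> j"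
  have "g = g * 1\<^sub>m k" using elem_SL[OF assms(1)] by simp
  moreover have "(g * 1\<^sub>m k) $$ (i, j) = (1\<^sub>m k :: int mat) $$ (i, j)"
    using ij elem_mult_index[OF assms, of "1\<^sub>m k" k j i] assms(2) by fastforce
  ultimately show "g $$ (i, j) = (if i = j then 1 else 0)" using ij by simp
qed

lemma block_elem_mult:
  assumes g: "g \<in> elem n" "n \<le> k" and A: "A \<in> carrier_mat k k" "block n A" shows "block n (g * A)"
  unfolding block_def
proof (intro allI impI)
  fix i j assume ij: "i < k" "j < k" "n \<le> i \<or> n \<le> j"
  have "(g * A) $$ (i, j) = A $$ (i, j)"
  proof (cases "n \<le> i")
    case True
    then show ?thesis using elem_mult_index(1)[OF g A(1) ij(2,1)] by simp
  next
    case False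
    then have "A $$ (t, j) = 0" if "t < n" for t
      using ij that A(2) g(2) unfolding block_def by fastforce
    then show ?thesis using elem_mult_index(2)[OF g A(1) ij(2) _ ij(1)] by blast
  qed
  then show "(g * A) $$ (i, j) = (if i = j then 1 else 0)" using A(2) ij unfolding block_def by metis
qed

text \<open>Euclid's algorithm on the first \<open>n\<close> entries of a column, measured by the
  sum of their absolute values.\<close>

lemma column_reduce:
  assumes n: "1 \<le> n" "n \<le> k" and A: "A \<in> carrier_mat k k" and c: "c < k"
  shows "\<exists>g\<in>elem n. \<forall>i. 0 < i \<and> i < n \<longrightarrow> (g * A) $$ (i, c) = 0"
  using A
proof (induction "nat (\<Sum>i<n. \<bar>A $$ (i, c)\<bar>)" arbitrary: A rule: less_induct)
  case (less A)
  show ?case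
  proof (cases "\<exists>i<n. \<exists>j<n. i \<noteq> j \<and> A $$ (j, c) \<noteq> 0 \<and> \<bar>A $$ (j, c)\<bar> \<le> \<bar>A $$ (i, c)\<bar>")
    case True
    then obtain i j where ij: "i < n" "j < n" "i \<noteq> j" "A $$ (j, c) \<noteq> 0" "\<bar>A $$ (j, c)\<bar> \<le> \<bar>A $$ (i, c)\<bar>"
      by blast
    \<comment> \<open>The sign with which adding the smaller nonzero entry shrinks the larger
      one.\<close>
    define s :: int where "s = - sgn (A $$ (i, c)) * sgn (A $$ (j, c))"
    have s: "\<bar>A $$ (i, c) + s * A $$ (j, c)\<bar> < \<bar>A $$ (i, c)\<bar>"
      using ij(4,5) by (auto simp: s_def sgn_if abs_if split: if_splits)
    let ?B = "X i j s * A"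
    have B: "?B \<in> carrier_mat k k" by (rule mult_carrier_mat[OF X_mat less.prems])
    have ent: "?B $$ (r, c) = A $$ (r, c) + (if r = i then s * A $$ (j, c) else 0)" if "r < k" for r
      using X_mult_index[OF less.prems, of j r c i s] ij n c that by simp
    have "(\<Sum>r<n. \<bar>?B $$ (r, c)\<bar>) < (\<Sum>r<n. \<bar>A $$ (r, c)\<bar>)"
    proof (rule sum_strict_mono_ex1)
      show "\<forall>r\<in>{..<n}. \<bar>?B $$ (r, c)\<bar> \<le> \<bar>A $$ (r, c)\<bar>" using s ent n by (auto simp del: index_mult_mat(1))
      show "\<exists>r\<in>{..<n}. \<bar>?B $$ (r, c)\<bar> < \<bar>A $$ (r, c)\<bar>"
        using s ent[of i] ij(1) n by (intro bexI[of _ i]) (auto simp del: index_mult_mat(1))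
    qed simp
    moreover have "0 \<le> (\<Sum>r<n. \<bar>?B $$ (r, c)\<bar>)" by (rule sum_nonneg) simp
    ultimately have "nat (\<Sum>r<n. \<bar>?B $$ (r, c)\<bar>) < nat (\<Sum>r<n. \<bar>A $$ (r, c)\<bar>)" by linarith
    from less.hyps[OF this B] obtain g where g: "g \<in> elem n"
      "\<forall>i. 0 < i \<and> i < n \<longrightarrow> (g * ?B) $$ (i, c) = 0" by blast
    have "g * ?B = (g * X i j s) * A"
      using SL_mat[OF elem_SL[OF g(1)]] less.prems by (simp add: assoc_mult_mat[of _ k k _ k _ k])
    then show ?thesis using g elem_mult[OF g(1) X_elem[of i n j s]] ij by metis
  next
    case False
    show ?thesis
    proof (cases "\<exists>i. 0 < i \<and> i < n \<and> A $$ (i, c) \<noteq> 0")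
      case False
      then show ?thesis using less.prems elem_1 by (intro bexI[of _ "1\<^sub>m k"]) auto
    next
      case True
      then obtain l where l: "0 < l" "l < n" "A $$ (l, c) \<noteq> 0" by blast
      have z: "A $$ (i, c) = 0" if "i < n" "i \<noteq> l" for i
        using False l that by (metis linorder_le_cases)
      \<comment> \<open>A single nonzero entry is left, but in row \<open>l\<close>: it is added to
        row 0 and then cancelled in row \<open>l\<close>.\<close>
      let ?g = "X l 0 (- 1) * X 0 l 1"
      have B: "X 0 l 1 * A \<in> carrier_mat k k" by (rule mult_carrier_mat[OF X_mat less.prems])
      have "?g * A = X l 0 (- 1) * (X 0 l 1 * A)"
        using less.prems by (simp add: assoc_mult_mat[of _ k k _ k _ k])
      then have "(?g * A) $$ (i, c) = 0" if "0 < i" "i < n" for i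
        using that l z n c X_mult_index[OF B, of 0 i c l "- 1"] X_mult_index[OF less.prems, of l i c 0 1]
          X_mult_index[OF less.prems, of l 0 c 0 1]
        by (auto simp del: index_mult_mat(1))
      moreover have "?g \<in> elem n" using l by (intro elem_mult X_elem) auto
      ultimately show ?thesis by blast
    qed
  qed
qed

text \<open>Column \<open>n\<close> is a unit vector, so adding multiples of it to earlier columns
  changes row \<open>n\<close> only. The predicate \<open>P\<close> tracks the group in which the
  factor lies: \<open>elem\<close> for generation, \<open>E m\<close> for the relative
  version.\<close>

lemma clear_row:
  assumes B: "B \<in> carrier_mat k k" and n: "n < k" and col: "\<And>i. i < k \<Longrightarrow> B $$ (i, n) = (if i = n then 1 else 0)"
    and P1: "P (1\<^sub>m k)" and PX: "\<And>h j. P h \<Longrightarrow> j < n \<Longrightarrow> P (h * X n j (- (B $$ (n, j))))"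
  shows "\<exists>h\<in>carrier (SL k). P h \<and> (\<forall>i<k. \<forall>j<k. (B * h) $$ (i, j) = (if i = n \<and> j < n then 0 else B $$ (i, j)))"
proof -
  have "\<exists>h\<in>carrier (SL k). P h \<and> (\<forall>i<k. \<forall>j<k. (B * h) $$ (i, j) = (if i = n \<and> j < m then 0 else B $$ (i, j)))"
    if "m \<le> n" for m
    using that
  proof (induction m)
    case 0
    then show ?case using B P1 by (intro bexI[of _ "1\<^sub>m k"]) auto
  next
    case (Suc m)
    then obtain h where h: "h \<in> carrier (SL k)" "P h"
      "\<And>i j. i < k \<Longrightarrow> j < k \<Longrightarrow> (B * h) $$ (i, j) = (if i = n \<and> j < m then 0 else B $$ (i, j))" by auto
    let ?h = "h * X n m (- (B $$ (n, m)))"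
    have hB: "B * h \<in> carrier_mat k k" using B SL_mat[OF h(1)] by simp
    have "B * ?h = B * h * X n m (- (B $$ (n, m)))"
      using B SL_mat[OF h(1)] by (simp add: assoc_mult_mat[of _ k k _ k _ k])
    then have "(B * ?h) $$ (i, j) = (if i = n \<and> j < Suc m then 0 else B $$ (i, j))" if "i < k" "j < k" for i j
      using that mult_X_index[OF hB n, of m i j] h(3)[of i n] h(3)[of i j] Suc.prems n col[of i]
      by (auto simp: less_Suc_eq simp del: index_mult_mat(1))
    moreover have "?h \<in> carrier (SL k)" using h(1) Suc.prems by auto
    moreover have "P ?h" using PX[OF h(2), of m] Suc.prems by simp
    ultimately show ?case by blast
  qed
  then show ?thesis by blast
qed

lemma dvd_det_column:
  fixes A :: "int mat"
  assumes "A \<in> carrier_mat k k" "c < k" "\<And>i. i < k \<Longrightarrow> d dvd A $$ (i, c)"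
  shows "d dvd det A"
  unfolding laplace_expansion_column[OF assms(1,2)] using assms by (intro dvd_sum dvd_mult2) auto

lemma elem_cancel:
  assumes "n \<le> k" "g \<in> elem n" "A \<in> carrier (SL k)" "g * A \<in> elem n" shows "A \<in> elem n"
proof -
  have "inv\<^bsub>SL k\<^esub> g * (g * A) \<in> elem n" using elem_mult[OF elem_inv[OF assms(1,2)] assms(4)] .
  moreover have "inv\<^bsub>SL k\<^esub> g * (g * A) = A" using elem_SL[OF assms(2)] assms(3) by (simp flip: SL_assoc)
  ultimately show ?thesis by simp
qed

lemma elem_cancel_right:
  assumes "n \<le> k" "g \<in> elem n" "A \<in> carrier (SL k)" "A * g \<in> elem n" shows "A \<in> elem n"
proof -
  have "(A * g) * inv\<^bsub>SL k\<^esub> g \<in> elem n" using elem_mult[OF assms(4) elem_inv[OF assms(1,2)]] .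
  moreover have "(A * g) * inv\<^bsub>SL k\<^esub> g = A" using elem_SL[OF assms(2)] assms(3) by (simp add: SL_assoc)
  ultimately show ?thesis by simp
qed

theorem block_elem:
  assumes "1 \<le> n" "n \<le> k" "A \<in> carrier (SL k)" "block n A" shows "A \<in> elem n"
  using assms
proof (induction n arbitrary: A rule: nat_induct_at_least[of 1, consumes 1])
  case base
  have k0: "0 < k" using k_ge_3 by simp
  have "A = multrow_mat k 0 (A $$ (0, 0))"
    using base by (intro eq_matI) (auto simp: block_def multrow_mat_def)
  then have "det A = A $$ (0, 0)" using det_multrow_mat[OF k0, of "A $$ (0, 0)"] by simp
  then have "A $$ (0, 0) = 1" using base by (simp add: SL_carrier)
  have "A $$ (i, j) = (1\<^sub>m k :: int mat) $$ (i, j)" if "i < k" "j < k" for i j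
    using base(3) that \<open>A $$ (0, 0) = 1\<close> unfolding block_def
    by (cases "i = 0 \<and> j = 0") (auto simp: Suc_le_eq)
  then have "A = 1\<^sub>m k" using base by (intro eq_matI) auto
  then show ?case using elem_1 by simp
next
  case (Suc n)
  have nk: "n < k" using Suc by simp
  note A = Suc.prems(2)
  obtain g where g: "g \<in> elem (Suc n)" "\<And>i. 0 < i \<Longrightarrow> i < Suc n \<Longrightarrow> (g * A) $$ (i, n) = 0"
    using column_reduce[of "Suc n" A n] Suc.prems SL_mat[OF A] nk by auto
  define B where "B = g * A"
  have B: "B \<in> carrier (SL k)" using elem_SL[OF g(1)] A by (simp add: B_def)
  have Bm: "B \<in> carrier_mat k k" using SL_mat[OF B] .
  have Bz: "B $$ (i, n) = 0" if "i < k" "0 < i" for i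
  proof (cases "i < Suc n")
    case True
    then show ?thesis using g(2)[of i] that by (simp add: B_def del: index_mult_mat(1))
  next
    case False
    then have "B $$ (i, n) = A $$ (i, n)"
      unfolding B_def using elem_mult_index(1)[OF g(1) _ SL_mat[OF A] nk, of i] that Suc.prems by simp
    then show ?thesis using Suc.prems(3) False that nk by (simp add: block_def)
  qed
  \<comment> \<open>The only entry of column \<open>n\<close> that can be nonzero, so it divides the
    determinant and is 1 or -1. The matrix \<open>g'\<close> puts d * d = 1 into row
    \<open>n\<close> and then clears row 0.\<close>
  define d where "d = B $$ (0, n)"
  have "d dvd B $$ (i, n)" if "i < k" for i using Bz that by (cases "i = 0") (auto simp: d_def)
  then have "d dvd 1" using dvd_det_column[OF Bm nk, of d] B by (simp add: SL_carrier)
  then have dd: "d * d = 1" by (auto simp: zdvd1_eq abs_if split: if_splits)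
  have n0: "n \<noteq> 0" using Suc by simp
  define g' where "g' = X 0 n (- d) * X n 0 d"
  define B' where "B' = g' * B"
  have g': "g' \<in> elem (Suc n)" unfolding g'_def using n0 by (intro elem_mult X_elem) auto
  have B': "B' \<in> carrier (SL k)" using elem_SL[OF g'] B by (simp add: B'_def)
  have Bm1: "X n 0 d * B \<in> carrier_mat k k" by (rule mult_carrier_mat[OF X_mat Bm])
  have B'eq: "B' = X 0 n (- d) * (X n 0 d * B)"
    unfolding B'_def g'_def using n0 B by (simp add: SL_assoc)
  have col: "B' $$ (i, n) = (if i = n then 1 else 0)" if "i < k" for i
    unfolding B'eq
    using that nk n0 Bz[of i] Bz[of n] dd X_mult_index[OF Bm1 nk that nk, of 0 "- d"] k_ge_3
      X_mult_index[OF Bm _ that nk, of 0 n d] X_mult_index[OF Bm _ nk nk, of 0 n d]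
    by (auto simp: d_def[symmetric] simp del: index_mult_mat(1))
  have "block (Suc n) (g' * (g * A))"
    using Suc.prems(1) by (intro block_elem_mult g' g(1) Suc.prems(3) SL_mat[OF A] mult_carrier_mat[OF SL_mat[OF elem_SL[OF g(1)]]])
  then have blk: "B' $$ (i, j) = (if i = j then 1 else 0)" if "i < k" "j < k" "Suc n \<le> i \<or> Suc n \<le> j" for i j
    using that unfolding block_def B'_def B_def by metis
  obtain h where h: "h \<in> carrier (SL k)" "h \<in> elem (Suc n)"
    "\<And>i j. i < k \<Longrightarrow> j < k \<Longrightarrow> (B' * h) $$ (i, j) = (if i = n \<and> j < n then 0 else B' $$ (i, j))"
  proof -
    have "h * X n j (- B' $$ (n, j)) \<in> elem (Suc n)" if "h \<in> elem (Suc n)" "j < n" for h j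
      using that by (intro elem_mult X_elem) auto
    from clear_row[OF SL_mat[OF B'] nk col, of "\<lambda>h. h \<in> elem (Suc n)", OF _ elem_1 this]
    show ?thesis using that by blast
  qed
  have "block n (B' * h)"
    unfolding block_def
  proof (intro allI impI)
    fix i j assume ij: "i < k" "j < k" "n \<le> i \<or> n \<le> j"
    show "(B' * h) $$ (i, j) = (if i = j then 1 else 0)"
    proof (cases "i = n \<and> j < n \<or> j = n")
      case True
      then show ?thesis using h(3) ij col by auto
    next
      case False
      then have "Suc n \<le> i \<or> Suc n \<le> j" using ij by linarith
      then show ?thesis using h(3) ij blk False by auto
    qed
  qed
  from Suc.IH[OF less_imp_le[OF nk] SL_closed[OF B' h(1)] this] have "B' * h \<in> elem n" .
  from elem_mono[OF this, of "Suc n"] have "B' * h \<in> elem (Suc n)" by simp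
  then have "B' \<in> elem (Suc n)" using elem_cancel_right[OF _ h(2) B'] Suc.prems by simp
  then have "B \<in> elem (Suc n)" unfolding B'_def using elem_cancel[OF _ g' B] Suc.prems by simp
  then show ?case unfolding B_def using elem_cancel[OF _ g(1) A] Suc.prems by simp
qed

section \<open>The normal closure of an elementary matrix\<close>

lemma mult_entry:
  assumes "A \<in> carrier_mat k k" "B \<in> carrier_mat k k" "i < k" "j < k"
  shows "(A * B) $$ (i, j) = (\<Sum>t<k. A $$ (i, t) * B $$ (t, j))"
  using assms by (simp add: times_mat_def scalar_prod_def atLeast0LessThan)

lemma mult_block_col:
  assumes "A \<in> carrier_mat k k" "h \<in> carrier_mat k k" "block n h" "n \<le> c" "i < k" "c < k"
  shows "(A * h) $$ (i, c) = A $$ (i, c)"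
proof -
  have "(A * h) $$ (i, c) = (\<Sum>t<k. if t = c then A $$ (i, c) else 0)"
    unfolding mult_entry[OF assms(1,2,5,6)] using assms(3,4,6) by (intro sum.cong) (auto simp: block_def)
  then show ?thesis using assms by simp
qed

section \<open>Principal congruence subgroups and their reduction to the corner\<close>

definition mat_cong :: "int \<Rightarrow> int mat \<Rightarrow> int mat \<Rightarrow> bool" where
  "mat_cong m A B \<longleftrightarrow> (\<forall>i<k. \<forall>j<k. [A $$ (i, j) = B $$ (i, j)] (mod m))"

lemma mat_cong_refl [simp]: "mat_cong m A A" by (simp add: mat_cong_def)
lemma mat_cong_sym: "mat_cong m A B \<Longrightarrow> mat_cong m B A" by (simp add: mat_cong_def cong_sym)
lemma mat_cong_trans: "mat_cong m A B \<Longrightarrow> mat_cong m B C \<Longrightarrow> mat_cong m A C" unfolding mat_cong_def using cong_trans by blast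

lemma mat_cong_mult:
  assumes "A \<in> carrier_mat k k" "B \<in> carrier_mat k k" "A' \<in> carrier_mat k k" "B' \<in> carrier_mat k k"
    and "mat_cong m A A'" "mat_cong m B B'"
  shows "mat_cong m (A * B) (A' * B')"
  unfolding mat_cong_def
proof (intro allI impI)
  fix i j assume "i < k" "j < k"
  then show "[(A * B) $$ (i, j) = (A' * B') $$ (i, j)] (mod m)"
    using assms unfolding mat_cong_def
    by (simp add: mult_entry del: index_mult_mat(1)) (intro cong_sum cong_mult, auto)
qed

definition Gam :: "int \<Rightarrow> int mat set" where "Gam m = {A \<in> carrier (SL k). mat_cong m A (1\<^sub>m k)}"

lemma Gam_normal: "Gam m \<lhd> SL k"
proof -
  have 1: "A * B \<in> Gam m" if "A \<in> Gam m" "B \<in> Gam m" for A B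
    using that mat_cong_mult[of A B "1\<^sub>m k" "1\<^sub>m k" m] by (auto simp: Gam_def SL_mat)
  have 2: "inv\<^bsub>SL k\<^esub> A \<in> Gam m" if "A \<in> Gam m" for A
    using that mat_cong_mult[of "inv\<^bsub>SL k\<^esub> A" "1\<^sub>m k" "inv\<^bsub>SL k\<^esub> A" A m]
    by (auto simp: Gam_def SL_mat intro: mat_cong_sym)
  have 3: "x * A * inv\<^bsub>SL k\<^esub> x \<in> Gam m" if "A \<in> Gam m" "x \<in> carrier (SL k)" for A x
  proof -
    have "mat_cong m (x * A) x" using that mat_cong_mult[of x A x "1\<^sub>m k" m] by (auto simp: Gam_def SL_mat)
    then have "mat_cong m (x * A * inv\<^bsub>SL k\<^esub> x) (x * inv\<^bsub>SL k\<^esub> x)"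
      using that by (intro mat_cong_mult) (auto simp: Gam_def SL_mat)
    then show ?thesis using that by (auto simp: Gam_def)
  qed
  have "subgroup (Gam m) (SL k)"
    using 1 2 by (intro subgroupI) (auto simp: Gam_def intro!: exI[of _ "1\<^sub>m k"])
  then show ?thesis using 3 by (simp add: normal_inv_iff)
qed

lemma Gam_iff_mat_cong:
  assumes "A \<in> carrier (SL k)" "B \<in> carrier (SL k)"
  shows "A * inv\<^bsub>SL k\<^esub> B \<in> Gam m \<longleftrightarrow> mat_cong m A B"
proof
  assume "A * inv\<^bsub>SL k\<^esub> B \<in> Gam m"
  then have "mat_cong m (A * inv\<^bsub>SL k\<^esub> B * B) (1\<^sub>m k * B)"
    using assms by (intro mat_cong_mult) (auto simp: Gam_def SL_mat)
  then show "mat_cong m A B" using assms by (simp add: SL_assoc)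
next
  assume "mat_cong m A B"
  then have "mat_cong m (A * inv\<^bsub>SL k\<^esub> B) (B * inv\<^bsub>SL k\<^esub> B)"
    using assms by (intro mat_cong_mult) (auto simp: SL_mat)
  then show "A * inv\<^bsub>SL k\<^esub> B \<in> Gam m" using assms by (simp add: Gam_def)
qed

definition E :: "int \<Rightarrow> int mat set" where
  "E m = carrier (SL k) \<inter> \<Inter>{N. N \<lhd> SL k \<and> X 0 1 m \<in> N}"

lemma E_normal: "E m \<lhd> SL k"
  unfolding E_def by (rule normal_Inter_carrier) auto

lemma E_subset: "N \<lhd> SL k \<Longrightarrow> X 0 1 m \<in> N \<Longrightarrow> E m \<subseteq> N"
  unfolding E_def by auto

lemma X_E: assumes "i \<noteq> j" "i < k" "j < k" shows "X i j (m * a) \<in> E m"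
proof -
  have "X 0 1 m \<in> E m" unfolding E_def by auto
  then have "X i j m \<in> E m" using normal_X_transfer[OF E_normal[of m], of 0 1 m i j] assms k_ge_3 by auto
  then show ?thesis using normal_X_mult[OF E_normal] assms by blast
qed

lemma E_closed:
  "A \<in> E m \<Longrightarrow> B \<in> E m \<Longrightarrow> A * B \<in> E m" "A \<in> E m \<Longrightarrow> A \<in> carrier (SL k)"
  "A \<in> E m \<Longrightarrow> x \<in> carrier (SL k) \<Longrightarrow> x * A * inv\<^bsub>SL k\<^esub> x \<in> E m"
  "A \<in> E m \<Longrightarrow> x \<in> carrier (SL k) \<Longrightarrow> inv\<^bsub>SL k\<^esub> x * A * x \<in> E m"
  "A \<in> E m \<Longrightarrow> inv\<^bsub>SL k\<^esub> A \<in> E m" "1\<^sub>m k \<in> E m"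
proof -
  interpret E: normal "E m" "SL k" by (rule E_normal)
  show "A \<in> E m \<Longrightarrow> B \<in> E m \<Longrightarrow> A * B \<in> E m" "A \<in> E m \<Longrightarrow> A \<in> carrier (SL k)"
    "A \<in> E m \<Longrightarrow> x \<in> carrier (SL k) \<Longrightarrow> x * A * inv\<^bsub>SL k\<^esub> x \<in> E m"
    "A \<in> E m \<Longrightarrow> x \<in> carrier (SL k) \<Longrightarrow> inv\<^bsub>SL k\<^esub> x * A * x \<in> E m"
    "A \<in> E m \<Longrightarrow> inv\<^bsub>SL k\<^esub> A \<in> E m" "1\<^sub>m k \<in> E m"
    using E.m_closed E.mem_carrier E.inv_op_closed2 E.inv_op_closed1 E.m_inv_closed E.one_closed
    by (auto simp del: E.one_closed)
qed

lemma E_Gam: "E m \<subseteq> Gam m"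
proof (rule E_subset[OF Gam_normal])
  show "X 0 1 m \<in> Gam m" using k_ge_3 by (auto simp: Gam_def mat_cong_def X_index cong_0_iff)
qed

lemma Gam_entry:
  "A \<in> Gam m \<Longrightarrow> i < k \<Longrightarrow> j < k \<Longrightarrow> i \<noteq> j \<Longrightarrow> m dvd A $$ (i, j)"
  "A \<in> Gam m \<Longrightarrow> i < k \<Longrightarrow> [A $$ (i, i) = 1] (mod m)"
proof -
  have "[A $$ (i, j) = (1\<^sub>m k :: int mat) $$ (i, j)] (mod m)" if "A \<in> Gam m" "i < k" "j < k" for j
    using that unfolding Gam_def mat_cong_def by blast
  then show "A \<in> Gam m \<Longrightarrow> i < k \<Longrightarrow> j < k \<Longrightarrow> i \<noteq> j \<Longrightarrow> m dvd A $$ (i, j)"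
    "A \<in> Gam m \<Longrightarrow> i < k \<Longrightarrow> [A $$ (i, i) = 1] (mod m)"
    by (force simp: cong_0_iff)+
qed

text \<open>A stable range argument carried out inside \<open>E m\<close>. Since 2 \<le> n, row 1 is
  free besides the rows 0 and n: a Bezout combination with coefficients divisible by
  \<open>m\<close> creates the value \<open>m\<close> there, and this corrects the diagonal entry 1
  + s m to 1.\<close>

lemma Gam_column_clear:
  assumes A: "A \<in> Gam m" and n: "2 \<le> n" "n < k" and blk: "block (Suc n) A"
  shows "\<exists>e. e \<in> E m \<and> e \<in> elem (Suc n) \<and> (\<forall>i<k. (e * A) $$ (i, n) = (if i = n then 1 else 0))"
proof -
  have AS: "A \<in> carrier (SL k)" using A unfolding Gam_def by blast
  obtain g where g: "g \<in> elem n" "\<And>i. 0 < i \<Longrightarrow> i < n \<Longrightarrow> (g * A) $$ (i, n) = 0"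
    using column_reduce[of n A n] n SL_mat[OF AS] by auto
  have gS: "g \<in> carrier (SL k)" using elem_SL[OF g(1)] .
  define B where "B = g * A * inv\<^bsub>SL k\<^esub> g"
  interpret Gm: normal "Gam m" "SL k" by (rule Gam_normal)
  have BG: "B \<in> Gam m" unfolding B_def using Gm.inv_op_closed2[OF gS A] by simp
  have BS: "B \<in> carrier (SL k)" using BG unfolding Gam_def by blast
  note B = SL_mat[OF BS]
  have gi: "inv\<^bsub>SL k\<^esub> g \<in> elem n" using elem_inv[OF _ g(1)] n by simp
  have Bcol: "B $$ (i, n) = (g * A) $$ (i, n)" if "i < k" for i
    unfolding B_def using mult_block_col[OF _ _ elem_block[OF gi]] that n gS AS by (simp add: SL_mat del: index_mult_mat(1))
  have gAn: "(g * A) $$ (i, n) = A $$ (i, n)" if "n \<le> i" "i < k" for i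
    using elem_mult_index(1)[OF g(1) _ SL_mat[OF AS], of n i] that n by simp
  have Bz: "B $$ (i, n) = 0" if "i < k" "i \<noteq> 0" "i \<noteq> n" for i
  proof (cases "i < n")
    case True
    then show ?thesis using Bcol g(2) that by simp
  next
    case False
    then have "B $$ (i, n) = A $$ (i, n)" using Bcol gAn that by simp
    then show ?thesis using blk that n False unfolding block_def by auto
  qed
  define b where "b = B $$ (0, n)"
  define a where "a = B $$ (n, n)"
  have "m dvd b" using Gam_entry(1)[OF BG, of 0 n] n unfolding b_def by simp
  then obtain r where r: "b = m * r" ..
  have "[a = 1] (mod m)" using Gam_entry(2)[OF BG n(2)] unfolding a_def .
  then obtain s where s: "a = 1 + s * m" by (metis cong_iff_lin cong_sym mult.commute)
  have "gcd b a dvd B $$ (i, n)" if "i < k" for i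
    using Bz[OF that] by (cases "i = 0"; cases "i = n") (auto simp: a_def b_def)
  then have "gcd b a dvd 1" using dvd_det_column[OF B n(2)] BS by (metis (no_types, lifting) SL_carrier)
  then obtain \<alpha> \<beta> where ab: "\<alpha> * b + \<beta> * a = 1" using bezout_int[of b a] by (metis is_unit_gcd_iff)
  have n01: "n \<noteq> 0" "n \<noteq> 1" "1 < n" "1 < k" "0 < k" using n by auto
  \<comment> \<open>\<open>X n 1 s\<close> need not lie in \<open>E m\<close>, so it enters by
    conjugation. Its right-hand copy acts first and leaves the column unchanged, because the entry
    in row 1 is 0; the left-hand copy makes the correction. Afterwards \<open>e2\<close> clears the
    rows 1 and 0.\<close>
  define e1 where "e1 = inv\<^bsub>SL k\<^esub> X n 1 s * (X 1 0 (m * \<alpha>) * X 1 n (m * \<beta>)) * X n 1 s"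
  define e2 where "e2 = X 0 n (m * - r) * X 1 n (m * - 1)"
  have inner: "X 1 0 (m * \<alpha>) * X 1 n (m * \<beta>) \<in> E m" using n01 n by (intro E_closed X_E) auto
  have e1: "e1 \<in> E m" unfolding e1_def using E_closed(4)[OF inner] n01 by simp
  have e2: "e2 \<in> E m" unfolding e2_def using n01 n by (intro E_closed X_E) auto
  have e1': "e1 = X n 1 (- s) * (X 1 0 (m * \<alpha>) * (X 1 n (m * \<beta>) * X n 1 s))"
    unfolding e1_def using n01 n X_inv[of n 1 s] by (simp add: SL_assoc)
  have el1: "e1 \<in> elem (Suc n)" unfolding e1' using n01 n by (intro elem_mult X_elem) auto
  have el2: "e2 \<in> elem (Suc n)" unfolding e2_def using n01 n by (intro elem_mult X_elem) auto
  define C1 where "C1 = X n 1 s * B"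
  define C2 where "C2 = X 1 n (m * \<beta>) * C1"
  define C3 where "C3 = X 1 0 (m * \<alpha>) * C2"
  define C4 where "C4 = X n 1 (- s) * C3"
  define C5 where "C5 = X 1 n (m * - 1) * C4"
  define C where "C = X 0 n (m * - r) * C5"
  have cm: "C1 \<in> carrier_mat k k" "C2 \<in> carrier_mat k k" "C3 \<in> carrier_mat k k" "C4 \<in> carrier_mat k k"
      "C5 \<in> carrier_mat k k" "C \<in> carrier_mat k k"
    unfolding C_def C5_def C4_def C3_def C2_def C1_def by (intro mult_carrier_mat[OF X_mat] B)+
  have Ceq: "C = (e2 * e1) * B"
    unfolding C_def C5_def C4_def C3_def C2_def C1_def e1' e2_def using n01 n BS by (simp add: SL_assoc)
  have B1: "B $$ (Suc 0, n) = 0" using Bz[of 1] n01 by simp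
  have v1: "C1 $$ (i, n) = B $$ (i, n)" if "i < k" for i
    unfolding C1_def using X_mult_index[OF B, of 1 i n n s] that n n01 B1 by (simp del: index_mult_mat(1))
  have v2: "C2 $$ (i, n) = (if i = 1 then m * \<beta> * a else B $$ (i, n))" if "i < k" for i
    unfolding C2_def using X_mult_index[OF cm(1), of n i n 1 "m * \<beta>"] that n n01 v1 B1
    by (simp add: a_def del: index_mult_mat(1))
  have v3: "C3 $$ (i, n) = (if i = 1 then m else B $$ (i, n))" if "i < k" for i
  proof -
    have "m * \<alpha> * b + m * \<beta> * a = m * (\<alpha> * b + \<beta> * a)" by (simp add: algebra_simps)
    then have "m * \<beta> * a + m * \<alpha> * b = m" using ab by (simp add: add.commute)
    then show ?thesis
      unfolding C3_def using X_mult_index[OF cm(2), of 0 i n 1 "m * \<alpha>"] that n n01 v2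
      by (simp add: b_def[symmetric] del: index_mult_mat(1))
  qed
  have v4: "C4 $$ (i, n) = (if i = 1 then m else if i = n then 1 else B $$ (i, n))" if "i < k" for i
    unfolding C4_def using X_mult_index[OF cm(3), of 1 i n n "- s"] that n n01 v3 s
    by (simp add: a_def[symmetric] del: index_mult_mat(1))
  have v5: "C5 $$ (i, n) = (if i = 1 then 0 else if i = n then 1 else B $$ (i, n))" if "i < k" for i
    unfolding C5_def using X_mult_index[OF cm(4), of n i n 1 "m * - 1"] that n n01 v4
    by (simp del: index_mult_mat(1))
  have v6: "C $$ (i, n) = (if i = n then 1 else 0)" if "i < k" for i
    unfolding C_def using X_mult_index[OF cm(5), of n i n 0 "m * - r"] that n n01 v5 r Bz[of i]
    by (simp add: b_def[symmetric] del: index_mult_mat(1))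
  \<comment> \<open>Undoing the conjugation by \<open>g\<close> stays in the normal subgroup
    \<open>E m\<close> and keeps the unit column, since \<open>g\<close> involves only indices below
    \<open>n\<close>.\<close>
  define e where "e = inv\<^bsub>SL k\<^esub> g * (e2 * e1) * g"
  have e21: "e2 * e1 \<in> E m" using E_closed(1)[OF e2 e1] .
  have eE: "e \<in> E m" unfolding e_def using E_closed(4)[OF e21 gS] .
  have ee: "e \<in> elem (Suc n)"
    unfolding e_def using elem_mono[OF g(1), of "Suc n"] elem_mono[OF gi, of "Suc n"] el1 el2
    by (intro elem_mult) auto
  have CS: "C \<in> carrier (SL k)" unfolding Ceq using E_closed(2)[OF e21] BS by simp
  have eA: "e * A = inv\<^bsub>SL k\<^esub> g * (C * g)"
    unfolding e_def Ceq B_def using E_closed(2)[OF e21] gS AS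
    by (simp add: SL_assoc)
  have Cg: "(C * g) $$ (i, n) = (if i = n then 1 else 0)" if "i < k" for i
    using mult_block_col[OF cm(6) SL_mat[OF gS] elem_block[OF g(1)], of n i] that n v6 by simp
  have "(e * A) $$ (i, n) = (if i = n then 1 else 0)" if "i < k" for i
  proof -
    have CgS: "C * g \<in> carrier_mat k k" using CS gS by (simp add: SL_mat)
    have "(inv\<^bsub>SL k\<^esub> g * (C * g)) $$ (i, n) = (C * g) $$ (i, n)"
      using elem_mult_index(2)[OF gi _ CgS n(2) _ that] Cg n by simp
    then show ?thesis unfolding eA using Cg[OF that] by simp
  qed
  then show ?thesis using eE ee by blast
qed

text \<open>Rows and columns are stripped off from the end. The process stops at the SL_2 corner,
  where \<open>Gam_column_clear\<close> would have no spare row.\<close>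

lemma Gam_decompose:
  assumes "2 \<le> n" "n \<le> k" "A \<in> Gam m" "block n A" shows "\<exists>e\<in>E m. \<exists>b\<in>elem 2. A = e * b"
  using assms
proof (induction n arbitrary: A rule: nat_induct_at_least[of 2, consumes 1])
  case base
  then have "A \<in> elem 2" using block_elem[of 2 A] by (simp add: Gam_def)
  then show ?case using E_closed(6) elem_SL by (metis SL_one_mult(1))
next
  case (Suc n)
  have nk: "n < k" using Suc by simp
  obtain e where e: "e \<in> E m" "e \<in> elem (Suc n)" "\<And>i. i < k \<Longrightarrow> (e * A) $$ (i, n) = (if i = n then 1 else 0)"
    using Gam_column_clear[OF Suc.prems(2) Suc.hyps nk Suc.prems(3)] by blast
  have AS: "A \<in> carrier (SL k)" using Suc.prems unfolding Gam_def by blast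
  define D where "D = e * A"
  interpret Gm: normal "Gam m" "SL k" by (rule Gam_normal)
  have DG: "D \<in> Gam m" unfolding D_def using Gm.m_closed[of e A] e(1) E_Gam Suc.prems by auto
  have DS: "D \<in> carrier (SL k)" using DG unfolding Gam_def by blast
  have Dblk: "block (Suc n) D"
    unfolding D_def using block_elem_mult[OF e(2) Suc.prems(1) SL_mat[OF AS] Suc.prems(3)] .
  have col: "D $$ (i, n) = (if i = n then 1 else 0)" if "i < k" for i unfolding D_def using e(3)[OF that] .
  have PX: "h * X n j (- D $$ (n, j)) \<in> E m" if hj: "h \<in> E m" "j < n" for h j
  proof -
    obtain t where "D $$ (n, j) = m * t" using Gam_entry(1)[OF DG nk, of j] hj nk by (auto elim: dvdE)
    then have "X n j (- D $$ (n, j)) \<in> E m" using X_E[of n j m "- t"] hj nk by simp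
    then show ?thesis using E_closed(1) hj by blast
  qed
  obtain h where h: "h \<in> carrier (SL k)" "h \<in> E m"
    "\<And>i j. i < k \<Longrightarrow> j < k \<Longrightarrow> (D * h) $$ (i, j) = (if i = n \<and> j < n then 0 else D $$ (i, j))"
    using clear_row[OF SL_mat[OF DS] nk col, of "\<lambda>h. h \<in> E m", OF _ E_closed(6) PX] by blast
  have "block n (D * h)"
    unfolding block_def
  proof (intro allI impI)
    fix i j assume ij: "i < k" "j < k" "n \<le> i \<or> n \<le> j"
    show "(D * h) $$ (i, j) = (if i = j then 1 else 0)"
    proof (cases "i = n \<and> j < n \<or> j = n")
      case True
      then show ?thesis using h(3) ij col by auto
    next
      case False
      then have "Suc n \<le> i \<or> Suc n \<le> j" using ij by linarith
      then show ?thesis using h(3) ij Dblk False unfolding block_def by auto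
    qed
  qed
  moreover have "D * h \<in> Gam m" using Gm.m_closed[OF DG, of h] h(2) E_Gam by auto
  ultimately obtain e' b where eb: "e' \<in> E m" "b \<in> elem 2" "D * h = e' * b" using Suc.IH[of "D * h"] nk by auto
  have S: "e \<in> carrier (SL k)" "e' \<in> carrier (SL k)" "b \<in> carrier (SL k)" "h \<in> carrier (SL k)"
    using E_closed(2) e eb h elem_SL by auto
  \<comment> \<open>The row operations \<open>h\<close> stand on the right; conjugation by
    \<open>b\<close> carries them to the left, into the \<open>E m\<close> factor.\<close>
  define f where "f = inv\<^bsub>SL k\<^esub> e * e' * (b * inv\<^bsub>SL k\<^esub> h * inv\<^bsub>SL k\<^esub> b)"
  have "f \<in> E m"
    unfolding f_def using E_closed(1)[OF E_closed(1)[OF E_closed(5)[OF e(1)] eb(1)] E_closed(3)[OF E_closed(5)[OF h(2)] S(3)]] .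
  moreover have "A = f * b"
  proof -
    have "f * b = inv\<^bsub>SL k\<^esub> e * (e' * b) * inv\<^bsub>SL k\<^esub> h" unfolding f_def using S by (simp add: SL_assoc)
    also have "\<dots> = inv\<^bsub>SL k\<^esub> e * (e * A * h) * inv\<^bsub>SL k\<^esub> h" using eb(3) by (simp add: D_def)
    also have "\<dots> = (inv\<^bsub>SL k\<^esub> e * e) * A * (h * inv\<^bsub>SL k\<^esub> h)" using S AS by (simp add: SL_assoc del: SL_inv_l SL_inv_r)
    also have "\<dots> = A" using S AS by simp
    finally show ?thesis by simp
  qed
  ultimately show ?case using eb(2) by blast
qed

section \<open>Polynomial index of the normal closure\<close>

text \<open>The relations between elementary matrices become Steinberg relations modulo
  \<open>m\<close> in the quotient by \<open>E m\<close>. The additive copy of this quotient given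
  by \<open>cayley\<close> makes \<open>card_gen_le\<close> applicable.\<close>

lemma card_elem2_cosets:
  assumes "m > 0"
  shows "finite ((\<lambda>b. E (int m) #>\<^bsub>SL k\<^esub> b) ` elem 2)" "card ((\<lambda>b. E (int m) #>\<^bsub>SL k\<^esub> b) ` elem 2) \<le> m ^ 8"
proof -
  let ?E = "E (int m)"
  let ?c = "\<lambda>b. ?E #>\<^bsub>SL k\<^esub> b"
  interpret E: normal ?E "SL k" by (rule E_normal)
  interpret Q: group "SL k Mod ?E" by (rule E.factorgroup_is_group)
  obtain \<phi> :: "int mat set \<Rightarrow> int mat set sym" where \<phi>: "inj_on \<phi> (carrier (SL k Mod ?E))"
    "\<And>a b. a \<in> carrier (SL k Mod ?E) \<Longrightarrow> b \<in> carrier (SL k Mod ?E) \<Longrightarrow> \<phi> (a \<otimes>\<^bsub>SL k Mod ?E\<^esub> b) = \<phi> a + \<phi> b"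
    using Q.cayley by blast
  have cc: "?c b \<in> carrier (SL k Mod ?E)" if "b \<in> carrier (SL k)" for b
    using that by (auto simp: FactGroup_def RCOSETS_def)
  define \<psi> where "\<psi> b = \<phi> (?c b)" for b
  have hom: "\<psi> (a * b) = \<psi> a + \<psi> b" if "a \<in> carrier (SL k)" "b \<in> carrier (SL k)" for a b
    using \<phi>(2)[OF cc cc] E.rcos_sum that by (simp add: \<psi>_def FactGroup_def)
  have psi1: "\<psi> (1\<^sub>m k) = 0"
  proof -
    have "\<psi> (1\<^sub>m k) + \<psi> (1\<^sub>m k) = \<psi> (1\<^sub>m k) + 0" using hom[of "1\<^sub>m k" "1\<^sub>m k"] by simp
    then show ?thesis by (rule add_left_imp_eq)
  qed
  have psiE: "\<psi> a = 0" if "a \<in> ?E" for a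
  proof -
    have "?c a = ?c (1\<^sub>m k)"
      using rcos_eq_iff[OF E.subgroup_axioms, of a "1\<^sub>m k"] that E_closed(2)[OF that] inv_one by simp
    then show ?thesis using psi1 by (simp add: \<psi>_def)
  qed
  define y where "y i j a = \<psi> (X i j a)" for i j a
  have "steinberg y (int m)"
  proof
    show "0 < int m" using assms by simp
    fix i j l a b assume t: "tri i j l"
    then have d: "i < k" "j < k" "l < k" "i \<noteq> j" "j \<noteq> l" "i \<noteq> l" using k_ge_3 by (auto simp: tri_def)
    show "y i j (a + b) = y i j a + y i j b"
      unfolding y_def using d by (simp add: X_add[symmetric] hom)
    have "X i j a * X i l b = X i l b * X i j a" using X_row[of i j l] d by simp
    then show "y i j a + y i l b = y i l b + y i j a"
      unfolding y_def using d hom[of "X i j a" "X i l b"] hom[of "X i l b" "X i j a"] by simp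
    have "X i j a * X l j b = X l j b * X i j a" using X_col[of i j l] d by simp
    then show "y i j a + y l j b = y l j b + y i j a"
      unfolding y_def using d hom[of "X i j a" "X l j b"] hom[of "X l j b" "X i j a"] by simp
    have "\<psi> (X i j a * X j l b) = \<psi> (X i l (a * b) * X j l b * X i j a)" using X_comm[of i j l] d by simp
    then show "y i j a + y j l b = y i l (a * b) + y j l b + y i j a"
      unfolding y_def using d by (simp add: hom)
    show "y i j (int m) = 0"
      unfolding y_def using X_E[of i j "int m" 1] d by (intro psiE) simp
  qed
  from card_gen_le[OF this] have fin: "finite (gen y)" "card (gen y) \<le> m ^ 8" by auto
  have "\<psi> b \<in> gen y" if "b \<in> elem 2" for b
    using that
  proof induction
    case elem_1
    then show ?case using psi1 gen_0 by simp
  next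
    case (elem_X g i j a)
    then have "i = 0 \<and> j = 1 \<or> i = 1 \<and> j = 0" by auto
    moreover have "\<psi> (X i j a * g) = y i j a + \<psi> g" using hom elem_X elem_SL by (simp add: y_def)
    ultimately show ?case using elem_X.IH gen_U gen_V by auto
  qed
  then have sub: "\<phi> ` (?c ` elem 2) \<subseteq> gen y" by (auto simp: \<psi>_def)
  have inj: "inj_on \<phi> (?c ` elem 2)"
    using \<phi>(1) by (rule inj_on_subset) (use cc elem_SL in auto)
  show "finite (?c ` elem 2)" using inj_on_finite[OF inj sub fin(1)] .
  show "card (?c ` elem 2) \<le> m ^ 8" using card_inj_on_le[OF inj sub fin(1)] fin(2) by simp
qed

text \<open>A coset is determined by the residues of the entries, which contribute the exponent k *
  k, and by a class of the congruence subgroup modulo \<open>E m\<close>, which meets the corner and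
  contributes the exponent 8.\<close>

theorem index_E:
  assumes "m > 0" shows "subgroup_index (SL k) (E (int m)) \<le> of_nat (m ^ (k * k + 8))"
proof -
  let ?E = "E (int m)"
  let ?c = "\<lambda>b. ?E #>\<^bsub>SL k\<^esub> b"
  interpret E: normal ?E "SL k" by (rule E_normal)
  let ?I = "{..<k} \<times> {..<k}"
  define res where "res A = (\<lambda>ij\<in>?I. A $$ ij mod int m)" for A :: "int mat"
  \<comment> \<open>One fixed matrix for each residue pattern that occurs; \<open>A\<close> times
    the inverse of its representative is then congruent to the identity.\<close>
  define rep where "rep r = (SOME A. A \<in> carrier (SL k) \<and> res A = r)" for r
  have rep: "rep (res A) \<in> carrier (SL k)" "res (rep (res A)) = res A" if "A \<in> carrier (SL k)" for A
    using someI[of "\<lambda>B. B \<in> carrier (SL k) \<and> res B = res A" A] that unfolding rep_def by auto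
  have res_meq: "mat_cong (int m) A B" if "res A = res B" for A B
    unfolding mat_cong_def
  proof (intro allI impI)
    fix i j assume "i < k" "j < k"
    then show "[A $$ (i, j) = B $$ (i, j)] (mod int m)"
      using fun_cong[OF that, of "(i, j)"] by (simp add: res_def unique_euclidean_semiring_class.cong_def)
  qed
  define f where "f A = (res A, ?c (A * inv\<^bsub>SL k\<^esub> rep (res A)))" for A
  let ?R = "?I \<rightarrow>\<^sub>E {0..<int m}"
  let ?F = "?R \<times> (?c ` elem 2)"
  have k2: "2 \<le> k" "k \<le> k" using k_ge_3 by auto
  have fin: "finite ?F" using card_elem2_cosets[OF assms] by (simp add: finite_PiE)
  have sub: "f ` carrier (SL k) \<subseteq> ?F"
  proof
    fix z assume "z \<in> f ` carrier (SL k)"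
    then obtain A where A: "A \<in> carrier (SL k)" "z = f A" by blast
    have "res A \<in> ?R" using assms by (auto simp: res_def)
    moreover have "?c (A * inv\<^bsub>SL k\<^esub> rep (res A)) \<in> ?c ` elem 2"
    proof -
      have "A * inv\<^bsub>SL k\<^esub> rep (res A) \<in> Gam (int m)"
        using Gam_iff_mat_cong[OF A(1) rep(1)[OF A(1)]] res_meq[of A "rep (res A)"] rep(2)[OF A(1)] by simp
      moreover have "block k (A * inv\<^bsub>SL k\<^esub> rep (res A))" by (auto simp: block_def)
      ultimately obtain e b where eb: "e \<in> ?E" "b \<in> elem 2" "A * inv\<^bsub>SL k\<^esub> rep (res A) = e * b"
        using Gam_decompose[of k "A * inv\<^bsub>SL k\<^esub> rep (res A)" "int m"] k2 by blast
      have "?c (e * b) = ?c b"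
        using rcos_eq_iff[OF E.subgroup_axioms, of "e * b" b] eb elem_SL E_closed(2) by (simp add: SL_assoc)
      then show ?thesis using eb by simp
    qed
    ultimately show "z \<in> ?F" using A by (simp add: f_def)
  qed
  have "subgroup_index (SL k) ?E \<le> of_nat (card ?F)"
  proof (rule subgroup_index_le_card(2)[OF E.subgroup_axioms fin sub])
    fix A B assume AB: "A \<in> carrier (SL k)" "B \<in> carrier (SL k)" "f A = f B"
    let ?r = "rep (res A)"
    have r: "?r \<in> carrier (SL k)" using rep AB by blast
    have e1: "res A = res B" and e2: "?c (A * inv\<^bsub>SL k\<^esub> ?r) = ?c (B * inv\<^bsub>SL k\<^esub> rep (res B))"
      using AB(3) unfolding f_def prod.inject by blast+
    then have "?c (A * inv\<^bsub>SL k\<^esub> ?r) = ?c (B * inv\<^bsub>SL k\<^esub> ?r)" by simp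
    then have *: "(A * inv\<^bsub>SL k\<^esub> ?r) * inv\<^bsub>SL k\<^esub> (B * inv\<^bsub>SL k\<^esub> ?r) \<in> ?E"
      using rcos_eq_iff[OF E.subgroup_axioms, of "A * inv\<^bsub>SL k\<^esub> ?r" "B * inv\<^bsub>SL k\<^esub> ?r"] AB r by simp
    have "inv\<^bsub>SL k\<^esub> (B * inv\<^bsub>SL k\<^esub> ?r) = ?r * inv\<^bsub>SL k\<^esub> B"
      using inv_mult_group[of B "inv\<^bsub>SL k\<^esub> ?r"] AB r by simp
    then have "(A * inv\<^bsub>SL k\<^esub> ?r) * inv\<^bsub>SL k\<^esub> (B * inv\<^bsub>SL k\<^esub> ?r) = A * ((inv\<^bsub>SL k\<^esub> ?r * ?r) * inv\<^bsub>SL k\<^esub> B)"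
      using AB r by (simp add: SL_assoc del: SL_inv_l)
    also have "\<dots> = A * inv\<^bsub>SL k\<^esub> B" using AB r by simp
    finally show "A \<otimes>\<^bsub>SL k\<^esub> inv\<^bsub>SL k\<^esub> B \<in> ?E" using * by (simp only: SL_mult)
  qed
  moreover have "card ?F \<le> m ^ (k * k + 8)"
  proof -
    have "card ?F = m ^ (k * k) * card (?c ` elem 2)"
      by (simp add: card_cartesian_product card_PiE)
    also have "\<dots> \<le> m ^ (k * k) * m ^ 8" using card_elem2_cosets(2)[OF assms] by simp
    finally show ?thesis by (simp add: power_add)
  qed
  ultimately show ?thesis using of_nat_mono order_trans by meson
qed

section \<open>Primes dividing the level of a subgroup\<close>

text \<open>Repeated commutators turn \<open>A\<close> into elementary matrices of \<open>N\<close>,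
  to whose entries the hypothesis on the level applies. A preliminary conjugation leaves at most two
  nonzero entries \<open>b\<close> and \<open>a\<close> in the last column, so that the commutator
  with \<open>X l 0 1\<close> differs from the identity in two rows only.\<close>

lemma normal_last_column:
  assumes N: "N \<lhd> SL k" and lev: "\<And>a. X 0 1 a \<in> N \<Longrightarrow> m dvd a" and A: "A \<in> N" and i: "i < k - 1"
  shows "m dvd A $$ (i, k - 1)"
proof -
  interpret N: normal N "SL k" by fact
  define l where "l = k - 1"
  have l: "l < k" "2 \<le> l" "0 < k" "1 < k" "l \<noteq> 0" "l \<noteq> 1" "1 \<le> l" "l \<le> k" using k_ge_3 by (auto simp: l_def)
  have AS: "A \<in> carrier (SL k)" using A N.mem_carrier by blast
  obtain g where g: "g \<in> elem l" "\<And>i. 0 < i \<Longrightarrow> i < l \<Longrightarrow> (g * A) $$ (i, l) = 0"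
    using column_reduce[OF l(7,8) SL_mat[OF AS] l(1)] by blast
  have gS: "g \<in> carrier (SL k)" using elem_SL[OF g(1)] .
  have gi: "inv\<^bsub>SL k\<^esub> g \<in> elem l" using elem_inv[OF l(8) g(1)] .
  define B where "B = g * A * inv\<^bsub>SL k\<^esub> g"
  have BN: "B \<in> N" unfolding B_def using N.inv_op_closed2[OF gS A] by simp
  have BS: "B \<in> carrier (SL k)" using BN N.mem_carrier by blast
  note Bm = SL_mat[OF BS]
  define R where "R = inv\<^bsub>SL k\<^esub> B"
  have RS: "R \<in> carrier (SL k)" and RN: "R \<in> N" unfolding R_def using BS BN by auto
  note Rm = SL_mat[OF RS]
  have BR: "B * R = 1\<^sub>m k" unfolding R_def using BS by simp
  have gAS: "g * A \<in> carrier (SL k)" using gS AS by simp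
  have Bcol: "B $$ (r, l) = (g * A) $$ (r, l)" if "r < k" for r
    unfolding B_def using mult_block_col[OF SL_mat[OF gAS] SL_mat[OF elem_SL[OF gi]] elem_block[OF gi l(8)] le_refl that l(1)] .
  have Bz: "B $$ (r, l) = 0" if "r < k" "r \<noteq> 0" "r \<noteq> l" for r
    unfolding Bcol[OF that(1)] using that g(2)[of r] by (simp add: l_def)
  define b where "b = B $$ (0, l)"
  define a where "a = B $$ (l, l)"
  \<comment> \<open>\<open>X l 0 1\<close> is the identity plus a matrix unit, so \<open>T\<close>
    is the identity plus the last column of \<open>B\<close> times row 0 of its inverse.
    \<open>C\<close> is the commutator of \<open>B\<close> and \<open>X l 0 1\<close>.\<close>
  define T where "T = B * (X l 0 1 * R)"
  define C where "C = T * X l 0 (- 1)"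
  have XR: "X l 0 1 * R \<in> carrier_mat k k" by (rule mult_carrier_mat[OF X_mat Rm])
  have Tm: "T \<in> carrier_mat k k" unfolding T_def by (rule mult_carrier_mat[OF Bm XR])
  have T: "T $$ (r, c) = (if r = c then 1 else 0) + B $$ (r, l) * R $$ (0, c)" if rc: "r < k" "c < k" for r c
  proof -
    have "T $$ (r, c) = (\<Sum>t<k. B $$ (r, t) * (X l 0 1 * R) $$ (t, c))"
      unfolding T_def by (rule mult_entry[OF Bm XR rc])
    also have "\<dots> = (\<Sum>t<k. B $$ (r, t) * R $$ (t, c) + (if t = l then B $$ (r, l) * R $$ (0, c) else 0))"
      using X_mult_index[OF Rm l(3)] rc by (intro sum.cong refl) (auto simp: algebra_simps simp del: index_mult_mat(1))
    also have "\<dots> = (B * R) $$ (r, c) + B $$ (r, l) * R $$ (0, c)"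
      unfolding sum.distrib mult_entry[OF Bm Rm rc] using l by simp
    finally show ?thesis unfolding BR using rc by simp
  qed
  have C: "C $$ (r, c) = T $$ (r, c) - (if c = 0 then T $$ (r, l) else 0)" if "r < k" "c < k" for r c
    unfolding C_def using mult_X_index[OF Tm l(1) l(5) that, of "- 1"] by simp
  have CN: "C \<in> N"
  proof -
    have "X l 0 1 * R * inv\<^bsub>SL k\<^esub> X l 0 1 \<in> N" using N.inv_op_closed2[of "X l 0 1" R] RN l by simp
    then have "B * (X l 0 1 * R * inv\<^bsub>SL k\<^esub> X l 0 1) \<in> N" using N.m_closed[OF BN] by simp
    then show ?thesis unfolding C_def T_def using l BS RS by (simp add: SL_assoc X_inv)
  qed
  have CS: "C \<in> carrier (SL k)" using CN N.mem_carrier by blast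
  note Cm = SL_mat[OF CS]
  have Crow: "C $$ (r, c) = (if r = c then 1 else 0)" if "r < k" "c < k" "r \<noteq> 0" "r \<noteq> l" for r c
    using that C T Bz l by auto
  have key: "m dvd C $$ (0, i) - (if i = 0 then 1 else 0) \<and> m dvd C $$ (l, i) - (if i = l then 1 else 0)"
    if i: "i = 0 \<or> i = l" for i
  proof -
    define \<alpha> where "\<alpha> = C $$ (0, i) - (if i = 0 then 1 else 0)"
    define \<beta> where "\<beta> = C $$ (l, i) - (if i = l then 1 else 0)"
    have ik: "i < k" "i \<noteq> 1" using i l by auto
    \<comment> \<open>The commutator of \<open>C\<close> and \<open>X i 1 1\<close>: it carries
      column \<open>i\<close> of \<open>C\<close> minus the identity to column 1.\<close>
    define D where "D = X 0 1 \<alpha> * X l 1 \<beta>"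
    have DS: "D \<in> carrier (SL k)" unfolding D_def using l by simp
    define C1 where "C1 = X i 1 1 * C"
    define C2 where "C2 = X l 1 \<beta> * C1"
    have m1: "C1 \<in> carrier_mat k k" unfolding C1_def by (rule mult_carrier_mat[OF X_mat Cm])
    have m2: "C2 \<in> carrier_mat k k" unfolding C2_def by (rule mult_carrier_mat[OF X_mat m1])
    have "C * X i 1 1 = X 0 1 \<alpha> * C2"
    proof (rule eq_matI)
      fix r c assume "r < dim_row (X 0 1 \<alpha> * C2)" "c < dim_col (X 0 1 \<alpha> * C2)"
      then have rc: "r < k" "c < k" using m2 by auto
      have row1: "C $$ (Suc 0, c) = (if c = 1 then 1 else 0)" using Crow[of 1 c] rc l by auto
      have "(X 0 1 \<alpha> * C2) $$ (r, c) = C $$ (r, c) + (if c = 1 then (if r = i then 1 else 0) + (if r = l then \<beta> else 0) + (if r = 0 then \<alpha> else 0) else 0)"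
        unfolding C2_def C1_def
        using rc l ik X_mult_index[OF Cm l(4) rc, of i 1] X_mult_index[OF m1[unfolded C1_def] l(4) rc, of l \<beta>]
          X_mult_index[OF m2[unfolded C1_def C2_def] l(4) rc, of 0 \<alpha>]
          X_mult_index[OF Cm l(4) l(4) rc(2), of i 1] X_mult_index[OF m1[unfolded C1_def] l(4) l(4) rc(2), of l \<beta>]
          row1
        by (auto simp del: index_mult_mat(1))
      moreover have "(C * X i 1 1) $$ (r, c) = C $$ (r, c) + (if c = 1 then C $$ (r, i) else 0)"
        using mult_X_index[OF Cm ik rc, of 1] by simp
      moreover have "C $$ (r, i) = (if r = i then 1 else 0) + (if r = l then \<beta> else 0) + (if r = 0 then \<alpha> else 0)"
        using Crow[OF rc(1) ik(1)] l by (auto simp: \<alpha>_def \<beta>_def)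
      ultimately show "(C * X i 1 1) $$ (r, c) = (X 0 1 \<alpha> * C2) $$ (r, c)" by simp
    qed (use Cm m2 in auto)
    also have "X 0 1 \<alpha> * C2 = D * X i 1 1 * C"
      unfolding C2_def C1_def D_def using CS l ik by (simp add: SL_assoc)
    finally have eq: "C * X i 1 1 = D * X i 1 1 * C" .
    have DN: "D \<in> N"
    proof (rule normal_commutator[OF N CN])
      show "C \<otimes>\<^bsub>SL k\<^esub> X i 1 1 = D \<otimes>\<^bsub>SL k\<^esub> X i 1 1 \<otimes>\<^bsub>SL k\<^esub> C \<or> X i 1 1 \<otimes>\<^bsub>SL k\<^esub> C = D \<otimes>\<^bsub>SL k\<^esub> C \<otimes>\<^bsub>SL k\<^esub> X i 1 1"
        unfolding SL_mult using eq by blast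
    qed (use DS ik in auto)
    \<comment> \<open>A further commutator, with \<open>X l 0 1\<close>, isolates \<alpha> in a
      single elementary matrix; dividing it out of \<open>D\<close> then isolates \<beta>.\<close>
    have "X l 0 1 * D = (X l 0 1 * X 0 1 \<alpha>) * X l 1 \<beta>" unfolding D_def using l by (simp add: SL_assoc)
    also have "X l 0 1 * X 0 1 \<alpha> = X l 1 \<alpha> * X 0 1 \<alpha> * X l 0 1" using X_comm[of l 0 1 1 \<alpha>] l by simp
    also have "\<dots> * X l 1 \<beta> = X l 1 \<alpha> * (X 0 1 \<alpha> * (X l 0 1 * X l 1 \<beta>))" using l by (simp add: SL_assoc)
    also have "X l 0 1 * X l 1 \<beta> = X l 1 \<beta> * X l 0 1" using X_row[of l 0 1] l by simp
    also have "X l 1 \<alpha> * (X 0 1 \<alpha> * (X l 1 \<beta> * X l 0 1)) = X l 1 \<alpha> * D * X l 0 1"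
      unfolding D_def using l by (simp add: SL_assoc)
    finally have eq2: "X l 0 1 * D = X l 1 \<alpha> * D * X l 0 1" .
    have la: "X l 1 \<alpha> \<in> N"
    proof (rule normal_commutator[OF N DN])
      show "D \<otimes>\<^bsub>SL k\<^esub> X l 0 1 = X l 1 \<alpha> \<otimes>\<^bsub>SL k\<^esub> X l 0 1 \<otimes>\<^bsub>SL k\<^esub> D \<or> X l 0 1 \<otimes>\<^bsub>SL k\<^esub> D = X l 1 \<alpha> \<otimes>\<^bsub>SL k\<^esub> D \<otimes>\<^bsub>SL k\<^esub> X l 0 1"
        unfolding SL_mult using eq2 by blast
    qed (use l in auto)
    then have 0: "X 0 1 \<alpha> \<in> N" using normal_X_transfer[OF N la, of 0 1] l by simp
    have "inv\<^bsub>SL k\<^esub> X 0 1 \<alpha> * D \<in> N" using N.m_closed[OF N.m_inv_closed[OF 0] DN] by simp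
    moreover have "inv\<^bsub>SL k\<^esub> X 0 1 \<alpha> * D = X l 1 \<beta>" unfolding D_def using l by (simp flip: SL_assoc)
    ultimately have "X l 1 \<beta> \<in> N" by simp
    then have "X 0 1 \<beta> \<in> N" using normal_X_transfer[OF N, of l 1 \<beta> 0 1] l by simp
    then show ?thesis using lev 0 unfolding \<alpha>_def[symmetric] \<beta>_def[symmetric] by blast
  qed
  have "gcd b a dvd B $$ (r, l)" if "r < k" for r
    using Bz[OF that] by (cases "r = 0"; cases "r = l") (auto simp: a_def b_def)
  then have "gcd b a dvd 1" using dvd_det_column[OF Bm l(1)] BS by (metis (no_types, lifting) SL_carrier)
  then have cop: "coprime b a" by (simp add: coprime_iff_gcd_eq_1)
  \<comment> \<open>The columns 0 and \<open>l\<close> of \<open>C\<close> give congruences for row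
    0 of the inverse. As \<open>a\<close> and \<open>b\<close> are coprime, \<open>m\<close> divides
    \<open>R $$ (0, l)\<close>, and eliminating \<open>R $$ (0, 0)\<close> from the other two
    congruences leaves \<open>b\<close>.\<close>
  have "m dvd b * R $$ (0, l)" "m dvd a * R $$ (0, l)"
    using key[of l] C[of _ l] T[of _ l] l by (simp_all add: a_def b_def)
  then have R0l: "m dvd R $$ (0, l)"
  proof -
    obtain u v where uv: "u * b + v * a = 1" using cop bezout_int[of b a] by (metis coprime_imp_gcd_eq_1)
    have "R $$ (0, l) = u * (b * R $$ (0, l)) + v * (a * R $$ (0, l))"
      using uv by (metis distrib_right mult.assoc mult_1)
    then show ?thesis using \<open>m dvd b * R $$ (0, l)\<close> \<open>m dvd a * R $$ (0, l)\<close> by (metis dvd_add dvd_mult)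
  qed
  have 1: "m dvd b * R $$ (0, 0) - b * R $$ (0, l)" "m dvd a * R $$ (0, 0) - 1 - a * R $$ (0, l)"
    using key[of 0] C[of _ 0] T[of _ 0] T[of _ l] l by (simp_all add: a_def b_def algebra_simps)
  have "m dvd b"
  proof -
    have "b = a * (b * R $$ (0, 0) - b * R $$ (0, l)) + a * b * R $$ (0, l) - b * (a * R $$ (0, 0) - 1 - a * R $$ (0, l)) - a * b * R $$ (0, l)"
      by (simp add: algebra_simps)
    then show ?thesis using 1 R0l by (metis dvd_add dvd_diff dvd_mult)
  qed
  then have Bd: "m dvd B $$ (r, l)" if "r < k" "r \<noteq> l" for r
    using Bz[OF that(1)] that by (cases "r = 0") (auto simp: b_def)
  have A': "A = inv\<^bsub>SL k\<^esub> g * (g * A)" using gS AS by (simp flip: SL_assoc)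
  have "A $$ (i, l) = (\<Sum>t<k. (inv\<^bsub>SL k\<^esub> g) $$ (i, t) * (g * A) $$ (t, l))"
    using i by (subst A', intro mult_entry SL_mat[OF elem_SL[OF gi]] SL_mat[OF gAS] l(1)) auto
  also have "m dvd \<dots>"
  proof (rule dvd_sum)
    fix t assume "t \<in> {..<k}"
    then show "m dvd (inv\<^bsub>SL k\<^esub> g) $$ (i, t) * (g * A) $$ (t, l)"
      using Bd[of t] Bcol[of t] elem_block[OF gi l(8)] i l(1) unfolding block_def
      by (cases "t = l") (auto simp: l_def)
  qed
  finally show ?thesis unfolding l_def .
qed

text \<open>\<open>normal_last_column\<close> holds for every conjugate of \<open>A\<close>.
  Conjugation by \<open>X i l 1\<close> adds column \<open>i\<close> to the last column, which
  yields the off-diagonal entries outside the last row and compares diagonal entries.\<close>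

lemma normal_scalar:
  assumes N: "N \<lhd> SL k" and lev: "\<And>a. X 0 1 a \<in> N \<Longrightarrow> m dvd a" and A: "A \<in> N"
  shows "mat_cong m A (A $$ (k - 1, k - 1) \<cdot>\<^sub>m 1\<^sub>m k)"
proof -
  interpret N: normal N "SL k" by fact
  define l where "l = k - 1"
  have l: "l < k" using k_ge_3 by (auto simp: l_def)
  have AS: "A \<in> carrier (SL k)" using A N.mem_carrier by blast
  note Am = SL_mat[OF AS]
  have last: "m dvd B $$ (r, l)" if "B \<in> N" "r < k" "r \<noteq> l" for B r
    using normal_last_column[OF N lev that(1), of r] that by (simp add: l_def)
  have other: "(r \<noteq> i \<longrightarrow> m dvd A $$ (r, i)) \<and> m dvd A $$ (i, i) - A $$ (l, l)" if i: "i < k" "i \<noteq> l" and r: "r < k" for i r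
  proof -
    have il: "l \<noteq> i" using i by simp
    define A1 where "A1 = A * X i l 1"
    define A2 where "A2 = X i l (- 1) * A1"
    have m1: "A1 \<in> carrier_mat k k" unfolding A1_def by (rule mult_carrier_mat[OF Am X_mat])
    have A2N: "A2 \<in> N"
      using N.inv_op_closed1[of "X i l 1" A] A i l unfolding A2_def A1_def by (simp add: X_inv SL_assoc AS)
    have e1: "A1 $$ (r, l) = A $$ (r, l) + A $$ (r, i)" if "r < k" for r
      unfolding A1_def using mult_X_index[OF Am i that l, of 1] by simp
    have e2: "A2 $$ (r, l) = A1 $$ (r, l) - (if r = i then A1 $$ (l, l) else 0)" if "r < k" for r
      unfolding A2_def using X_mult_index[OF m1 l that l, of i "- 1"] by simp
    \<comment> \<open>Chosen so that the conjugate of \<open>A\<close> has -A(l, i) in position (i,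
      l). The last row needs this separate conjugation, as \<open>last\<close> says nothing about
      row \<open>l\<close>.\<close>
    define Y where "Y = X l i (- 1) * X i l 1"
    have YS: "Y \<in> carrier (SL k)" unfolding Y_def using i il by simp
    have Yi: "inv\<^bsub>SL k\<^esub> Y = X i l (- 1) * X l i 1"
      unfolding Y_def using inv_mult_group[of "X l i (- 1)" "X i l 1"] i il l by (simp add: X_inv)
    define B1 where "B1 = A * X l i (- 1)"
    define B2 where "B2 = B1 * X i l 1"
    define B3 where "B3 = X l i 1 * B2"
    define B4 where "B4 = X i l (- 1) * B3"
    have n1: "B1 \<in> carrier_mat k k" unfolding B1_def by (rule mult_carrier_mat[OF Am X_mat])
    have n2: "B2 \<in> carrier_mat k k" unfolding B2_def by (rule mult_carrier_mat[OF n1 X_mat])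
    have n3: "B3 \<in> carrier_mat k k" unfolding B3_def by (rule mult_carrier_mat[OF X_mat n2])
    have "B4 = inv\<^bsub>SL k\<^esub> Y * A * Y"
      unfolding Yi unfolding Y_def B4_def B3_def B2_def B1_def using AS i il by (simp add: SL_assoc)
    then have B4N: "B4 \<in> N" using N.inv_op_closed1[OF YS A] by simp
    have f1: "B1 $$ (r, c) = A $$ (r, c) - (if c = i then A $$ (r, l) else 0)" if "r < k" "c < k" for r c
      unfolding B1_def using mult_X_index[OF Am l il that, of "- 1"] by simp
    have f2: "B2 $$ (r, l) = A $$ (r, i)" if "r < k" for r
      unfolding B2_def using mult_X_index[OF n1 i that l, of 1] f1 that i l by simp
    have f3: "B3 $$ (r, l) = A $$ (r, i) + (if r = l then A $$ (i, i) else 0)" if "r < k" for r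
      unfolding B3_def using X_mult_index[OF n2 i(1) that l, of l 1] f2 that i by simp
    have f4: "B4 $$ (i, l) = - A $$ (l, i)"
      unfolding B4_def using X_mult_index[OF n3 l i(1) l, of i "- 1"] f3 i l by simp
    have li: "m dvd A $$ (l, i)" using last[OF B4N i] f4 by simp
    have "m dvd A $$ (i, l)" using last[OF A i] .
    moreover have "m dvd A $$ (i, l) + A $$ (i, i) - (A $$ (l, l) + A $$ (l, i))"
      using last[OF A2N i] e1 e2 i l by simp
    ultimately have "m dvd (A $$ (i, l) + A $$ (i, i) - (A $$ (l, l) + A $$ (l, i))) - A $$ (i, l) + A $$ (l, i)"
      using dvd_add[OF dvd_diff li] by blast
    then have dd: "m dvd A $$ (i, i) - A $$ (l, l)" by (simp add: algebra_simps)
    have "m dvd A $$ (r, i)" if ri: "r \<noteq> i"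
    proof (cases "r = l")
      case False
      have "m dvd A $$ (r, l) + A $$ (r, i)" using last[OF A2N r False] e1 e2 r ri by simp
      then show ?thesis using last[OF A r False] by (simp add: dvd_add_right_iff)
    qed (use li in simp)
    then show ?thesis using dd by blast
  qed
  show ?thesis
    unfolding mat_cong_def l_def[symmetric]
  proof (intro allI impI)
    fix r c assume rc: "r < k" "c < k"
    show "[A $$ (r, c) = (A $$ (l, l) \<cdot>\<^sub>m 1\<^sub>m k) $$ (r, c)] (mod m)"
      using other[of c r] last[OF A, of r] rc by (cases "c = l"; cases "r = c") (auto simp: cong_0_iff cong_iff_dvd_diff)
  qed
qed

section \<open>Counting residues modulo a prime\<close>

text \<open>For \<open>j < k\<close> this is the product of the commuting matrices
  \<open>X r j (v r)\<close> with r different from j.\<close>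

definition colmat :: "nat \<Rightarrow> (nat \<Rightarrow> int) \<Rightarrow> int mat" where
  "colmat j v = mat k k (\<lambda>(r, c). if r = c then 1 else if c = j then v r else 0)"

lemma colmat_mat [simp]: "colmat j v \<in> carrier_mat k k" by (simp add: colmat_def)

lemma colmat_index: "r < k \<Longrightarrow> c < k \<Longrightarrow> colmat j v $$ (r, c) = (if r = c then 1 else if c = j then v r else 0)"
  by (simp add: colmat_def)

lemma colmat_subgroup:
  assumes H: "subgroup H (SL k)" and j: "j < k" and X: "\<And>r. r < k \<Longrightarrow> r \<noteq> j \<Longrightarrow> X r j (v r) \<in> H"
  shows "colmat j v \<in> H"
proof -
  have "colmat j (\<lambda>r. if r < n then v r else 0) \<in> H" if "n \<le> k" for n
    using that
  proof (induction n)
    case 0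
    have "colmat j (\<lambda>r. if r < 0 then v r else 0) = 1\<^sub>m k" by (rule eq_matI) (auto simp: colmat_def)
    then show ?case using subgroup.one_closed[OF H] by simp
  next
    case (Suc n)
    show ?case
    proof (cases "n = j")
      case True
      then have "colmat j (\<lambda>r. if r < Suc n then v r else 0) = colmat j (\<lambda>r. if r < n then v r else 0)"
        by (intro eq_matI) (auto simp: colmat_def)
      then show ?thesis using Suc by simp
    next
      case False
      have "colmat j (\<lambda>r. if r < Suc n then v r else 0) = X n j (v n) * colmat j (\<lambda>r. if r < n then v r else 0)"
      proof (rule eq_matI, goal_cases)
        case (1 r c)
        then have rc: "r < k" "c < k" by (auto simp: colmat_def)
        show ?case
          using X_mult_index[OF colmat_mat j rc, of n "v n" j "\<lambda>r. if r < n then v r else 0"] rc j False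
          by (auto simp: colmat_index simp del: index_mult_mat(1))
      qed (auto simp: colmat_def)
      then show ?thesis using Suc X[of n] False subgroup.m_closed[OF H, of "X n j (v n)"] by simp
    qed
  qed
  from this[of k] have "colmat j (\<lambda>r. if r < k then v r else 0) \<in> H" by simp
  moreover have "colmat j (\<lambda>r. if r < k then v r else 0) = colmat j v" by (rule eq_matI) (auto simp: colmat_def)
  ultimately show ?thesis by simp
qed

lemma colmat_SL [simp]: "j < k \<Longrightarrow> colmat j v \<in> carrier (SL k)"
  using colmat_subgroup[OF subgroup_self] by simp

lemma colmat_mult_index:
  assumes "B \<in> carrier_mat k k" "r < k" "c < k" "j < k"
  shows "(colmat j v * B) $$ (r, c) = B $$ (r, c) + (if r = j then 0 else v r * B $$ (j, c))"
proof -
  have "(colmat j v * B) $$ (r, c) = (\<Sum>t<k. (if t = r then B $$ (r, c) else 0) + (if t = j then (if r = j then 0 else v r * B $$ (j, c)) else 0))"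
    unfolding mult_entry[OF colmat_mat assms(1-3)] using assms by (intro sum.cong) (auto simp: colmat_index)
  then show ?thesis using assms by (simp add: sum.distrib)
qed

lemma det_mat_cong:
  assumes "A \<in> carrier_mat k k" "B \<in> carrier_mat k k" "mat_cong m A B" shows "[det A = det B] (mod m)"
  using assms(3) unfolding mat_cong_def by (intro det_cong[OF assms(1,2)]) blast

text \<open>Before the last column a unit \<open>v j\<close> can be compensated with the help of row
  j + 1. In the last column there is no further row, so the diagonal residue has to be 1.\<close>

lemma column_exists:
  assumes p: "prime (p::nat)" and j: "j < k" and v: "v j \<in> (if j = k - 1 then {1} else {1..<int p})"
  shows "\<exists>g\<in>carrier (SL k). (\<forall>i<j. \<forall>r<k. g $$ (r, i) = (if r = i then 1 else 0)) \<and> (\<forall>r<k. [g $$ (r, j) = v r] (mod int p))"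
proof (cases "j = k - 1")
  case True
  then show ?thesis using j v by (intro bexI[of _ "colmat j v"]) (auto simp: colmat_index)
next
  case False
  then have j1: "Suc j < k" "j \<noteq> Suc j" "Suc j \<noteq> j" using j by auto
  have "\<not> int p dvd v j" using v False by (auto dest: zdvd_imp_le)
  then have "coprime (v j) (int p)"
    using p by (metis coprime_commute prime_imp_coprime prime_nat_int_transfer)
  then obtain s where s: "[v j * s = 1] (mod int p)" using cong_solve_coprime_int by blast
  \<comment> \<open>Column \<open>j\<close> of \<open>B\<close> has \<open>v j\<close> in row j and
    1 in row j + 1. Adding \<open>c r\<close> times row \<open>j\<close> corrects the other rows
    modulo p, as \<open>s\<close> inverts \<open>v j\<close>.\<close>
  define c where "c r = (v r - (if r = Suc j then 1 else 0)) * s" for r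
  define B where "B = X j (Suc j) (v j - 1) * X (Suc j) j 1"
  have BS: "B \<in> carrier (SL k)" unfolding B_def using j1 by simp
  note Bm = SL_mat[OF BS]
  have Be: "B $$ (r, i) = X (Suc j) j 1 $$ (r, i) + (if r = j then (v j - 1) * X (Suc j) j 1 $$ (Suc j, i) else 0)"
    if "r < k" "i < k" for r i
    unfolding B_def using X_mult_index[OF X_mat j1(1) that] by simp
  define g where "g = colmat j c * B"
  have ge: "g $$ (r, i) = B $$ (r, i) + (if r = j then 0 else c r * B $$ (j, i))" if "r < k" "i < k" for r i
    unfolding g_def using colmat_mult_index[OF Bm that j] .
  have "g \<in> carrier (SL k)" unfolding g_def using BS j by simp
  moreover have "g $$ (r, i) = (if r = i then 1 else 0)" if "i < j" "r < k" for i r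
    using that j j1 by (simp add: ge Be X_index)
  moreover have "[g $$ (r, j) = v r] (mod int p)" if r: "r < k" for r
  proof (cases "r = j")
    case True
    then show ?thesis using j j1 by (simp add: ge Be X_index)
  next
    case False
    have "g $$ (r, j) = (if r = Suc j then 1 else 0) + c r * v j"
      using r False j j1 by (simp add: ge Be X_index)
    also have "c r * v j = (v r - (if r = Suc j then 1 else 0)) * (v j * s)" by (simp add: c_def)
    also have "[(if r = Suc j then 1 else 0) + (v r - (if r = Suc j then 1 else 0)) * (v j * s)
        = (if r = Suc j then 1 else 0) + (v r - (if r = Suc j then 1 else 0)) * 1] (mod int p)"
      by (intro cong_add cong_mult cong_refl s)
    finally show ?thesis by simp
  qed
  ultimately show ?thesis by blast
qed

lemma image_pairE:
  assumes "z \<in> (\<lambda>(v, s). f v s) ` (A \<times> B)" obtains v s where "v \<in> A" "s \<in> B" "z = f v s"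
  using assms by auto

text \<open>An explicit family of matrices with distinct residues, built from the last column to the
  first with unit pivots. In \<open>g v * s\<close> the factor \<open>s\<close> agrees with the
  identity up to column \<open>j\<close>, so column \<open>j\<close> reveals \<open>v\<close>, and
  cancelling \<open>g v\<close> then reveals \<open>s\<close>. For \<open>n = k - 1\<close> the
  family has the full order of magnitude p^(k*k-1).\<close>

lemma many_residues:
  assumes p: "prime (p::nat)" and "n < k"
  shows "\<exists>S\<subseteq>carrier (SL k). finite S \<and> card S = p ^ (k - 1) * ((p - 1) * p ^ (k - 1)) ^ n \<and>
     (\<forall>s\<in>S. \<forall>i<k - 1 - n. \<forall>r<k. s $$ (r, i) = (if r = i then 1 else 0)) \<and>
     (\<forall>s\<in>S. \<forall>s'\<in>S. mat_cong (int p) s s' \<longrightarrow> s = s')"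
proof -
  have step: "\<exists>S\<subseteq>carrier (SL k). finite S \<and> card S = (if j = k - 1 then 1 else p - 1) * p ^ (k - 1) * card S' \<and>
     (\<forall>s\<in>S. \<forall>i<j. \<forall>r<k. s $$ (r, i) = (if r = i then 1 else 0)) \<and>
     (\<forall>s\<in>S. \<forall>s'\<in>S. mat_cong (int p) s s' \<longrightarrow> s = s')"
    if j: "j < k" and S': "S' \<subseteq> carrier (SL k)" "finite S'"
      "\<And>s i r. s \<in> S' \<Longrightarrow> i < Suc j \<Longrightarrow> r < k \<Longrightarrow> s $$ (r, i) = (if r = i then 1 else 0)"
      "\<And>s s'. s \<in> S' \<Longrightarrow> s' \<in> S' \<Longrightarrow> mat_cong (int p) s s' \<Longrightarrow> s = s'" for j S'
  proof -
    let ?J = "if j = k - 1 then {1} else {1..<int p}"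
    let ?V = "\<Pi>\<^sub>E r\<in>{..<k}. if r = j then ?J else {0..<int p}"
    have V1: "v r \<in> {0..<int p}" if "v \<in> ?V" "r < k" for v r
    proof -
      have "v r \<in> (if r = j then ?J else {0..<int p})" using that by (auto simp: PiE_iff)
      then show ?thesis using prime_gt_1_nat[OF p] by (auto split: if_splits)
    qed
    have "\<exists>g. g \<in> carrier (SL k) \<and> (\<forall>i<j. \<forall>r<k. g $$ (r, i) = (if r = i then 1 else 0)) \<and> (\<forall>r<k. [g $$ (r, j) = v r] (mod int p))"
      if "v \<in> ?V" for v
    proof -
      have "v j \<in> ?J" using PiE_mem[OF that, of j] j by simp
      then show ?thesis using column_exists[OF p j, of v] by blast
    qed
    then have "\<forall>v\<in>?V. \<exists>g. g \<in> carrier (SL k) \<and> (\<forall>i<j. \<forall>r<k. g $$ (r, i) = (if r = i then 1 else 0)) \<and> (\<forall>r<k. [g $$ (r, j) = v r] (mod int p))"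
      by (rule ballI)
    from bchoice[OF this] obtain g where g0: "\<forall>v\<in>?V. g v \<in> carrier (SL k) \<and>
        (\<forall>i<j. \<forall>r<k. g v $$ (r, i) = (if r = i then 1 else 0)) \<and> (\<forall>r<k. [g v $$ (r, j) = v r] (mod int p))" ..
    have g: "g v \<in> carrier (SL k)" "\<And>i r. i < j \<Longrightarrow> r < k \<Longrightarrow> g v $$ (r, i) = (if r = i then 1 else 0)"
      "\<And>r. r < k \<Longrightarrow> [g v $$ (r, j) = v r] (mod int p)" if "v \<in> ?V" for v
      using bspec[OF g0 that] by auto
    have ent: "(A * s) $$ (r, i) = A $$ (r, i)" if "A \<in> carrier (SL k)" "s \<in> S'" "i < Suc j" "r < k" for A s i r
    proof -
      have ik: "i < k" using that j by simp
      have "(A * s) $$ (r, i) = (\<Sum>t<k. if t = i then A $$ (r, i) else 0)"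
        unfolding mult_entry[OF SL_mat[OF that(1)] SL_mat[OF subsetD[OF S'(1) that(2)]] that(4) ik]
        using S'(3)[OF that(2,3)] by (intro sum.cong) auto
      then show ?thesis using ik by simp
    qed
    let ?f = "\<lambda>(v, s). g v * s"
    have key: "v = v' \<and> s = s'" if vs: "v \<in> ?V" "v' \<in> ?V" "s \<in> S'" "s' \<in> S'" "mat_cong (int p) (g v * s) (g v' * s')" for v v' s s'
    proof -
      have sS: "s \<in> carrier (SL k)" "s' \<in> carrier (SL k)" using vs S' by auto
      have "v r = v' r" if r: "r < k" for r
      proof -
        have "[g v $$ (r, j) = g v' $$ (r, j)] (mod int p)"
          using vs(5) r j ent[OF g(1)[OF vs(1)] vs(3), of j r] ent[OF g(1)[OF vs(2)] vs(4), of j r]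
          unfolding mat_cong_def by (metis lessI)
        then have "[v r = v' r] (mod int p)"
          using g(3)[OF vs(1) r] g(3)[OF vs(2) r] by (meson cong_sym cong_trans)
        then show ?thesis using V1[OF vs(1) r] V1[OF vs(2) r] by (simp add: unique_euclidean_semiring_class.cong_def)
      qed
      then have v: "v = v'" using vs(1,2) by (intro PiE_ext) auto
      have "mat_cong (int p) (inv\<^bsub>SL k\<^esub> g v * (g v * s)) (inv\<^bsub>SL k\<^esub> g v * (g v * s'))"
        by (rule mat_cong_mult) (use vs(5) g(1)[OF vs(1)] sS v in \<open>auto simp: SL_mat\<close>)
      moreover have "inv\<^bsub>SL k\<^esub> g v * (g v * s) = s" "inv\<^bsub>SL k\<^esub> g v * (g v * s') = s'"
        using g(1)[OF vs(1)] sS by (simp_all flip: SL_assoc)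
      ultimately have "s = s'" using S'(4)[OF vs(3,4)] by simp
      then show ?thesis using v by blast
    qed
    have inj: "inj_on ?f (?V \<times> S')"
    proof (rule inj_onI)
      fix x y assume xy: "x \<in> ?V \<times> S'" "y \<in> ?V \<times> S'" "?f x = ?f y"
      then have "mat_cong (int p) (g (fst x) * snd x) (g (fst y) * snd y)" by (simp add: case_prod_beta)
      with key[of "fst x" "fst y" "snd x" "snd y"] xy(1,2) show "x = y"
        by (metis mem_Times_iff prod_eqI)
    qed
    have "card (?f ` (?V \<times> S')) = card ?V * card S'"
      using card_image[OF inj] by (simp add: card_cartesian_product)
    also have "card ?V = (\<Prod>r<k. if r = j then card ?J else p)"
      by (subst card_PiE) (auto intro!: prod.cong)
    also have "\<dots> = card ?J * p ^ (k - 1)"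
      using j by (subst prod.remove[of _ j]) (auto simp: card_Diff_singleton)
    also have "card ?J = (if j = k - 1 then 1 else p - 1)" by (auto simp: nat_diff_distrib)
    finally have "card (?f ` (?V \<times> S')) = (if j = k - 1 then 1 else p - 1) * p ^ (k - 1) * card S'" .
    moreover have "?f ` (?V \<times> S') \<subseteq> carrier (SL k)"
    proof
      fix z assume "z \<in> ?f ` (?V \<times> S')"
      then obtain v s where vs: "v \<in> ?V" "s \<in> S'" "z = g v * s" by (rule image_pairE)
      show "z \<in> carrier (SL k)" unfolding vs(3) using g(1)[OF vs(1)] subsetD[OF S'(1) vs(2)] by simp
    qed
    moreover have "finite (?f ` (?V \<times> S'))" using S'(2) by (intro finite_imageI finite_cartesian_product finite_PiE) auto
    moreover have "\<forall>s\<in>?f ` (?V \<times> S'). \<forall>i<j. \<forall>r<k. s $$ (r, i) = (if r = i then 1 else 0)"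
    proof (intro ballI allI impI)
      fix z i r assume z: "z \<in> ?f ` (?V \<times> S')" and ir: "i < j" "r < k"
      from z obtain v s where vs: "v \<in> ?V" "s \<in> S'" "z = g v * s" by (rule image_pairE)
      show "z $$ (r, i) = (if r = i then 1 else 0)"
        unfolding vs(3) using ent[OF g(1)[OF vs(1)] vs(2) less_SucI[OF ir(1)] ir(2)] g(2)[OF vs(1) ir] by simp
    qed
    moreover have "\<forall>s\<in>?f ` (?V \<times> S'). \<forall>s'\<in>?f ` (?V \<times> S'). mat_cong (int p) s s' \<longrightarrow> s = s'"
    proof (intro ballI impI)
      fix z z' assume z: "z \<in> ?f ` (?V \<times> S')" "z' \<in> ?f ` (?V \<times> S')" "mat_cong (int p) z z'"
      obtain v s where vs: "v \<in> ?V" "s \<in> S'" "z = g v * s" using z(1) by (rule image_pairE)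
      obtain v' s' where vs': "v' \<in> ?V" "s' \<in> S'" "z' = g v' * s'" using z(2) by (rule image_pairE)
      from key[OF vs(1) vs'(1) vs(2) vs'(2)] z(3) show "z = z'" unfolding vs(3) vs'(3) by blast
    qed
    ultimately show ?thesis by blast
  qed
  show ?thesis
    using assms(2)
  proof (induction n)
    case 0
    have "k - 1 < k" using 0 by simp
    have *: "s $$ (r, i) = (if r = i then 1 else 0)" if "s \<in> {1\<^sub>m k}" "i < Suc (k - 1)" "r < k" for s :: "int mat" and i r
      using that by simp
    show ?case
      using step[of "k - 1" "{1\<^sub>m k}", OF \<open>k - 1 < k\<close> _ _ *] by simp
  next
    case (Suc n)
    then obtain S' where S': "S' \<subseteq> carrier (SL k)" "finite S'" "card S' = p ^ (k - 1) * ((p - 1) * p ^ (k - 1)) ^ n"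
      "\<forall>s\<in>S'. \<forall>i<k - 1 - n. \<forall>r<k. s $$ (r, i) = (if r = i then 1 else 0)"
      "\<forall>s\<in>S'. \<forall>s'\<in>S'. mat_cong (int p) s s' \<longrightarrow> s = s'" by auto
    have j: "k - 1 - Suc n < k" "Suc (k - 1 - Suc n) = k - 1 - n" "k - 1 - Suc n \<noteq> k - 1" using Suc.prems by auto
    have *: "s $$ (r, i) = (if r = i then 1 else 0)" if "s \<in> S'" "i < Suc (k - 1 - Suc n)" "r < k" for s i r
      using S'(4) that unfolding j(2) by blast
    show ?case
      using step[OF j(1) S'(1,2) *] S'(3,5) j(3) by (simp add: mult_ac)
  qed
qed

text \<open>Two members of the family in one coset of \<open>N\<close> differ by a scalar \<lambda>
  modulo p with \<lambda>^k = 1, and a prime modulus has at most \<open>k\<close> such residues. The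
  factor 2^(k-1) comes from p \<le> 2 (p - 1), applied once for each column with k > j + 1.\<close>

theorem normal_index_lower:
  assumes p: "prime (p::nat)" and N: "N \<lhd> SL k" and lev: "\<And>a. X 0 1 a \<in> N \<Longrightarrow> int p dvd a"
  shows "of_nat (p ^ (k * k - 1)) \<le> of_nat (k * 2 ^ (k - 1)) * subgroup_index (SL k) N"
proof (cases "finite (rcosets\<^bsub>SL k\<^esub> N)")
  case True
  interpret N: normal N "SL k" by fact
  have "k - 1 < k" using k_ge_3 by simp
  obtain S where S: "S \<subseteq> carrier (SL k)" "finite S" "card S = p ^ (k - 1) * ((p - 1) * p ^ (k - 1)) ^ (k - 1)"
    "\<And>s s'. s \<in> S \<Longrightarrow> s' \<in> S \<Longrightarrow> mat_cong (int p) s s' \<Longrightarrow> s = s'"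
    using many_residues[OF p \<open>k - 1 < k\<close>] by blast
  let ?c = "\<lambda>s. N #>\<^bsub>SL k\<^esub> s"
  let ?\<Lambda> = "{x \<in> {..<p}. [x ^ k = 1] (mod p)}"
  have L: "card ?\<Lambda> \<le> k" using roots_mod_prime_bound[OF p, of k 1] k_ge_3 by simp
  have p1: "p > 1" using prime_gt_1_nat[OF p] .
  have fib: "card {s \<in> S. ?c s = y} \<le> k" if y: "y \<in> ?c ` S" for y
  proof -
    obtain s0 where s0: "s0 \<in> S" "y = ?c s0" using y by blast
    have s0S: "s0 \<in> carrier (SL k)" using s0 S by auto
    define A where "A s = s * inv\<^bsub>SL k\<^esub> s0" for s
    define lam where "lam s = nat (A s $$ (k - 1, k - 1) mod int p)" for s
    have AN: "A s \<in> N" if "s \<in> S" "?c s = y" for s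
      using rcos_eq_iff[OF N.subgroup_axioms, of s s0] that s0 s0S S(1) by (auto simp: A_def)
    have lamA: "mat_cong (int p) (A s) (int (lam s) \<cdot>\<^sub>m 1\<^sub>m k)" if "s \<in> S" "?c s = y" for s
    proof -
      have il: "int (lam s) = A s $$ (k - 1, k - 1) mod int p" unfolding lam_def using p1 by simp
      have "mat_cong (int p) (A s) (A s $$ (k - 1, k - 1) \<cdot>\<^sub>m 1\<^sub>m k)" by (rule normal_scalar[OF N lev AN[OF that]])
      moreover have "mat_cong (int p) (A s $$ (k - 1, k - 1) \<cdot>\<^sub>m 1\<^sub>m k) (int (lam s) \<cdot>\<^sub>m 1\<^sub>m k)"
        unfolding mat_cong_def il by (auto simp: unique_euclidean_semiring_class.cong_def)
      ultimately show ?thesis by (rule mat_cong_trans)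
    qed
    have sub: "lam ` {s \<in> S. ?c s = y} \<subseteq> ?\<Lambda>"
    proof
      fix x assume "x \<in> lam ` {s \<in> S. ?c s = y}"
      then obtain s where s: "s \<in> S" "?c s = y" "x = lam s" by blast
      have As: "A s \<in> carrier (SL k)" using AN[OF s(1,2)] N.mem_carrier by blast
      have "[det (A s) = det (int x \<cdot>\<^sub>m 1\<^sub>m k)] (mod int p)"
        unfolding s(3) by (rule det_mat_cong[OF SL_mat[OF As] _ lamA[OF s(1,2)]]) simp
      then have "[1 = int x ^ k] (mod int p)" using As by (simp add: SL_carrier det_smult)
      then have "[x ^ k = 1] (mod p)" by (metis cong_int_iff cong_sym of_nat_1 of_nat_power)
      moreover have "x < p" unfolding s(3) lam_def using p1 by (simp add: nat_less_iff)
      ultimately show "x \<in> ?\<Lambda>" by simp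
    qed
    have inj: "inj_on lam {s \<in> S. ?c s = y}"
    proof (rule inj_onI)
      fix s s' assume s: "s \<in> {s \<in> S. ?c s = y}" "s' \<in> {s \<in> S. ?c s = y}" "lam s = lam s'"
      have 1: "mat_cong (int p) (A s) (int (lam s) \<cdot>\<^sub>m 1\<^sub>m k)" using lamA[of s] s(1) by blast
      have 2: "mat_cong (int p) (A s') (int (lam s) \<cdot>\<^sub>m 1\<^sub>m k)" unfolding s(3) using lamA[of s'] s(2) by blast
      from mat_cong_trans[OF 1 mat_cong_sym[OF 2]] have "mat_cong (int p) (A s) (A s')" .
      moreover have sS: "s \<in> carrier (SL k)" "s' \<in> carrier (SL k)" using s S(1) by auto
      ultimately have "mat_cong (int p) (A s * s0) (A s' * s0)"
        using s0S by (intro mat_cong_mult) (auto simp: A_def SL_mat)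
      moreover have "A s * s0 = s" "A s' * s0 = s'" unfolding A_def using sS s0S by (simp_all add: SL_assoc)
      ultimately have "mat_cong (int p) s s'" by simp
      then show "s = s'" using S(4)[of s s'] s(1,2) by blast
    qed
    have "finite ?\<Lambda>" by simp
    from card_inj_on_le[OF inj sub this] show ?thesis using L by linarith
  qed
  have "S = (\<Union>y\<in>?c ` S. {s \<in> S. ?c s = y})" by auto
  then have "card S \<le> (\<Sum>y\<in>?c ` S. card {s \<in> S. ?c s = y})"
    using card_UN_le[of "?c ` S" "\<lambda>y. {s \<in> S. ?c s = y}"] S(2) by simp
  also have "\<dots> \<le> card (?c ` S) * k" using sum_bounded_above[of "?c ` S" "\<lambda>y. card {s \<in> S. ?c s = y}" k] fib by simp
  also have "card (?c ` S) \<le> card (rcosets\<^bsub>SL k\<^esub> N)"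
    using S(1) by (intro card_mono True) (auto simp: RCOSETS_def)
  finally have 1: "card S \<le> card (rcosets\<^bsub>SL k\<^esub> N) * k" by simp
  have "p ^ (k * k - 1) = p ^ (k - 1) * (p * p ^ (k - 1)) ^ (k - 1)"
  proof -
    have "k * k - 1 = (k - 1) + k * (k - 1)" using k_ge_3 by (cases k) auto
    moreover have "p * p ^ (k - 1) = p ^ k" using k_ge_3 by (cases k) auto
    ultimately show ?thesis by (simp add: power_add power_mult)
  qed
  also have "\<dots> \<le> p ^ (k - 1) * ((2 * (p - 1)) * p ^ (k - 1)) ^ (k - 1)"
    using p1 by (intro mult_le_mono power_mono) auto
  also have "\<dots> = 2 ^ (k - 1) * card S" unfolding S(3) by (simp add: power_mult_distrib mult_ac)
  also have "\<dots> \<le> 2 ^ (k - 1) * (card (rcosets\<^bsub>SL k\<^esub> N) * k)" using 1 by simp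
  also have "\<dots> = k * 2 ^ (k - 1) * card (rcosets\<^bsub>SL k\<^esub> N)" by simp
  finally have "(of_nat (p ^ (k * k - 1)) :: ennreal) \<le> of_nat (k * 2 ^ (k - 1) * card (rcosets\<^bsub>SL k\<^esub> N))"
    by (rule of_nat_mono)
  then show ?thesis using True by (simp add: subgroup_index_def)
next
  case False
  then show ?thesis using k_ge_3 by (simp add: subgroup_index_def ennreal_mult_top)
qed

section \<open>Normal cores and conjugates\<close>

definition core :: "int mat set \<Rightarrow> int mat set" where
  "core H = {A \<in> carrier (SL k). \<forall>g\<in>carrier (SL k). g * A * inv\<^bsub>SL k\<^esub> g \<in> H}"

lemma conj_mult:
  assumes "g \<in> carrier (SL k)" "A \<in> carrier (SL k)" "B \<in> carrier (SL k)"
  shows "g * (A * B) * inv\<^bsub>SL k\<^esub> g = (g * A * inv\<^bsub>SL k\<^esub> g) * (g * B * inv\<^bsub>SL k\<^esub> g)"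
proof -
  have "(g * A * inv\<^bsub>SL k\<^esub> g) * (g * B * inv\<^bsub>SL k\<^esub> g) = g * (A * ((inv\<^bsub>SL k\<^esub> g * g) * (B * inv\<^bsub>SL k\<^esub> g)))"
    using assms by (simp add: SL_assoc del: SL_inv_l)
  then show ?thesis using assms by (simp add: SL_assoc)
qed

lemma conj_inv:
  assumes "g \<in> carrier (SL k)" "A \<in> carrier (SL k)"
  shows "inv\<^bsub>SL k\<^esub> (g * A * inv\<^bsub>SL k\<^esub> g) = g * inv\<^bsub>SL k\<^esub> A * inv\<^bsub>SL k\<^esub> g"
  using assms inv_mult_group[of "g * A" "inv\<^bsub>SL k\<^esub> g"] inv_mult_group[of g A] by (simp add: SL_assoc)

lemma conj_subgroup:
  assumes H: "subgroup H (SL k)" and g: "g \<in> carrier (SL k)"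
  shows "subgroup {A \<in> carrier (SL k). g * A * inv\<^bsub>SL k\<^esub> g \<in> H} (SL k)"
proof -
  interpret H: subgroup H "SL k" by fact
  have H: "x * y \<in> H" if "x \<in> H" "y \<in> H" for x y using H.m_closed that by simp
  show ?thesis
  proof (rule subgroupI)
    show "{A \<in> carrier (SL k). g * A * inv\<^bsub>SL k\<^esub> g \<in> H} \<noteq> {}"
      using g H.one_closed by (auto intro!: exI[of _ "1\<^sub>m k"])
    fix A assume "A \<in> {A \<in> carrier (SL k). g * A * inv\<^bsub>SL k\<^esub> g \<in> H}"
    then have A: "A \<in> carrier (SL k)" "g * A * inv\<^bsub>SL k\<^esub> g \<in> H" by auto
    have "g * inv\<^bsub>SL k\<^esub> A * inv\<^bsub>SL k\<^esub> g \<in> H"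
      using H.m_inv_closed[OF A(2)] unfolding conj_inv[OF g A(1)] .
    then show "inv\<^bsub>SL k\<^esub> A \<in> {A \<in> carrier (SL k). g * A * inv\<^bsub>SL k\<^esub> g \<in> H}" using A by simp
  next
    fix A B assume "A \<in> {A \<in> carrier (SL k). g * A * inv\<^bsub>SL k\<^esub> g \<in> H}" "B \<in> {A \<in> carrier (SL k). g * A * inv\<^bsub>SL k\<^esub> g \<in> H}"
    then show "A \<otimes>\<^bsub>SL k\<^esub> B \<in> {A \<in> carrier (SL k). g * A * inv\<^bsub>SL k\<^esub> g \<in> H}"
      using conj_mult[OF g, of A B] H by auto
  qed auto
qed

lemma core_normal: assumes H: "subgroup H (SL k)" shows "core H \<lhd> SL k"
proof -
  have c: "core H = carrier (SL k) \<inter> \<Inter>((\<lambda>g. {A \<in> carrier (SL k). g * A * inv\<^bsub>SL k\<^esub> g \<in> H}) ` carrier (SL k))"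
    by (auto simp: core_def)
  have "subgroup (core H) (SL k)"
    unfolding c by (rule subgroup_Inter_carrier) (auto intro: conj_subgroup[OF H])
  moreover have "x * A * inv\<^bsub>SL k\<^esub> x \<in> core H" if x: "x \<in> carrier (SL k)" and A: "A \<in> core H" for x A
  proof -
    have AS: "A \<in> carrier (SL k)" using A by (simp add: core_def)
    have "g * (x * A * inv\<^bsub>SL k\<^esub> x) * inv\<^bsub>SL k\<^esub> g = (g * x) * A * inv\<^bsub>SL k\<^esub> (g * x)" if g: "g \<in> carrier (SL k)" for g
      using x AS g inv_mult_group[of g x] by (simp add: SL_assoc)
    then show ?thesis using x A AS by (auto simp: core_def)
  qed
  ultimately show ?thesis by (simp add: normal_inv_iff)
qed

lemma core_subset: "core H \<subseteq> H"
  by (auto simp: core_def dest!: bspec[of _ _ "1\<^sub>m k"]) (metis SL_1 SL_one SL_one_mult(1) SL_one_mult(2) inv_one)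

lemma core_of_normal: assumes "N \<lhd> SL k" shows "core N = N"
proof -
  interpret N: normal N "SL k" by fact
  have "N \<subseteq> core N" unfolding core_def using N.inv_op_closed2 N.mem_carrier by auto
  then show ?thesis using core_subset by blast
qed

section \<open>Row and column groups, and the index of an arbitrary subgroup\<close>

definition rowmat :: "(nat \<Rightarrow> int) \<Rightarrow> int mat" where "rowmat a = transpose_mat (colmat 0 a)"

lemma rowmat_SL [simp]: "rowmat a \<in> carrier (SL k)"
  using colmat_SL[of 0 a] k_ge_3 unfolding rowmat_def SL_carrier by (simp add: det_transpose[OF colmat_mat])

lemma rowmat_index: "r < k \<Longrightarrow> c < k \<Longrightarrow> rowmat a $$ (r, c) = (if r = c then 1 else if r = 0 then a c else 0)"
  by (auto simp: rowmat_def colmat_def)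

lemma rowmat_mult_index:
  assumes "B \<in> carrier_mat k k" "r < k" "c < k" "a 0 = 0"
  shows "(rowmat a * B) $$ (r, c) = B $$ (r, c) + (if r = 0 then (\<Sum>t<k. a t * B $$ (t, c)) else 0)"
proof -
  have "(rowmat a * B) $$ (r, c) = (\<Sum>t<k. (if t = r then B $$ (r, c) else 0) + (if r = 0 then a t * B $$ (t, c) else 0))"
    unfolding mult_entry[OF SL_mat[OF rowmat_SL] assms(1-3)] using assms by (intro sum.cong) (auto simp: rowmat_index)
  then show ?thesis using assms by (simp add: sum.distrib)
qed

lemma rowmat_add:
  assumes "a 0 = 0" "b 0 = 0" shows "rowmat a * rowmat b = rowmat (\<lambda>t. a t + b t)"
proof (rule eq_matI, goal_cases)
  case (1 r c)
  then have rc: "r < k" "c < k" using SL_dim[OF rowmat_SL] by auto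
  have "(\<Sum>t<k. a t * rowmat b $$ (t, c)) = (\<Sum>t<k. if t = c then a c else 0)"
    using assms rc by (intro sum.cong) (auto simp: rowmat_index)
  then have "(\<Sum>t<k. a t * rowmat b $$ (t, c)) = a c" using rc by simp
  then show ?case
    using rowmat_mult_index[of "rowmat b" r c a, OF SL_mat[OF rowmat_SL] rc assms(1)] rc assms
    by (auto simp: rowmat_index simp del: index_mult_mat(1))
qed (use SL_dim[OF rowmat_SL] in auto)

lemma rowmat_0: "rowmat (\<lambda>_. 0) = 1\<^sub>m k"
  by (rule eq_matI) (auto simp: rowmat_index)

lemma rowmat_inv: assumes "a 0 = 0" shows "inv\<^bsub>SL k\<^esub> rowmat a = rowmat (\<lambda>t. - a t)"
  using rowmat_add[of "\<lambda>t. - a t" a] assms rowmat_0 by (intro inv_equality) auto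

lemma colmat_add: assumes "j < k" shows "colmat j v * colmat j w = colmat j (\<lambda>t. v t + w t)"
proof (rule eq_matI, goal_cases)
  case (1 r c)
  then have rc: "r < k" "c < k" by (auto simp: colmat_def)
  then show ?case
    using colmat_mult_index[OF colmat_mat rc assms, of v j w] assms
    by (auto simp: colmat_index simp del: index_mult_mat(1))
qed (auto simp: colmat_def)

lemma colmat_0: "colmat j (\<lambda>_. 0) = 1\<^sub>m k"
  by (rule eq_matI) (auto simp: colmat_def)

lemma colmat_inv: assumes "j < k" shows "inv\<^bsub>SL k\<^esub> colmat j v = colmat j (\<lambda>t. - v t)"
  using colmat_add[OF assms, of "\<lambda>t. - v t" v] assms colmat_0 by (intro inv_equality) auto

text \<open>A Heisenberg relation: conjugation by the row matrix adds the pairing of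
  \<open>a\<close> and \<open>v\<close> to coordinate 0 of the column. This pairing lets row
  matrices act as characters on column vectors.\<close>

lemma rowmat_colmat:
  assumes "a 0 = 0" "a l = 0" "l < k" "l \<noteq> 0"
  shows "rowmat a * colmat l v = colmat l (\<lambda>r. v r + (if r = 0 then (\<Sum>t<k. a t * v t) else 0)) * rowmat a"
    (is "_ = colmat l ?v * _")
proof (rule eq_matI, goal_cases)
  case (1 r c)
  then have rc: "r < k" "c < k" using SL_dim[OF rowmat_SL] by (auto simp: colmat_def)
  have "(\<Sum>t<k. a t * colmat l v $$ (t, c)) = (\<Sum>t<k. (if t = c then a c else 0) + (if c = l then a t * v t else 0))"
    using assms rc by (intro sum.cong) (auto simp: colmat_index)
  also have "\<dots> = a c + (if c = l then (\<Sum>t<k. a t * v t) else 0)" using rc by (simp add: sum.distrib)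
  finally have 1: "(\<Sum>t<k. a t * colmat l v $$ (t, c)) = a c + (if c = l then (\<Sum>t<k. a t * v t) else 0)" .
  define s where "s = (\<Sum>t<k. a t * v t)"
  have 2: "(rowmat a * colmat l v) $$ (r, c) = colmat l v $$ (r, c) + (if r = 0 then a c + (if c = l then s else 0) else 0)"
    using rowmat_mult_index[of "colmat l v" r c a, OF colmat_mat rc assms(1)] unfolding 1 s_def .
  show ?case
    using colmat_mult_index[OF SL_mat[OF rowmat_SL] rc assms(3), of ?v a] rc assms
    unfolding 2 s_def[symmetric]
    by (auto simp: colmat_index rowmat_index simp del: index_mult_mat(1))
qed (use SL_dim[OF rowmat_SL] in \<open>auto simp: colmat_def\<close>)

text \<open>The characters of a subgroup \<open>L\<close> of \<open>\<int>\<^sup>r\<close> modulo \<open>p\<close> separate at least as many points as \<open>L\<close> has;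
  \<open>S\<close> collects such characters and \<open>C\<close> a transversal of \<open>L\<close>, both built one coordinate at a time.\<close>

lemma dual_transversals:
  fixes L :: "(nat \<Rightarrow> int) set" and p :: nat
  assumes p: "prime p" and e0: "\<forall>z. (\<lambda>t. if t = 0 then z else 0) \<in> L \<longrightarrow> int p dvd z"
    and i: "i < n"
  shows "\<exists>S C. finite S \<and> finite C \<and> card S * card C = p ^ Suc i \<and>
    (\<forall>a\<in>S. a 0 = 0 \<and> (\<forall>t>i. a t = 0)) \<and> (\<forall>c\<in>C. \<forall>t>i. c t = 0) \<and>
    (\<forall>c\<in>C. \<forall>c'\<in>C. (\<lambda>t. c t - c' t) \<in> L \<longrightarrow> c = c') \<and>
    (\<forall>a\<in>S. \<forall>a'\<in>S. (\<forall>c\<in>L. (\<forall>t>i. c t = 0) \<longrightarrow> int p dvd (\<Sum>t<n. (a t - a' t) * c t)) \<longrightarrow> a = a')"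
  using i
proof (induction i)
  case 0
  let ?C = "(\<lambda>z t. if t = (0::nat) then z else (0::int)) ` {0..<int p}"
  have inj: "inj_on (\<lambda>z t. if t = (0::nat) then z else (0::int)) {0..<int p}"
    by (rule inj_onI) (metis (full_types))
  have "c = c'" if cc: "c \<in> ?C" "c' \<in> ?C" "(\<lambda>t. c t - c' t) \<in> L" for c c'
  proof -
    obtain z z' where z: "c = (\<lambda>t. if t = 0 then z else 0)" "c' = (\<lambda>t. if t = 0 then z' else 0)"
      "z \<in> {0..<int p}" "z' \<in> {0..<int p}" using cc(1,2) by blast
    have "(\<lambda>t. c t - c' t) = (\<lambda>t. if t = 0 then z - z' else 0)" by (auto simp: z)
    then have "int p dvd z - z'" using e0 cc(3) by simp
    then have "z = z'" using z(3,4) by (metis atLeastLessThan_iff mod_eq_dvd_iff mod_pos_pos_trivial)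
    then show ?thesis unfolding z(1,2) by (rule arg_cong)
  qed
  moreover have "card ?C = p" using card_image[OF inj] by simp
  ultimately show ?case
    by (intro exI[of _ "{\<lambda>_. 0}"] exI[of _ ?C]) auto
next
  case (Suc i)
  then obtain S C where SC: "finite S" "finite C" "card S * card C = p ^ Suc i"
    "\<And>a. a \<in> S \<Longrightarrow> a 0 = 0" "\<And>a t. a \<in> S \<Longrightarrow> i < t \<Longrightarrow> a t = 0" "\<And>c t. c \<in> C \<Longrightarrow> i < t \<Longrightarrow> c t = 0"
    "\<And>c c'. c \<in> C \<Longrightarrow> c' \<in> C \<Longrightarrow> (\<lambda>t. c t - c' t) \<in> L \<Longrightarrow> c = c'"
    "\<And>a a'. a \<in> S \<Longrightarrow> a' \<in> S \<Longrightarrow> (\<forall>c\<in>L. (\<forall>t>i. c t = 0) \<longrightarrow> int p dvd (\<Sum>t<n. (a t - a' t) * c t)) \<Longrightarrow> a = a'"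
    by (auto simp: Suc_lessD)
  define ext where "ext f z = (f :: nat \<Rightarrow> int)(Suc i := z)" for f z
  have ext_card: "card ((\<lambda>(f, z). ext f z) ` (A \<times> {0..<int p})) = card A * p" "finite ((\<lambda>(f, z). ext f z) ` (A \<times> {0..<int p}))"
    if "finite A" "\<And>f t. f \<in> A \<Longrightarrow> i < t \<Longrightarrow> f t = 0" for A
  proof -
    have "inj_on (\<lambda>(f, z). ext f z) (A \<times> {0..<int p})"
    proof (rule inj_onI, clarify)
      fix f z f' z' assume f: "f \<in> A" "f' \<in> A" "ext f z = ext f' z'"
      have "z = z'" using fun_cong[OF f(3), of "Suc i"] by (simp add: ext_def)
      moreover have "f t = f' t" for t
        using fun_cong[OF f(3), of t] that(2)[OF f(1), of "Suc i"] that(2)[OF f(2), of "Suc i"]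
        by (cases "t = Suc i") (auto simp: ext_def)
      ultimately show "f = f' \<and> z = z'" by auto
    qed
    from card_image[OF this] show "card ((\<lambda>(f, z). ext f z) ` (A \<times> {0..<int p})) = card A * p"
      by (simp add: card_cartesian_product)
    show "finite ((\<lambda>(f, z). ext f z) ` (A \<times> {0..<int p}))" using that(1) by simp
  qed
  have small: "z = z'" if "int p dvd z - z'" "z \<in> {0..<int p}" "z' \<in> {0..<int p}" for z z'
    using that by (metis atLeastLessThan_iff mod_eq_dvd_iff mod_pos_pos_trivial)
  \<comment> \<open>The new coordinate multiplies one of the two cardinalities by p. If some vector
    of \<open>L\<close> ends there in a unit modulo p, it separates the new characters; otherwise
    vectors of \<open>L\<close> end in a multiple of p, and the extended representatives stay
    inequivalent.\<close>
  show ?case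
  proof (cases "\<exists>c\<in>L. (\<forall>t>Suc i. c t = 0) \<and> \<not> int p dvd c (Suc i)")
    case True
    then obtain d where d: "d \<in> L" "\<And>t. Suc i < t \<Longrightarrow> d t = 0" "\<not> int p dvd d (Suc i)" by blast
    let ?S = "(\<lambda>(f, z). ext f z) ` (S \<times> {0..<int p})"
    have sep: "ext a z = ext a' z'"
      if a: "a \<in> S" "a' \<in> S" and z: "z \<in> {0..<int p}" "z' \<in> {0..<int p}"
        and hyp: "\<And>c. c \<in> L \<Longrightarrow> (\<forall>t>Suc i. c t = 0) \<Longrightarrow> int p dvd (\<Sum>t<n. (ext a z t - ext a' z' t) * c t)" for a a' z z'
    proof -
      have "a = a'"
      proof (rule SC(8)[OF a], intro ballI impI)
        fix c assume c: "c \<in> L" "\<forall>t>i. c t = 0"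
        have "(\<Sum>t<n. (ext a z t - ext a' z' t) * c t) = (\<Sum>t<n. (a t - a' t) * c t)"
          using c(2) by (intro sum.cong) (auto simp: ext_def)
        then show "int p dvd (\<Sum>t<n. (a t - a' t) * c t)" using hyp[OF c(1)] c(2) by auto
      qed
      moreover have "(\<Sum>t<n. (ext a z t - ext a z' t) * d t) = (\<Sum>t<n. if t = Suc i then (z - z') * d (Suc i) else 0)"
        by (intro sum.cong) (auto simp: ext_def)
      ultimately have "int p dvd (z - z') * d (Suc i)" using hyp[OF d(1)] d(2) Suc.prems by simp
      then have "int p dvd z - z'" using d(3) p by (metis prime_dvd_multD prime_nat_int_transfer)
      then show ?thesis using small z \<open>a = a'\<close> by blast
    qed
    have "card ?S = card S * p" and fS: "finite ?S" by (rule ext_card, rule SC(1), erule SC(5), assumption)+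
    then have 1: "finite ?S" "card ?S * card C = p ^ Suc (Suc i)"
      using SC(3) by (simp_all add: mult_ac)
    have 2: "b 0 = 0 \<and> (\<forall>t>Suc i. b t = 0)" if b: "b \<in> ?S" for b
    proof -
      obtain f z where "f \<in> S" "z \<in> {0..<int p}" "b = ext f z" using b by (rule image_pairE)
      then show ?thesis using SC(4)[of f] SC(5)[of f] by (simp add: ext_def)
    qed
    have 3: "b = b'" if b: "b \<in> ?S" "b' \<in> ?S"
        and hyp: "\<forall>c\<in>L. (\<forall>t>Suc i. c t = 0) \<longrightarrow> int p dvd (\<Sum>t<n. (b t - b' t) * c t)" for b b'
    proof -
      obtain f z where f: "f \<in> S" "z \<in> {0..<int p}" "b = ext f z" using b(1) by (rule image_pairE)
      obtain f' z' where f': "f' \<in> S" "z' \<in> {0..<int p}" "b' = ext f' z'" using b(2) by (rule image_pairE)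
      show ?thesis using sep[OF f(1) f'(1) f(2) f'(2)] hyp unfolding f(3) f'(3) by blast
    qed
    have 4: "c t = 0" if "c \<in> C" "Suc i < t" for c t using SC(6)[of c t] that by simp
    show ?thesis
    proof (rule exI[of _ ?S], rule exI[of _ C], intro conjI)
      show "\<forall>a\<in>?S. a 0 = 0 \<and> (\<forall>t>Suc i. a t = 0)" by (rule ballI) (rule 2)
      show "\<forall>c\<in>C. \<forall>t>Suc i. c t = 0" by (intro ballI allI impI) (rule 4)
      show "\<forall>c\<in>C. \<forall>c'\<in>C. (\<lambda>t. c t - c' t) \<in> L \<longrightarrow> c = c'" by (intro ballI impI) (rule SC(7))
      show "\<forall>a\<in>?S. \<forall>a'\<in>?S. (\<forall>c\<in>L. (\<forall>t>Suc i. c t = 0) \<longrightarrow> int p dvd (\<Sum>t<n. (a t - a' t) * c t)) \<longrightarrow> a = a'"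
        by (intro ballI, rule impI) (rule 3)
    qed (use 1 SC(2) in simp_all)
  next
    case False
    then have F: "int p dvd c (Suc i)" if "c \<in> L" "\<And>t. Suc i < t \<Longrightarrow> c t = 0" for c using that by blast
    let ?C = "(\<lambda>(f, z). ext f z) ` (C \<times> {0..<int p})"
    have sep: "ext c z = ext c' z'"
      if c: "c \<in> C" "c' \<in> C" and z: "z \<in> {0..<int p}" "z' \<in> {0..<int p}"
        and L: "(\<lambda>t. ext c z t - ext c' z' t) \<in> L" for c c' z z'
    proof -
      have "int p dvd ext c z (Suc i) - ext c' z' (Suc i)"
        using F[OF L] SC(6)[OF c(1)] SC(6)[OF c(2)] by (simp add: ext_def)
      then have "z = z'" using small z by (simp add: ext_def)
      moreover from this have "(\<lambda>t. ext c z t - ext c' z' t) = (\<lambda>t. c t - c' t)"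
        using SC(6)[OF c(1), of "Suc i"] SC(6)[OF c(2), of "Suc i"] by (auto simp: ext_def)
      ultimately show ?thesis using SC(7)[OF c] L by simp
    qed
    have "card ?C = card C * p" and fC: "finite ?C" by (rule ext_card, rule SC(2), erule SC(6), assumption)+
    then have 1: "finite ?C" "card S * card ?C = p ^ Suc (Suc i)"
      using SC(3) by (simp_all add: mult_ac)
    have 2: "b t = 0" if b: "b \<in> ?C" and t: "Suc i < t" for b t
    proof -
      obtain f z where "f \<in> C" "z \<in> {0..<int p}" "b = ext f z" using b by (rule image_pairE)
      then show ?thesis using SC(6)[of f t] t by (simp add: ext_def)
    qed
    have 3: "b = b'" if b: "b \<in> ?C" "b' \<in> ?C" and bL: "(\<lambda>t. b t - b' t) \<in> L" for b b'
    proof -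
      obtain f z where f: "f \<in> C" "z \<in> {0..<int p}" "b = ext f z" using b(1) by (rule image_pairE)
      obtain f' z' where f': "f' \<in> C" "z' \<in> {0..<int p}" "b' = ext f' z'" using b(2) by (rule image_pairE)
      show ?thesis using sep[OF f(1) f'(1) f(2) f'(2)] bL unfolding f(3) f'(3) by blast
    qed
    have 4: "b 0 = 0 \<and> (\<forall>t>Suc i. b t = 0)" if "b \<in> S" for b using SC(4,5) that by simp
    have 5: "b = b'" if "b \<in> S" "b' \<in> S"
        "\<forall>c\<in>L. (\<forall>t>Suc i. c t = 0) \<longrightarrow> int p dvd (\<Sum>t<n. (b t - b' t) * c t)" for b b'
      using SC(8)[OF that(1,2)] that(3) by simp
    show ?thesis
    proof (rule exI[of _ S], rule exI[of _ ?C], intro conjI)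
      show "\<forall>a\<in>S. a 0 = 0 \<and> (\<forall>t>Suc i. a t = 0)" by (rule ballI) (rule 4)
      show "\<forall>c\<in>?C. \<forall>t>Suc i. c t = 0" by (intro ballI allI impI) (rule 2)
      show "\<forall>c\<in>?C. \<forall>c'\<in>?C. (\<lambda>t. c t - c' t) \<in> L \<longrightarrow> c = c'" by (intro ballI impI) (rule 3)
      show "\<forall>a\<in>S. \<forall>a'\<in>S. (\<forall>c\<in>L. (\<forall>t>Suc i. c t = 0) \<longrightarrow> int p dvd (\<Sum>t<n. (a t - a' t) * c t)) \<longrightarrow> a = a'"
        by (intro ballI, rule impI) (rule 5)
    qed (use 1 SC(1) in simp_all)
  qed
qed

text \<open>After a conjugation the last-column subgroup meets \<open>H\<close> in a proper sublattice \<open>L\<close>. An element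
  \<open>D c * rowmat b\<close> of \<open>H\<close> normalizes \<open>D L\<close>, which forces \<open>b\<close> to kill \<open>L\<close> modulo \<open>p\<close>; hence the products
  of a transversal of \<open>L\<close> with characters of \<open>L\<close> lie in distinct cosets.\<close>

theorem subgroup_index_lower:
  assumes p: "prime (p::nat)" and H: "subgroup H (SL k)"
    and m: "X 0 1 (int p * F) \<in> core H" and F: "X 0 1 F \<notin> core H"
  shows "of_nat (p ^ (k - 1)) \<le> subgroup_index (SL k) H"
proof -
  interpret N: normal "core H" "SL k" by (rule core_normal[OF H])
  interpret H: subgroup H "SL k" by fact
  note N = N.normal_axioms
  define l where "l = k - 1"
  have l: "l < k" "l \<noteq> 0" "0 \<noteq> l" "0 < k" "1 < k" "0 < l" using k_ge_3 by (auto simp: l_def)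
  have "X 0 l F \<notin> core H" using F normal_X_transfer[OF N, of 0 l F 0 1] l by auto
  moreover have "X 0 l F \<in> carrier (SL k)" using l by simp
  \<comment> \<open>Outside the core means that some conjugate is outside \<open>H\<close>; for the
    conjugate subgroup \<open>K\<close> the matrix \<open>X 0 l F\<close> itself is missing.\<close>
  ultimately obtain g where g: "g \<in> carrier (SL k)" "g * X 0 l F * inv\<^bsub>SL k\<^esub> g \<notin> H"
    unfolding core_def by blast
  define K where "K = {A \<in> carrier (SL k). g * A * inv\<^bsub>SL k\<^esub> g \<in> H}"
  interpret K: subgroup K "SL k" unfolding K_def by (rule conj_subgroup[OF H g(1)])
  have NK: "core H \<subseteq> K" unfolding core_def K_def using g(1) by blast
  have Kmult: "x * y \<in> K" if "x \<in> K" "y \<in> K" for x y using K.m_closed that by simp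
  \<comment> \<open>The scale \<open>F\<close> is adapted to the level: p times any integer vector
    lies in the lattice \<open>L\<close>, while the first basis vector does not.\<close>
  define D where "D c = colmat l (\<lambda>t. F * c t)" for c
  have DS [simp]: "D c \<in> carrier (SL k)" for c unfolding D_def using l by simp
  have D_add: "D c * D c' = D (\<lambda>t. c t + c' t)" for c c'
    unfolding D_def using colmat_add[OF l(1)] by (simp add: distrib_left)
  have D_inv: "inv\<^bsub>SL k\<^esub> D c = D (\<lambda>t. - c t)" for c
    unfolding D_def using colmat_inv[OF l(1)] by simp
  define L where "L = {c. D c \<in> K}"
  have diff: "(\<lambda>t. c t - c' t) \<in> L" if "c \<in> L" "c' \<in> L" for c c'
    using that Kmult[of "D c" "inv\<^bsub>SL k\<^esub> D c'"] K.m_inv_closed[of "D c'"] D_add[of c "\<lambda>t. - c' t"]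
    by (simp add: L_def D_inv)
  have zero: "(\<lambda>_. 0) \<in> L"
    unfolding L_def D_def using K.one_closed by (simp add: colmat_0)
  have add: "(\<lambda>t. c t + c' t) \<in> L" if "c \<in> L" "c' \<in> L" for c c'
    using diff[OF that(1) diff[OF zero that(2)]] by simp
  have pL: "(\<lambda>t. int p * c t) \<in> L" for c
  proof -
    have "D (\<lambda>t. int p * c t) \<in> core H"
      unfolding D_def
    proof (rule colmat_subgroup[OF N.subgroup_axioms l(1)])
      fix r assume r: "r < k" "r \<noteq> l"
      have "X r l (int p * F) \<in> core H" using normal_X_transfer[OF N m, of r l] r l by simp
      from normal_X_mult[OF N this r(2,1) l(1), of "c r"] show "X r l (F * (int p * c r)) \<in> core H"
        by (simp add: mult_ac)
    qed
    then show ?thesis using NK by (auto simp: L_def)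
  qed
  have e0: "int p dvd z" if z: "(\<lambda>t. if t = 0 then z else 0) \<in> L" for z
  proof (rule ccontr)
    assume "\<not> int p dvd z"
    then have "coprime (int p) z" using p by (metis prime_imp_coprime prime_nat_int_transfer)
    then obtain u v where uv: "u * int p + v * z = 1"
      using bezout_int[of "int p" z] by (metis coprime_imp_gcd_eq_1)
    have mult: "(\<lambda>t. if t = 0 then c * z else 0) \<in> L" for c
    proof (induction c rule: int_induct[where k = 0])
      case base
      then show ?case using zero by (simp cong: if_cong)
    next
      case (step1 c)
      have "(\<lambda>t. (if t = (0::nat) then c * z else 0) + (if t = 0 then z else 0)) = (\<lambda>t. if t = 0 then (c + 1) * z else 0)"
        by (auto simp: algebra_simps)
      then show ?case using add[OF step1(2) z] by simp
    next
      case (step2 c)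
      have "(\<lambda>t. (if t = (0::nat) then c * z else 0) - (if t = 0 then z else 0)) = (\<lambda>t. if t = 0 then (c - 1) * z else 0)"
        by (auto simp: algebra_simps)
      then show ?case using diff[OF step2(2) z] by simp
    qed
    have "(\<lambda>t. int p * (if t = (0::nat) then u else 0) + (if t = 0 then v * z else 0)) = (\<lambda>t. if t = 0 then 1 else 0)"
      using uv by (auto simp: mult.commute)
    then have "(\<lambda>t. if t = 0 then 1 else 0) \<in> L"
      using add[OF pL[of "\<lambda>t. if t = 0 then u else 0"] mult[of v]] by simp
    then have "D (\<lambda>t. if t = 0 then 1 else 0) \<in> K" by (simp add: L_def)
    moreover have "D (\<lambda>t. if t = 0 then 1 else 0) = X 0 l F"
      unfolding D_def using l by (intro eq_matI) (auto simp: colmat_def X_index)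
    ultimately have "X 0 l F \<in> K" by (simp only:)
    then show False using g(2) unfolding K_def by blast
  qed
  have "l - 1 < k" "\<forall>z. (\<lambda>t. if t = 0 then z else 0) \<in> L \<longrightarrow> int p dvd z" using l e0 by auto
  from dual_transversals[OF p this(2,1)]
  obtain S C where SC: "finite S" "finite C" "card S * card C = p ^ Suc (l - 1)"
    and S0: "\<forall>a\<in>S. a 0 = 0 \<and> (\<forall>t>l - 1. a t = 0)"
    and C0: "\<forall>c\<in>C. \<forall>t>l - 1. c t = 0"
    and sepC: "\<forall>c\<in>C. \<forall>c'\<in>C. (\<lambda>t. c t - c' t) \<in> L \<longrightarrow> c = c'"
    and sepS: "\<forall>a\<in>S. \<forall>a'\<in>S. (\<forall>c\<in>L. (\<forall>t>l - 1. c t = 0) \<longrightarrow> int p dvd (\<Sum>t<k. (a t - a' t) * c t)) \<longrightarrow> a = a'"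
    by (elim exE conjE) (rule that)
  define u where "u x = D (snd x) * rowmat (fst x)" for x
  have uS [simp]: "u x \<in> carrier (SL k)" for x unfolding u_def by simp
  have key: "x = x'" if x: "x \<in> S \<times> C" "x' \<in> S \<times> C" and K': "u x * inv\<^bsub>SL k\<^esub> u x' \<in> K" for x x'
  proof -
    obtain a c where xe: "x = (a, c)" "a \<in> S" "c \<in> C" using x(1) by blast
    obtain a' c' where xe': "x' = (a', c')" "a' \<in> S" "c' \<in> C" using x(2) by blast
    define b where "b t = a t - a' t" for t
    have "l - 1 < l" using l by simp
    then have b0: "b 0 = 0" "b l = 0" using bspec[OF S0 xe(2)] bspec[OF S0 xe'(2)] by (simp_all add: b_def)
    have a0: "a 0 = 0" "a' 0 = 0" using bspec[OF S0 xe(2)] bspec[OF S0 xe'(2)] by simp_all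
    define y where "y = D c * rowmat b * D (\<lambda>t. - c' t)"
    have yS: "y \<in> carrier (SL k)" unfolding y_def by simp
    have yK: "y \<in> K"
    proof -
      have "inv\<^bsub>SL k\<^esub> u x' = inv\<^bsub>SL k\<^esub> rowmat a' * inv\<^bsub>SL k\<^esub> D c'"
        using inv_mult_group[of "D c'" "rowmat a'"] by (simp add: u_def xe')
      also have "\<dots> = rowmat (\<lambda>t. - a' t) * D (\<lambda>t. - c' t)"
        using rowmat_inv[of a', OF a0(2)] D_inv by simp
      finally have "u x * inv\<^bsub>SL k\<^esub> u x' = D c * (rowmat a * rowmat (\<lambda>t. - a' t)) * D (\<lambda>t. - c' t)"
        by (simp add: u_def xe SL_assoc)
      also have "rowmat a * rowmat (\<lambda>t. - a' t) = rowmat b"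
        using rowmat_add[of a "\<lambda>t. - a' t"] a0 by (simp add: b_def[abs_def])
      finally show ?thesis using K' by (simp add: y_def)
    qed
    have "int p dvd (\<Sum>t<k. b t * c1 t)" if c1: "c1 \<in> L" for c1
    proof -
      \<comment> \<open>Conjugation by \<open>y\<close> changes a vector of \<open>L\<close> only by
        \<open>?s\<close> in coordinate 0. Hence \<open>L\<close> contains \<open>?s\<close> times
        the first basis vector, and \<open>e0\<close> applies.\<close>
      let ?s = "\<Sum>t<k. b t * c1 t"
      let ?c2 = "\<lambda>t. c1 t + (if t = 0 then ?s else 0)"
      have rc: "rowmat b * D c1 = D ?c2 * rowmat b"
      proof -
        have "(\<lambda>r. F * c1 r + (if r = 0 then \<Sum>t<k. b t * (F * c1 t) else 0)) = (\<lambda>t. F * ?c2 t)"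
          by (auto simp: sum_distrib_left algebra_simps)
        then show ?thesis unfolding D_def using rowmat_colmat[OF b0 l(1,2), of "\<lambda>t. F * c1 t"] by simp
      qed
      have "y * D c1 = D c * rowmat b * (D (\<lambda>t. - c' t) * D c1)" unfolding y_def by (simp add: SL_assoc)
      also have "D (\<lambda>t. - c' t) * D c1 = D c1 * D (\<lambda>t. - c' t)" by (simp add: D_add add.commute)
      also have "D c * rowmat b * (D c1 * D (\<lambda>t. - c' t)) = D c * (rowmat b * D c1) * D (\<lambda>t. - c' t)" by (simp add: SL_assoc)
      also have "\<dots> = (D c * D ?c2) * rowmat b * D (\<lambda>t. - c' t)" unfolding rc by (simp add: SL_assoc)
      also have "D c * D ?c2 = D ?c2 * D c" by (simp add: D_add add.commute)
      also have "D ?c2 * D c * rowmat b * D (\<lambda>t. - c' t) = D ?c2 * y" unfolding y_def by (simp add: SL_assoc)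
      finally have "D ?c2 = y * D c1 * inv\<^bsub>SL k\<^esub> y" using yS by (simp add: SL_assoc)
      also have "\<dots> \<in> K" using Kmult yK K.m_inv_closed[OF yK] c1 by (simp add: L_def)
      finally have "?c2 \<in> L" by (simp add: L_def)
      from diff[OF this c1] have "(\<lambda>t. if t = 0 then ?s else 0) \<in> L" by simp
      then show ?thesis by (rule e0)
    qed
    then have aa: "a = a'"
      using bspec[OF bspec[OF sepS xe(2)] xe'(2)] unfolding b_def by blast
    then have "b = (\<lambda>_. 0)" by (auto simp: b_def)
    then have "y = D (\<lambda>t. c t - c' t)" unfolding y_def by (simp add: rowmat_0 D_add)
    then have "(\<lambda>t. c t - c' t) \<in> L" using yK unfolding L_def by simp
    then have "c = c'" using bspec[OF bspec[OF sepC xe(3)] xe'(3)] by blast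
    then show ?thesis using aa by (simp add: xe xe')
  qed
  \<comment> \<open>Left multiplication by \<open>g\<close> turns elements in distinct right cosets
    of \<open>K\<close> into elements in distinct right cosets of \<open>H\<close>.\<close>
  let ?P = "(\<lambda>x. g * u x) ` (S \<times> C)"
  have inj: "inj_on (\<lambda>x. g * u x) (S \<times> C)"
  proof (rule inj_onI)
    fix x x' assume x: "x \<in> S \<times> C" "x' \<in> S \<times> C" "g * u x = g * u x'"
    have "inv\<^bsub>SL k\<^esub> g * (g * u z) = u z" for z using g(1) by (simp flip: SL_assoc)
    then have "u x = u x'" using x(3) by metis
    then have "u x * inv\<^bsub>SL k\<^esub> u x' \<in> K" using K.one_closed by simp
    then show "x = x'" by (rule key[OF x(1,2)])
  qed
  have "of_nat (card ?P) \<le> subgroup_index (SL k) H"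
  proof (rule card_le_subgroup_index[OF H])
    show "?P \<subseteq> carrier (SL k)" using g(1) by auto
    fix w w' assume w: "w \<in> ?P" "w' \<in> ?P" "w \<otimes>\<^bsub>SL k\<^esub> inv\<^bsub>SL k\<^esub> w' \<in> H"
    obtain x where x: "x \<in> S \<times> C" "w = g * u x" using w(1) by blast
    obtain x' where x': "x' \<in> S \<times> C" "w' = g * u x'" using w(2) by blast
    have "g * (u x * inv\<^bsub>SL k\<^esub> u x') * inv\<^bsub>SL k\<^esub> g = w * inv\<^bsub>SL k\<^esub> w'"
      using inv_mult_group[of g "u x'"] g(1) by (simp add: x x' SL_assoc)
    then have "g * (u x * inv\<^bsub>SL k\<^esub> u x') * inv\<^bsub>SL k\<^esub> g \<in> H" using w(3) by (simp only: SL_mult)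
    moreover have "u x * inv\<^bsub>SL k\<^esub> u x' \<in> carrier (SL k)" by simp
    ultimately have "u x * inv\<^bsub>SL k\<^esub> u x' \<in> K" unfolding K_def by blast
    from key[OF x(1) x'(1) this] show "w = w'" unfolding x(2) x'(2) by (rule arg_cong)
  qed
  moreover have "card ?P = p ^ (k - 1)"
  proof -
    have "Suc (l - 1) = k - 1" using l by (simp add: l_def)
    then show ?thesis using card_image[OF inj] SC(3) by (simp only: card_cartesian_product)
  qed
  ultimately show ?thesis by simp
qed

section \<open>The level of a subgroup of finite index\<close>

text \<open>The hypothesis on \<open>x\<close> bounds the primes dividing the level \<open>m\<close>
  of the core: for such a prime it is applied to F = m / p. Smoothness passes from \<open>m\<close>
  to its divisors \<open>t\<close>, each of which is also at most \<open>n\<close>.\<close>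

theorem E_subset_of_index:
  assumes H: "subgroup H (SL k)" and n: "n > 0" "subgroup_index (SL k) H \<le> of_nat n"
    and x: "\<And>p F. prime (p::nat) \<Longrightarrow> X 0 1 (int p * F) \<in> core H \<Longrightarrow> X 0 1 F \<notin> core H \<Longrightarrow> p \<le> x"
  shows "E (int (smooth_lcm x n)) \<subseteq> H"
proof -
  interpret N: normal "core H" "SL k" by (rule core_normal[OF H])
  interpret H: subgroup H "SL k" by fact
  have k1: "0 < k" "1 < k" using k_ge_3 by auto
  have XS [simp]: "X 0 1 a \<in> carrier (SL k)" for a by simp
  define I where "I g = {a. g * X 0 1 a * inv\<^bsub>SL k\<^esub> g \<in> H}" for g
  have Idiff: "a - b \<in> I g" if "g \<in> carrier (SL k)" "a \<in> I g" "b \<in> I g" for a b g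
  proof -
    have "g * X 0 1 (a - b) * inv\<^bsub>SL k\<^esub> g = (g * X 0 1 a * inv\<^bsub>SL k\<^esub> g) * inv\<^bsub>SL k\<^esub> (g * X 0 1 b * inv\<^bsub>SL k\<^esub> g)"
      using conj_inv[OF that(1), of "X 0 1 b"] conj_mult[OF that(1), of "X 0 1 a" "X 0 1 (- b)"] k1
      by (simp add: X_inv X_add)
    then show ?thesis using that H.m_closed H.m_inv_closed by (simp add: I_def)
  qed
  have ex: "\<exists>s>0. s \<le> n \<and> int s \<in> I g" if g: "g \<in> carrier (SL k)" for g
  proof (rule ccontr)
    assume no: "\<not> (\<exists>s>0. s \<le> n \<and> int s \<in> I g)"
    \<comment> \<open>Pigeonhole: if no such s existed, the n + 1 elements with argument 0, ..., n
      would lie in distinct cosets.\<close>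
    let ?w = "\<lambda>a. g * X 0 1 (int a)"
    have d: "a = b" if ab: "a \<le> n" "b \<le> n" "?w a * inv\<^bsub>SL k\<^esub> ?w b \<in> H" for a b :: nat
    proof -
      have "?w a * inv\<^bsub>SL k\<^esub> ?w b = g * (X 0 1 (int a) * X 0 1 (- int b)) * inv\<^bsub>SL k\<^esub> g"
        using inv_mult_group[of g "X 0 1 (int b)"] g k1 by (simp add: SL_assoc X_inv)
      then have in1: "int a - int b \<in> I g" using ab(3) k1 by (simp add: I_def X_add)
      have "0 \<in> I g" using Idiff[OF g in1 in1] by simp
      then have in2: "int b - int a \<in> I g" using Idiff[OF g _ in1, of 0] by simp
      show ?thesis
      proof (rule ccontr)
        assume "a \<noteq> b"
        then consider "a < b" | "b < a" by linarith
        then show False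
        proof cases
          case 1
          then show False using no in2 ab by (auto simp: of_nat_diff dest!: spec[of _ "b - a"])
        next
          case 2
          then show False using no in1 ab by (auto simp: of_nat_diff dest!: spec[of _ "a - b"])
        qed
      qed
    qed
    have inj: "inj_on ?w {..n}"
    proof (rule inj_onI)
      fix a b assume ab: "a \<in> {..n}" "b \<in> {..n}" "?w a = ?w b"
      then have "?w a * inv\<^bsub>SL k\<^esub> ?w b = 1\<^sub>m k" using g by simp
      then have "?w a * inv\<^bsub>SL k\<^esub> ?w b \<in> H" using H.one_closed by simp
      then show "a = b" using d ab by simp
    qed
    have "of_nat (card (?w ` {..n})) \<le> subgroup_index (SL k) H"
      by (rule card_le_subgroup_index[OF H]) (use d g in auto)
    then have "of_nat (Suc n) \<le> subgroup_index (SL k) H" using card_image[OF inj] by simp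
    from order_trans[OF this n(2)] have "Suc n \<le> n" by (simp only: of_nat_le_iff)
    then show False by simp
  qed
  let ?J = "{a. X 0 1 a \<in> core H}"
  have J: "a \<in> ?J \<longleftrightarrow> (\<forall>g\<in>carrier (SL k). a \<in> I g)" for a
    unfolding core_def I_def using XS by blast
  have gen: "\<exists>t>0. t \<le> n \<and> (\<forall>a. a \<in> I g \<longleftrightarrow> int t dvd a)" if g: "g \<in> carrier (SL k)" for g
  proof -
    obtain s where s: "0 < s" "s \<le> n" "int s \<in> I g" using ex[OF g] by blast
    obtain t where "0 < t" "t \<le> s" "\<And>a. a \<in> I g \<longleftrightarrow> int t dvd a"
      using int_subgroup_generator[OF Idiff[OF g] s(1,3)] by blast
    then show ?thesis using s(2) by (intro exI[of _ t]) auto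
  qed
  \<comment> \<open>n! is a common multiple of all the \<open>t\<close>, which shows that the core
    has a positive level.\<close>
  have "int (fact n) \<in> ?J"
    unfolding J
  proof
    fix g assume "g \<in> carrier (SL k)"
    then obtain t where t: "0 < t" "t \<le> n" "\<And>a. a \<in> I g \<longleftrightarrow> int t dvd a" using gen by blast
    have "t dvd fact n" using t by (intro dvd_fact) auto
    then have "int t dvd int (fact n)" by (simp only: of_nat_dvd_iff)
    then show "int (fact n) \<in> I g" using t(3) by blast
  qed
  moreover have "a - b \<in> ?J" if "a \<in> ?J" "b \<in> ?J" for a b
    using that Idiff unfolding J by blast
  ultimately obtain m where m: "0 < m" "\<And>a. a \<in> ?J \<longleftrightarrow> int m dvd a"
    using int_subgroup_generator[of ?J "fact n"] fact_gt_zero by metis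
  have mx: "p \<le> x" if pm: "prime p" "p dvd m" for p
  proof -
    obtain F where F: "m = p * F" using pm(2) by (elim dvdE)
    have F0: "0 < F" using m(1) F by (cases F) auto
    have "X 0 1 (int p * int F) \<in> core H" using m(2)[of "int m"] F by simp
    moreover have "\<not> int m dvd int F"
    proof
      assume "int m dvd int F"
      then have "m \<le> F" using F0 by (simp add: dvd_imp_le)
      then show False using F F0 prime_gt_1_nat[OF pm(1)] by simp
    qed
    then have "X 0 1 (int F) \<notin> core H" using m(2)[of "int F"] by simp
    ultimately show ?thesis by (rule x[OF pm(1)])
  qed
  have "int (smooth_lcm x n) \<in> ?J"
    unfolding J
  proof
    fix g assume g: "g \<in> carrier (SL k)"
    then obtain t where t: "0 < t" "t \<le> n" "\<And>a. a \<in> I g \<longleftrightarrow> int t dvd a" using gen by blast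
    have "int m \<in> ?J" using m(2) by simp
    then have "int t dvd int m" using t(3) g unfolding J by blast
    then have tm: "t dvd m" by (simp only: of_nat_dvd_iff)
    have "t dvd smooth_lcm x n"
    proof (rule dvd_smooth_lcm[OF t(1,2)])
      fix p :: nat assume p: "prime p" "p dvd t"
      show "p \<le> x" by (rule mx[OF p(1) dvd_trans[OF p(2) tm]])
    qed
    then have "int t dvd int (smooth_lcm x n)" by (simp only: of_nat_dvd_iff)
    then show "int (smooth_lcm x n) \<in> I g" using t(3) by blast
  qed
  then have "X 0 1 (int (smooth_lcm x n)) \<in> core H" by (rule CollectD)
  from subset_trans[OF E_subset[OF core_normal[OF H] this] core_subset] show ?thesis .
qed

section \<open>Maximal subgroups attached to primes\<close>

lemma X_in_Gam: "X 0 1 m \<in> Gam m"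
  using X_E[of 0 1 m 1] E_Gam k_ge_3 by auto

lemma normal_with_X:
  assumes N: "N \<lhd> SL k" and X: "X 0 1 1 \<in> N" shows "N = carrier (SL k)"
proof -
  interpret N: normal N "SL k" by fact
  have Xa: "X i j a \<in> N" if "i < k" "j < k" "i \<noteq> j" for i j a
  proof -
    have "X i j 1 \<in> N" using normal_X_transfer[OF N X, of i j] that k_ge_3 by auto
    then show ?thesis using normal_X_mult[OF N, of i j 1 a] that by simp
  qed
  have "A \<in> N" if "A \<in> carrier (SL k)" for A
  proof -
    have "A \<in> elem k" using block_elem[of k A] that k_ge_3 by (auto simp: block_def)
    then show ?thesis using elem_subgroup[OF N.subgroup_axioms, of k A] Xa by blast
  qed
  then show ?thesis using N.subset by blast
qed

text \<open>The arguments of elementary matrices in \<open>N\<close> at a fixed position form an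
  ideal. With pF and, for \<open>a\<close> prime to \<open>p\<close>, also aF, it would contain F by
  Bezout.\<close>

lemma normal_level:
  assumes p: "prime (p::nat)" and N: "N \<lhd> SL k" and F: "X 0 1 (int p * F) \<in> N" "X 0 1 F \<notin> N" and a: "X 0 1 a \<in> N"
  shows "int p dvd a"
proof (rule ccontr)
  assume "\<not> int p dvd a"
  then have "coprime (int p) a" using p by (metis prime_imp_coprime prime_nat_int_transfer)
  then obtain u v where uv: "u * int p + v * a = 1"
    using bezout_int[of "int p" a] by (metis coprime_imp_gcd_eq_1)
  interpret N: normal N "SL k" by (rule N)
  have k1: "0 < k" "1 < k" "(0::nat) \<noteq> 1" using k_ge_3 by auto
  have "X 0 1 (int p * F * u) \<in> N" "X 0 1 (a * (v * F)) \<in> N"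
    using normal_X_mult[OF N F(1) k1(3,1,2)] normal_X_mult[OF N a k1(3,1,2)] by blast+
  then have "X 0 1 (int p * F * u) * X 0 1 (a * (v * F)) \<in> N" using N.m_closed by simp
  moreover have "int p * F * u + a * (v * F) = F" using arg_cong[OF uv, of "\<lambda>x. x * F"] by (simp add: algebra_simps)
  ultimately have "X 0 1 F \<in> N" using k1 by (simp add: X_add)
  then show False using F(2) by blast
qed

lemma proper_normal_level:
  assumes "prime (p::nat)" "N \<lhd> SL k" "N \<noteq> carrier (SL k)" "X 0 1 (int p) \<in> N" "X 0 1 a \<in> N"
  shows "int p dvd a"
  using normal_level[of p N 1 a] normal_with_X assms by auto

section \<open>Indices of congruence subgroups and of line stabilizers\<close>

text \<open>The determinant saves one of the k * k residues: some cofactor of column 0 is a unit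
  modulo p, and the entry in its place is determined by the others. The factor \<open>k\<close>
  counts the possible places.\<close>

lemma index_Gam:
  assumes p: "prime (p::nat)"
  shows "finite (rcosets\<^bsub>SL k\<^esub> Gam (int p))" "subgroup_index (SL k) (Gam (int p)) \<le> of_nat (k * p ^ (k * k - 1))"
proof -
  interpret Gm: normal "Gam (int p)" "SL k" by (rule Gam_normal)
  have k0: "0 < k" using k_ge_3 by simp
  let ?I = "{..<k} \<times> {..<k}"
  define piv where "piv A = (SOME i. i < k \<and> \<not> int p dvd cofactor A i 0)" for A :: "int mat"
  have piv: "piv A < k \<and> \<not> int p dvd cofactor A (piv A) 0" if A: "A \<in> carrier (SL k)" for A
    unfolding piv_def
  proof (rule someI_ex, rule ccontr)
    assume "\<not> (\<exists>i. i < k \<and> \<not> int p dvd cofactor A i 0)"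
    then have "int p dvd (\<Sum>i<k. A $$ (i, 0) * cofactor A i 0)" by (intro dvd_sum) auto
    then have "int p dvd 1"
      using laplace_expansion_column[OF SL_mat[OF A] k0] A by (simp add: SL_carrier)
    then show False using prime_gt_1_nat[OF p] by simp
  qed
  define f where "f A = (piv A, \<lambda>ij\<in>?I - {(piv A, 0)}. A $$ ij mod int p)" for A :: "int mat"
  let ?F = "SIGMA i:{..<k}. (?I - {(i, 0)}) \<rightarrow>\<^sub>E {0..<int p}"
  have fin: "finite ?F" by (intro finite_SigmaI finite_PiE) auto
  have sub: "f ` carrier (SL k) \<subseteq> ?F"
    using piv prime_gt_0_nat[OF p] by (auto simp: f_def split: if_splits)
  have key: "mat_cong (int p) A B" if A: "A \<in> carrier (SL k)" and B: "B \<in> carrier (SL k)" and fAB: "f A = f B" for A B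
  proof -
    define i where "i = piv A"
    have i: "i < k" "\<not> int p dvd cofactor A i 0" using piv[OF A] by (auto simp: i_def)
    have pB: "piv B = i" using fAB by (simp add: f_def i_def)
    have eq: "[A $$ (r, c) = B $$ (r, c)] (mod int p)" if rc: "r < k" "c < k" "(r, c) \<noteq> (i, 0)" for r c
    proof -
      have "(\<lambda>ij\<in>?I - {(i, 0)}. A $$ ij mod int p) = (\<lambda>ij\<in>?I - {(i, 0)}. B $$ ij mod int p)"
        using fAB pB by (simp add: f_def i_def)
      from fun_cong[OF this, of "(r, c)"] show ?thesis using rc by (simp add: unique_euclidean_semiring_class.cong_def)
    qed
    \<comment> \<open>Cofactors of column 0 involve only the other columns, where all residues
      agree.\<close>
    have cof: "[cofactor A r 0 = cofactor B r 0] (mod int p)" if r: "r < k" for r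
      unfolding cofactor_def
    proof (intro cong_mult cong_refl det_cong[of _ "k - 1"])
      fix a b assume ab: "a < k - 1" "b < k - 1"
      then show "[mat_delete A r 0 $$ (a, b) = mat_delete B r 0 $$ (a, b)] (mod int p)"
        using SL_mat[OF A] SL_mat[OF B] r by (auto simp: mat_delete_def intro!: eq)
    qed (use SL_mat[OF A] SL_mat[OF B] in \<open>auto intro!: mat_delete_carrier\<close>)
    let ?s = "\<lambda>A :: int mat. \<Sum>r\<in>{..<k} - {i}. A $$ (r, 0) * cofactor A r 0"
    have det: "A $$ (i, 0) * cofactor A i 0 + ?s A = 1" if "A \<in> carrier (SL k)" for A
    proof -
      have "det A = (\<Sum>r<k. A $$ (r, 0) * cofactor A r 0)"
        using laplace_expansion_column[OF SL_mat[OF that] k0] .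
      also have "\<dots> = A $$ (i, 0) * cofactor A i 0 + ?s A" using i by (subst sum.remove[of _ i]) auto
      finally show ?thesis using that by (simp add: SL_carrier)
    qed
    have s: "[?s A = ?s B] (mod int p)" by (intro cong_sum cong_mult eq cof) (use k0 in auto)
    have "[A $$ (i, 0) * cofactor A i 0 + ?s A = B $$ (i, 0) * cofactor B i 0 + ?s B] (mod int p)"
      using det[OF A] det[OF B] by simp
    then have "[A $$ (i, 0) * cofactor A i 0 = B $$ (i, 0) * cofactor B i 0] (mod int p)"
      using cong_diff[OF _ s] by fastforce
    also have "[B $$ (i, 0) * cofactor B i 0 = B $$ (i, 0) * cofactor A i 0] (mod int p)"
      by (intro cong_mult cong_refl cong_sym[OF cof] i)
    finally have "int p dvd (A $$ (i, 0) - B $$ (i, 0)) * cofactor A i 0"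
      by (simp add: cong_iff_dvd_diff left_diff_distrib)
    then have "int p dvd A $$ (i, 0) - B $$ (i, 0)"
      using i(2) p by (metis prime_dvd_multD prime_nat_int_transfer)
    then have "[A $$ (i, 0) = B $$ (i, 0)] (mod int p)" by (simp add: cong_iff_dvd_diff)
    then show ?thesis using eq unfolding mat_cong_def by blast
  qed
  have inj: "A \<otimes>\<^bsub>SL k\<^esub> inv\<^bsub>SL k\<^esub> B \<in> Gam (int p)" if "A \<in> carrier (SL k)" "B \<in> carrier (SL k)" "f A = f B" for A B
    using Gam_iff_mat_cong[OF that(1,2)] key[OF that] by simp
  have "card ?F = (\<Sum>i<k. p ^ (k * k - 1))"
    by (subst card_SigmaI) (auto intro!: sum.cong finite_PiE simp: card_PiE card_Diff_singleton k0)
  then have cF: "card ?F = k * p ^ (k * k - 1)" by simp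
  show "finite (rcosets\<^bsub>SL k\<^esub> Gam (int p))"
    by (rule subgroup_index_le_card(1)[OF Gm.subgroup_axioms fin sub inj])
  show "subgroup_index (SL k) (Gam (int p)) \<le> of_nat (k * p ^ (k * k - 1))"
    unfolding cF[symmetric] by (rule subgroup_index_le_card(2)[OF Gm.subgroup_axioms fin sub inj])
qed

text \<open>The stabilizer, modulo \<open>p\<close>, of the line spanned by the first unit row
  vector, with matrices acting on rows from the right.\<close>

definition Par :: "nat \<Rightarrow> int mat set" where
  "Par p = {A \<in> carrier (SL k). \<forall>j<k. 0 < j \<longrightarrow> int p dvd A $$ (0, j)}"

lemma Par_row_cong:
  assumes "A \<in> carrier (SL k)" "B \<in> carrier (SL k)" "\<And>j. j < k \<Longrightarrow> [A $$ (0, j) = \<mu> * B $$ (0, j)] (mod int p)"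
  shows "A * inv\<^bsub>SL k\<^esub> B \<in> Par p"
proof -
  have k0: "0 < k" using k_ge_3 by simp
  let ?R = "inv\<^bsub>SL k\<^esub> B"
  have R: "?R \<in> carrier (SL k)" using assms by simp
  have "int p dvd (A * ?R) $$ (0, j)" if j: "j < k" "0 < j" for j
  proof -
    have "(A * ?R) $$ (0, j) = (\<Sum>t<k. A $$ (0, t) * ?R $$ (t, j))"
      by (rule mult_entry[OF SL_mat[OF assms(1)] SL_mat[OF R] k0 j(1)])
    also have "[\<dots> = (\<Sum>t<k. \<mu> * B $$ (0, t) * ?R $$ (t, j))] (mod int p)"
      by (intro cong_sum cong_mult assms(3) cong_refl) auto
    also have "(\<Sum>t<k. \<mu> * B $$ (0, t) * ?R $$ (t, j)) = \<mu> * (B * ?R) $$ (0, j)"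
      unfolding mult_entry[OF SL_mat[OF assms(2)] SL_mat[OF R] k0 j(1)] by (simp add: sum_distrib_left mult.assoc)
    also have "(B * ?R) $$ (0, j) = 0" using assms(2) j k0 by simp
    finally show ?thesis by (simp add: cong_0_iff)
  qed
  then show ?thesis using assms R by (simp add: Par_def)
qed

lemma row_not_dvd:
  assumes p: "prime (p::nat)" and A: "A \<in> carrier (SL k)" shows "\<exists>i<k. \<not> int p dvd A $$ (0, i)"
proof (rule ccontr)
  assume no: "\<not> (\<exists>i<k. \<not> int p dvd A $$ (0, i))"
  have k0: "0 < k" using k_ge_3 by simp
  have "det A = (\<Sum>j<k. A $$ (0, j) * cofactor A 0 j)" using laplace_expansion_row[OF SL_mat[OF A] k0] .
  also have "int p dvd \<dots>" using no by (intro dvd_sum) auto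
  finally show False using A prime_gt_1_nat[OF p] by (simp add: SL_carrier)
qed

lemma Par_subgroup: assumes p: "prime (p::nat)" shows "subgroup (Par p) (SL k)"
proof (rule subgroupI)
  have k0: "0 < k" using k_ge_3 by simp
  show "Par p \<subseteq> carrier (SL k)" by (auto simp: Par_def)
  show "Par p \<noteq> {}"
  proof -
    have "1\<^sub>m k \<in> Par p" using k0 by (simp add: Par_def)
    then show ?thesis by blast
  qed
  fix A assume A: "A \<in> Par p"
  then have AS: "A \<in> carrier (SL k)" by (simp add: Par_def)
  have "\<not> int p dvd A $$ (0, 0)"
    using row_not_dvd[OF p AS] A by (auto simp: Par_def)
  then have "coprime (A $$ (0, 0)) (int p)"
    using p by (metis coprime_commute prime_imp_coprime prime_nat_int_transfer)
  then obtain s where s: "[A $$ (0, 0) * s = 1] (mod int p)" using cong_solve_coprime_int by blast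
  have "1\<^sub>m k * inv\<^bsub>SL k\<^esub> A \<in> Par p"
  proof (rule Par_row_cong[OF _ AS])
    fix j assume j: "j < k"
    show "[1\<^sub>m k $$ (0, j) = s * A $$ (0, j)] (mod int p)"
    proof (cases "j = 0")
      case True
      then show ?thesis using cong_sym[OF s] k0 by (simp add: mult.commute)
    next
      case False
      then have "int p dvd s * A $$ (0, j)" using A j by (simp add: Par_def)
      then have "[s * A $$ (0, j) = 0] (mod int p)" by (simp add: cong_0_iff)
      then show ?thesis using False j k0 by (simp add: cong_sym)
    qed
  qed simp
  then show "inv\<^bsub>SL k\<^esub> A \<in> Par p" using AS by simp
next
  fix A B assume A: "A \<in> Par p" and B: "B \<in> Par p"
  then have S: "A \<in> carrier (SL k)" "B \<in> carrier (SL k)" by (simp_all add: Par_def)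
  have k0: "0 < k" using k_ge_3 by simp
  have "int p dvd (A * B) $$ (0, j)" if j: "j < k" "0 < j" for j
    unfolding mult_entry[OF SL_mat[OF S(1)] SL_mat[OF S(2)] k0 j(1)]
  proof (rule dvd_sum)
    fix t assume "t \<in> {..<k}"
    then show "int p dvd A $$ (0, t) * B $$ (t, j)"
      using A B j by (cases "t = 0") (auto simp: Par_def)
  qed
  then show "A \<otimes>\<^bsub>SL k\<^esub> B \<in> Par p" using S by (simp add: Par_def)
qed

text \<open>A coset corresponds to a point of projective space over Z/p, recorded by the place of a
  unit entry of the first row and by the other entries after that one is normalised to 1.\<close>

lemma index_Par:
  assumes p: "prime (p::nat)"
  shows "finite (rcosets\<^bsub>SL k\<^esub> Par p)" "subgroup_index (SL k) (Par p) \<le> of_nat (k * p ^ (k - 1))"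
proof -
  have k0: "0 < k" using k_ge_3 by simp
  define piv where "piv A = (SOME i. i < k \<and> \<not> int p dvd A $$ (0, i))" for A :: "int mat"
  have piv: "piv A < k \<and> \<not> int p dvd A $$ (0, piv A)" if A: "A \<in> carrier (SL k)" for A
    unfolding piv_def by (rule someI_ex) (use row_not_dvd[OF p A] in blast)
  define s where "s A = (SOME s. [A $$ (0, piv A) * s = 1] (mod int p))" for A :: "int mat"
  have s: "[A $$ (0, piv A) * s A = 1] (mod int p)" if A: "A \<in> carrier (SL k)" for A
    unfolding s_def
  proof (rule someI_ex)
    have "coprime (A $$ (0, piv A)) (int p)"
      using piv[OF A] p by (metis coprime_commute prime_imp_coprime prime_nat_int_transfer)
    then show "\<exists>s. [A $$ (0, piv A) * s = 1] (mod int p)" by (rule cong_solve_coprime_int)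
  qed
  define f where "f A = (piv A, \<lambda>j\<in>{..<k} - {piv A}. A $$ (0, j) * s A mod int p)" for A :: "int mat"
  let ?F = "SIGMA i:{..<k}. ({..<k} - {i}) \<rightarrow>\<^sub>E {0..<int p}"
  have fin: "finite ?F" by (intro finite_SigmaI finite_PiE) auto
  have sub: "f ` carrier (SL k) \<subseteq> ?F"
    using piv prime_gt_0_nat[OF p] by (auto simp: f_def split: if_splits)
  have inj: "A \<otimes>\<^bsub>SL k\<^esub> inv\<^bsub>SL k\<^esub> B \<in> Par p" if AB: "A \<in> carrier (SL k)" "B \<in> carrier (SL k)" "f A = f B" for A B
  proof -
    define i where "i = piv A"
    have pB: "piv B = i" using AB(3) by (simp add: f_def i_def)
    have sA: "[A $$ (0, i) * s A = 1] (mod int p)" and sB: "[B $$ (0, i) * s B = 1] (mod int p)"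
      using s[OF AB(1)] s[OF AB(2)] pB by (simp_all add: i_def)
    have eq: "[A $$ (0, j) * s A = B $$ (0, j) * s B] (mod int p)" if j: "j < k" for j
    proof (cases "j = i")
      case True
      then show ?thesis using cong_trans[OF sA cong_sym[OF sB]] by simp
    next
      case False
      have "(\<lambda>j\<in>{..<k} - {i}. A $$ (0, j) * s A mod int p) = (\<lambda>j\<in>{..<k} - {i}. B $$ (0, j) * s B mod int p)"
        using AB(3) pB by (simp add: f_def i_def)
      from fun_cong[OF this, of j] show ?thesis using j False by (simp add: unique_euclidean_semiring_class.cong_def)
    qed
    have "[A $$ (0, j) = (s B * A $$ (0, i)) * B $$ (0, j)] (mod int p)" if j: "j < k" for j
    proof -
      have "[A $$ (0, j) * 1 = A $$ (0, j) * (A $$ (0, i) * s A)] (mod int p)"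
        by (intro cong_mult cong_refl cong_sym[OF sA])
      also have "A $$ (0, j) * (A $$ (0, i) * s A) = A $$ (0, i) * (A $$ (0, j) * s A)" by simp
      also have "[\<dots> = A $$ (0, i) * (B $$ (0, j) * s B)] (mod int p)"
        by (intro cong_mult cong_refl eq j)
      finally show ?thesis by (simp add: mult_ac)
    qed
    from Par_row_cong[OF AB(1,2) this] show ?thesis by simp
  qed
  have "card ?F = (\<Sum>i<k. p ^ (k - 1))"
    by (subst card_SigmaI) (auto intro!: sum.cong finite_PiE simp: card_PiE card_Diff_singleton)
  then have cF: "card ?F = k * p ^ (k - 1)" by simp
  show "finite (rcosets\<^bsub>SL k\<^esub> Par p)"
    by (rule subgroup_index_le_card(1)[OF Par_subgroup[OF p] fin sub inj])
  show "subgroup_index (SL k) (Par p) \<le> of_nat (k * p ^ (k - 1))"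
    unfolding cF[symmetric] by (rule subgroup_index_le_card(2)[OF Par_subgroup[OF p] fin sub inj])
qed

section \<open>Maximal subgroups attached to a prime and the resulting lower bounds\<close>

lemma ex_maximal_normal:
  assumes p: "prime (p::nat)"
  shows "\<exists>M. maximal_normal_subgroup M (SL k) \<and> subgroup_index (SL k) M \<le> of_nat (k * p ^ (k * k - 1)) \<and>
    (\<forall>a. X 0 1 a \<in> M \<longrightarrow> int p dvd a)"
proof -
  have "X 0 1 1 \<notin> Gam (int p)"
  proof
    assume "X 0 1 1 \<in> Gam (int p)"
    then have "int p dvd X 0 1 1 $$ (0, 1)" using Gam_entry(1)[of "X 0 1 1" "int p" 0 1] k_ge_3 by auto
    then show False using k_ge_3 prime_gt_1_nat[OF p] by (simp add: X_index)
  qed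
  moreover have "X 0 1 1 \<in> carrier (SL k)" by simp
  ultimately have "Gam (int p) \<noteq> carrier (SL k)" by blast
  from ex_maximal_normal_subgroup[OF Gam_normal this index_Gam(1)[OF p]]
  obtain M where M: "maximal_normal_subgroup M (SL k)" "Gam (int p) \<subseteq> M" by blast
  then have MN: "M \<lhd> SL k" "M \<noteq> carrier (SL k)" by (simp_all add: maximal_normal_subgroup_def)
  have "subgroup_index (SL k) M \<le> subgroup_index (SL k) (Gam (int p))"
    by (intro subgroup_index_antimono normal_imp_subgroup Gam_normal MN M)
  then have "subgroup_index (SL k) M \<le> of_nat (k * p ^ (k * k - 1))" using index_Gam(2)[OF p] by (rule order_trans)
  moreover have "\<forall>a. X 0 1 a \<in> M \<longrightarrow> int p dvd a"
    using proper_normal_level[OF p MN] M(2) X_in_Gam by blast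
  ultimately show ?thesis using M(1) by blast
qed

text \<open>\<open>Gam p\<close> is normal and lies in the line stabilizer, hence in all conjugates
  of \<open>M\<close>. So the core of \<open>M\<close> contains \<open>X 0 1 p\<close>; it is
  proper, and the argument for normal subgroups applies to it.\<close>

lemma ex_maximal:
  assumes p: "prime (p::nat)"
  shows "\<exists>M. maximal_subgroup M (SL k) \<and> subgroup_index (SL k) M \<le> of_nat (k * p ^ (k - 1)) \<and>
    (\<forall>a. X 0 1 a \<in> core M \<longrightarrow> int p dvd a)"
proof -
  have "X 0 1 1 \<notin> Par p"
  proof
    assume "X 0 1 1 \<in> Par p"
    then have "int p dvd X 0 1 1 $$ (0, 1)" using k_ge_3 unfolding Par_def by auto
    then show False using k_ge_3 prime_gt_1_nat[OF p] by (simp add: X_index)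
  qed
  moreover have "X 0 1 1 \<in> carrier (SL k)" by simp
  ultimately have "Par p \<noteq> carrier (SL k)" by blast
  from ex_maximal_subgroup[OF Par_subgroup[OF p] this index_Par(1)[OF p]]
  obtain M where M: "maximal_subgroup M (SL k)" "Par p \<subseteq> M" by blast
  then have MS: "subgroup M (SL k)" "M \<noteq> carrier (SL k)" by (simp_all add: maximal_subgroup_def)
  have "subgroup_index (SL k) M \<le> subgroup_index (SL k) (Par p)"
    by (intro subgroup_index_antimono Par_subgroup[OF p] MS M)
  then have "subgroup_index (SL k) M \<le> of_nat (k * p ^ (k - 1))" using index_Par(2)[OF p] by (rule order_trans)
  moreover have "core M \<noteq> carrier (SL k)" using core_subset[of M] MS subgroup.subset[OF MS(1)] by blast
  moreover have "X 0 1 (int p) \<in> core M"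
  proof -
    interpret Gm: normal "Gam (int p)" "SL k" by (rule Gam_normal)
    have k0: "0 < k" using k_ge_3 by simp
    have "Gam (int p) \<subseteq> Par p"
    proof
      fix A assume A: "A \<in> Gam (int p)"
      have "int p dvd A $$ (0, j)" if "j < k" "0 < j" for j
        using Gam_entry(1)[OF A k0 that(1)] that(2) by blast
      moreover have "A \<in> carrier (SL k)" using A Gm.subset by blast
      ultimately show "A \<in> Par p" unfolding Par_def by blast
    qed
    then have GM: "Gam (int p) \<subseteq> M" using M(2) by blast
    have "g * X 0 1 (int p) * inv\<^bsub>SL k\<^esub> g \<in> M" if "g \<in> carrier (SL k)" for g
      using Gm.inv_op_closed2[OF that X_in_Gam] GM unfolding SL_mult by blast
    then show ?thesis unfolding core_def by simp
  qed
  ultimately show ?thesis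
    using proper_normal_level[OF p core_normal[OF MS(1)]] M(1) by blast
qed

text \<open>The family that defines \<open>i_max\<close> is stable under conjugation, so its
  intersection lies in the core of each member.\<close>

lemma conj_maximal:
  assumes M: "maximal_subgroup M (SL k)" and g: "g \<in> carrier (SL k)"
  shows "maximal_subgroup {A \<in> carrier (SL k). g * A * inv\<^bsub>SL k\<^esub> g \<in> M} (SL k)"
    and "subgroup_index (SL k) {A \<in> carrier (SL k). g * A * inv\<^bsub>SL k\<^esub> g \<in> M} \<le> subgroup_index (SL k) M"
proof -
  define C where "C H h = {A \<in> carrier (SL k). h * A * inv\<^bsub>SL k\<^esub> h \<in> H}" for H h
  have MS: "subgroup M (SL k)" "M \<noteq> carrier (SL k)" using M by (simp_all add: maximal_subgroup_def)
  have gi: "inv\<^bsub>SL k\<^esub> g \<in> carrier (SL k)" using g by simp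
  have CS: "subgroup (C H h) (SL k)" if "subgroup H (SL k)" "h \<in> carrier (SL k)" for H h
    unfolding C_def using conj_subgroup[OF that] .
  have bk: "g * (inv\<^bsub>SL k\<^esub> g * A * g) * inv\<^bsub>SL k\<^esub> g = A" "inv\<^bsub>SL k\<^esub> g * (g * A * inv\<^bsub>SL k\<^esub> g) * g = A"
    if A: "A \<in> carrier (SL k)" for A
  proof -
    have "g * (inv\<^bsub>SL k\<^esub> g * A * g) * inv\<^bsub>SL k\<^esub> g = (g * inv\<^bsub>SL k\<^esub> g) * A * (g * inv\<^bsub>SL k\<^esub> g)"
      using g A by (simp add: SL_assoc del: SL_inv_r)
    then show "g * (inv\<^bsub>SL k\<^esub> g * A * g) * inv\<^bsub>SL k\<^esub> g = A" using g A by simp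
    have "inv\<^bsub>SL k\<^esub> g * (g * A * inv\<^bsub>SL k\<^esub> g) * g = (inv\<^bsub>SL k\<^esub> g * g) * A * (inv\<^bsub>SL k\<^esub> g * g)"
      using g A by (simp add: SL_assoc del: SL_inv_l)
    then show "inv\<^bsub>SL k\<^esub> g * (g * A * inv\<^bsub>SL k\<^esub> g) * g = A" using g A by simp
  qed
  have CC1: "C (C H g) (inv\<^bsub>SL k\<^esub> g) = H" and CC2: "C (C H (inv\<^bsub>SL k\<^esub> g)) g = H" if "subgroup H (SL k)" for H
    using subgroup.subset[OF that] g bk unfolding C_def by auto
  have full: "C (carrier (SL k)) h = carrier (SL k)" if "h \<in> carrier (SL k)" for h
    unfolding C_def using that by auto
  have mono: "C H h \<subseteq> C H' h" if "H \<subseteq> H'" for H H' h using that unfolding C_def by blast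
  have "C M g \<noteq> carrier (SL k)" using CC1[OF MS(1)] full[OF gi] MS(2) by metis
  moreover have "K = C M g \<or> K = carrier (SL k)" if K: "subgroup K (SL k)" "C M g \<subseteq> K" for K
  proof -
    have "M \<subseteq> C K (inv\<^bsub>SL k\<^esub> g)" using mono[OF K(2), of "inv\<^bsub>SL k\<^esub> g"] CC1[OF MS(1)] by simp
    then have "C K (inv\<^bsub>SL k\<^esub> g) = M \<or> C K (inv\<^bsub>SL k\<^esub> g) = carrier (SL k)"
      using M CS[OF K(1) gi] unfolding maximal_subgroup_def by blast
    then show ?thesis using CC2[OF K(1)] full[OF g] by metis
  qed
  ultimately have "maximal_subgroup (C M g) (SL k)"
    unfolding maximal_subgroup_def using CS[OF MS(1) g] by blast
  then show "maximal_subgroup {A \<in> carrier (SL k). g * A * inv\<^bsub>SL k\<^esub> g \<in> M} (SL k)" by (simp only: C_def)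
  have "subgroup_index (SL k) (C M g) \<le> subgroup_index (SL k) M"
  proof (cases "finite (rcosets\<^bsub>SL k\<^esub> M)")
    case True
    have "subgroup_index (SL k) (C M g) \<le> of_nat (card (rcosets\<^bsub>SL k\<^esub> M))"
    proof (rule subgroup_index_le_card(2)[OF CS[OF MS(1) g] True, of "\<lambda>A. M #>\<^bsub>SL k\<^esub> (g * A)"])
      show "(\<lambda>A. M #>\<^bsub>SL k\<^esub> (g * A)) ` carrier (SL k) \<subseteq> rcosets\<^bsub>SL k\<^esub> M"
        using g by (auto simp: RCOSETS_def)
      fix A B assume AB: "A \<in> carrier (SL k)" "B \<in> carrier (SL k)" "M #>\<^bsub>SL k\<^esub> (g * A) = M #>\<^bsub>SL k\<^esub> (g * B)"
      then have "(g * A) * inv\<^bsub>SL k\<^esub> (g * B) \<in> M" using rcos_eq_iff[OF MS(1), of "g * A" "g * B"] g by simp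
      moreover have "(g * A) * inv\<^bsub>SL k\<^esub> (g * B) = g * (A * inv\<^bsub>SL k\<^esub> B) * inv\<^bsub>SL k\<^esub> g"
        using inv_mult_group[of g B] g AB(1,2) by (simp add: SL_assoc)
      ultimately show "A \<otimes>\<^bsub>SL k\<^esub> inv\<^bsub>SL k\<^esub> B \<in> C M g" using AB(1,2) by (simp add: C_def)
    qed
    then show ?thesis using True by (simp add: subgroup_index_def)
  qed (simp add: subgroup_index_def)
  then show "subgroup_index (SL k) {A \<in> carrier (SL k). g * A * inv\<^bsub>SL k\<^esub> g \<in> M} \<le> subgroup_index (SL k) M"
    by (simp only: C_def)
qed

text \<open>The matrices \<open>X 0 1 a\<close> with \<open>a\<close> below the primorial lie in
  distinct cosets, since two equal cosets would make the difference of the arguments divisible by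
  every prime in question.\<close>

lemma primorial_le_index:
  assumes J: "subgroup J (SL k)" and dvd: "\<And>p a. p \<in> primes_le y \<Longrightarrow> X 0 1 a \<in> J \<Longrightarrow> int p dvd a"
  shows "of_nat (\<Prod>(primes_le y)) \<le> subgroup_index (SL k) J"
proof -
  let ?P = "\<Prod>(primes_le y)"
  have k1: "0 < k" "1 < k" using k_ge_3 by auto
  have XP: "a = b" if "a < ?P" "b < ?P" "X 0 1 (int a - int b) \<in> J" for a b :: nat
  proof -
    have "?P dvd nat \<bar>int a - int b\<bar>"
    proof (rule prod_primes_dvd)
      fix p assume p: "p \<in> primes_le y"
      then have "int p dvd \<bar>int a - int b\<bar>" using dvd[OF p that(3)] by simp
      then have "int p dvd int (nat \<bar>int a - int b\<bar>)" by simp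
      then have "p dvd nat \<bar>int a - int b\<bar>" by (simp only: of_nat_dvd_iff)
      then show "prime p \<and> p dvd nat \<bar>int a - int b\<bar>" using p by (simp add: primes_le_def)
    qed simp
    moreover have "nat \<bar>int a - int b\<bar> < ?P" using that(1,2) by linarith
    ultimately have "nat \<bar>int a - int b\<bar> = 0" by (metis dvd_imp_le not_le neq0_conv)
    then show ?thesis by simp
  qed
  have sub: "X 0 1 (int a) * inv\<^bsub>SL k\<^esub> X 0 1 (int b) = X 0 1 (int a - int b)" for a b
    using k1 by (simp add: X_inv X_add)
  let ?S = "(\<lambda>a. X 0 1 (int a)) ` {..<?P}"
  have "inj_on (\<lambda>a. X 0 1 (int a)) {..<?P}"
  proof (rule inj_onI)
    fix a b assume ab: "a \<in> {..<?P}" "b \<in> {..<?P}" "X 0 1 (int a) = X 0 1 (int b)"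
    have "X 0 1 (int a) * inv\<^bsub>SL k\<^esub> X 0 1 (int b) = 1\<^sub>m k" unfolding ab(3) by simp
    then have "X 0 1 (int a - int b) \<in> J" using subgroup.one_closed[OF J] unfolding sub by simp
    then show "a = b" using XP ab by simp
  qed
  then have "card ?S = ?P" by (simp add: card_image)
  moreover have "of_nat (card ?S) \<le> subgroup_index (SL k) J"
  proof (rule card_le_subgroup_index[OF J])
    fix A B assume AB: "A \<in> ?S" "B \<in> ?S" "A \<otimes>\<^bsub>SL k\<^esub> inv\<^bsub>SL k\<^esub> B \<in> J"
    obtain a where a: "a < ?P" "A = X 0 1 (int a)" using AB(1) by blast
    obtain b where b: "b < ?P" "B = X 0 1 (int b)" using AB(2) by blast
    have "X 0 1 (int a - int b) \<in> J" using AB(3) unfolding SL_mult a(2) b(2) sub .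
    from XP[OF a(1) b(1) this] show "A = B" unfolding a(2) b(2) by simp
  qed auto
  ultimately show ?thesis by simp
qed

lemma i_max_normal_lower:
  assumes "\<And>p. p \<in> primes_le y \<Longrightarrow> real (k * p ^ (k * k - 1)) \<le> z"
  shows "of_nat (\<Prod>(primes_le y)) \<le> i_max_normal (SL k) z"
  unfolding i_max_normal_def intersection_index_def
proof (rule primorial_le_index)
  show "subgroup (carrier (SL k) \<inter> \<Inter>{H. maximal_normal_subgroup H (SL k) \<and> subgroup_index (SL k) H \<le> ennreal z}) (SL k)"
    by (rule subgroup_Inter_carrier) (auto simp: maximal_normal_subgroup_def normal_imp_subgroup)
  fix p a assume p: "p \<in> primes_le y"
    and a: "X 0 1 a \<in> carrier (SL k) \<inter> \<Inter>{H. maximal_normal_subgroup H (SL k) \<and> subgroup_index (SL k) H \<le> ennreal z}"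
  have "prime p" using p by (simp add: primes_le_def)
  from ex_maximal_normal[OF this] obtain M where M: "maximal_normal_subgroup M (SL k)"
    "subgroup_index (SL k) M \<le> of_nat (k * p ^ (k * k - 1))" "\<forall>a. X 0 1 a \<in> M \<longrightarrow> int p dvd a" by blast
  have "(of_nat (k * p ^ (k * k - 1)) :: ennreal) \<le> ennreal z"
    using ennreal_leI[OF assms[OF p]] by (simp only: ennreal_of_nat_eq_real_of_nat)
  with M(2) have "subgroup_index (SL k) M \<le> ennreal z" by (rule order_trans)
  then have "X 0 1 a \<in> M" using a M(1) by blast
  then show "int p dvd a" using M(3) by blast
qed

lemma i_max_lower:
  assumes "\<And>p. p \<in> primes_le y \<Longrightarrow> real (k * p ^ (k - 1)) \<le> z"
  shows "of_nat (\<Prod>(primes_le y)) \<le> i_max (SL k) z"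
  unfolding i_max_def intersection_index_def
proof (rule primorial_le_index)
  show "subgroup (carrier (SL k) \<inter> \<Inter>{H. maximal_subgroup H (SL k) \<and> subgroup_index (SL k) H \<le> ennreal z}) (SL k)"
    by (rule subgroup_Inter_carrier) (auto simp: maximal_subgroup_def)
  fix p a assume p: "p \<in> primes_le y"
    and a: "X 0 1 a \<in> carrier (SL k) \<inter> \<Inter>{H. maximal_subgroup H (SL k) \<and> subgroup_index (SL k) H \<le> ennreal z}"
  have "prime p" using p by (simp add: primes_le_def)
  from ex_maximal[OF this] obtain M where M: "maximal_subgroup M (SL k)"
    "subgroup_index (SL k) M \<le> of_nat (k * p ^ (k - 1))" "\<forall>a. X 0 1 a \<in> core M \<longrightarrow> int p dvd a" by blast
  have "(of_nat (k * p ^ (k - 1)) :: ennreal) \<le> ennreal z"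
    using ennreal_leI[OF assms[OF p]] by (simp only: ennreal_of_nat_eq_real_of_nat)
  with M(2) have ind: "subgroup_index (SL k) M \<le> ennreal z" by (rule order_trans)
  have "g * X 0 1 a * inv\<^bsub>SL k\<^esub> g \<in> M" if g: "g \<in> carrier (SL k)" for g
  proof -
    let ?C = "{A \<in> carrier (SL k). g * A * inv\<^bsub>SL k\<^esub> g \<in> M}"
    have "X 0 1 a \<in> ?C"
      using a conj_maximal(1)[OF M(1) g] order_trans[OF conj_maximal(2)[OF M(1) g] ind] by blast
    then show ?thesis by blast
  qed
  then have "X 0 1 a \<in> core M" by (simp add: core_def)
  then show "int p dvd a" using M(3) by blast
qed

end

section \<open>Growth\<close>

text \<open>\<open>x\<close> is the integer part of r = (K n)^(1/d). The e-th power of the least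
  common multiple is at most exp(24 d e x), and 24 d (e + 1) r is the d-th root of B n, which fixes
  \<open>B\<close>; e + 1 in place of \<open>e\<close> keeps it positive.\<close>

lemma growth_upper:
  fixes i :: "real \<Rightarrow> ennreal"
  assumes d: "d > 0" and K: "K > 0"
    and le: "\<And>n x. n > 0 \<Longrightarrow> (\<And>p. prime p \<Longrightarrow> p ^ d \<le> K * n \<Longrightarrow> p \<le> x) \<Longrightarrow> i (real n) \<le> of_nat (smooth_lcm x n ^ e)"
  obtains B :: nat where "B > 0" "\<And>n. n > 0 \<Longrightarrow> i (real n) \<le> ennreal (exp (real (B * n) powr (1 / real d)))"
proof
  let ?B = "(24 * (e + 1) * d) ^ d * K"
  show "?B > 0" using d K by simp
  fix n :: nat assume n: "n > 0"
  define r where "r = real (K * n) powr (1 / real d)"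
  define x where "x = nat \<lfloor>r\<rfloor>"
  have N: "K * n > 0" "K * n \<ge> n" using K n by auto
  have "real (K * n) \<ge> 1" using N by linarith
  then have r1: "r \<ge> 1" unfolding r_def by (simp add: ge_one_powr_ge_zero)
  have rd: "r ^ d = real (K * n)" unfolding r_def using N(1) d by (simp add: powr_powr flip: powr_realpow')
  have xr: "real x \<le> r" "r < real x + 1" unfolding x_def using r1 by (simp, linarith)
  have px: "p \<le> x" if "prime p" "p ^ d \<le> K * n" for p
  proof -
    have "real p ^ d \<le> r ^ d" unfolding rd using that(2) by (metis of_nat_le_iff of_nat_power)
    then have "real p \<le> r" using r1 d by (simp add: power_mono_iff)
    then show ?thesis unfolding x_def by (rule le_nat_floor)
  qed
  let ?c = "real (card (primes_le x))"
  \<comment> \<open>For x \<ge> 2, n \<le> r^d and r < x + 1 \<le> x^2 give ln n \<le> 2 d ln x;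
    together with the 12 of \<open>card_primes_upper\<close> this makes 24 d. For x < 2 there are no
    primes to count.\<close>
  have c: "?c * ln (real n) \<le> 24 * d * real x"
  proof (cases "x \<ge> 2")
    case True
    have "ln (real n) \<le> ln (r ^ d)" unfolding rd using n N by simp
    also have "\<dots> = d * ln r" using r1 by (simp add: ln_realpow)
    also have "\<dots> \<le> d * (2 * ln (real x))"
    proof (intro mult_left_mono)
      have "r \<le> real x * 2" using xr True by linarith
      also have "\<dots> \<le> real x * real x" using True by (intro mult_left_mono) auto
      finally have "r \<le> real x ^ 2" by (simp add: power2_eq_square)
      then have "ln r \<le> ln (real x ^ 2)" using r1 True by (subst ln_le_cancel_iff) auto
      then show "ln r \<le> 2 * ln (real x)" using True by (simp add: ln_realpow)
    qed simp
    finally have "?c * ln (real n) \<le> ?c * (d * (2 * ln (real x)))" by (rule mult_left_mono) simp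
    also have "\<dots> = 2 * d * (?c * ln (real x))" by simp
    also have "\<dots> \<le> 2 * d * (12 * real x)" by (intro mult_left_mono card_primes_upper) simp
    finally show ?thesis by simp
  next
    case False
    then have "primes_le x = {}" by (auto simp: primes_le_def dest: prime_ge_2_nat)
    then show ?thesis by simp
  qed
  have "real (smooth_lcm x n ^ e) \<le> (real n ^ card (primes_le x)) ^ e"
    using smooth_lcm_le[OF n, of x] by (metis of_nat_le_iff of_nat_power of_nat_0_le_iff power_mono)
  also have "\<dots> = exp (e * (?c * ln (real n)))"
    using n by (simp add: exp_of_nat_mult exp_ln)
  also have "\<dots> \<le> exp (e * (24 * d * real x))" using c by (simp add: mult_left_mono)
  also have "e * (24 * d * real x) \<le> (24 * (e + 1) * d) * r"
  proof -
    have "e * (24 * d * real x) \<le> real (24 * (e + 1) * d) * real x" by (simp add: algebra_simps)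
    also have "\<dots> \<le> real (24 * (e + 1) * d) * r" using xr by (intro mult_left_mono) auto
    finally show ?thesis by simp
  qed
  also have "(24 * (e + 1) * d) * r = real (?B * n) powr (1 / real d)"
  proof -
    have "real (?B * n) = (real (24 * (e + 1) * d) * r) ^ d" by (simp add: power_mult_distrib rd)
    moreover have "((real (24 * (e + 1) * d) * r) ^ d) powr (1 / real d) = real (24 * (e + 1) * d) * r"
      using r1 d by (subst powr_realpow[symmetric]) (auto simp: powr_powr intro!: mult_pos_pos)
    ultimately show ?thesis by simp
  qed
  finally have "real (smooth_lcm x n ^ e) \<le> exp (real (?B * n) powr (1 / real d))" by simp
  then have "(of_nat (smooth_lcm x n ^ e) :: ennreal) \<le> ennreal (exp (real (?B * n) powr (1 / real d)))"
    unfolding ennreal_of_nat_eq_real_of_nat by (rule ennreal_leI)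
  then show "i (real n) \<le> ennreal (exp (real (?B * n) powr (1 / real d)))"
    using le[OF n px] by (rule order_trans[rotated])
qed

text \<open>Taking \<open>y\<close> near 8 r cancels the 1/8 of \<open>primorial_lower\<close>, and
  8^d goes into \<open>D\<close>. In \<open>C\<close> the term 1/8 pays for rounding 8 r down, and
  \<open>C0\<close> is the constant of the primorial bound.\<close>

lemma growth_lower:
  fixes i :: "real \<Rightarrow> ennreal"
  assumes d: "d > 0" and K: "K > 0"
    and le: "\<And>y z. (\<And>p. p \<in> primes_le y \<Longrightarrow> real (K * p ^ d) \<le> z) \<Longrightarrow> of_nat (\<Prod>(primes_le y)) \<le> i z"
  obtains C :: real and D :: nat where "C > 0" "D > 0"
    "\<And>n. n > 0 \<Longrightarrow> ennreal (exp (real n powr (1 / real d))) \<le> ennreal C * i (real (D * n))"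
proof -
  obtain C0 where C0: "\<And>y. exp (real y / 8 - C0) \<le> real (\<Prod>(primes_le y))" using primorial_lower by blast
  let ?C = "exp (1 / 8 + C0)"
  have "ennreal (exp (real n powr (1 / real d))) \<le> ennreal ?C * i (real (K * 8 ^ d * n))" if n: "n > 0" for n
  proof -
    define r where "r = real n powr (1 / real d)"
    define y where "y = nat \<lfloor>8 * r\<rfloor>"
    have r0: "r \<ge> 0" by (simp add: r_def)
    have rd: "r ^ d = real n" unfolding r_def using n d by (simp add: powr_powr flip: powr_realpow')
    have yr: "real y \<le> 8 * r" "8 * r < real y + 1" unfolding y_def using r0 by (simp, linarith)
    have "of_nat (\<Prod>(primes_le y)) \<le> i (real (K * 8 ^ d * n))"
    proof (rule le)
      fix p assume "p \<in> primes_le y"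
      then have "real p \<le> 8 * r" using yr(1) unfolding primes_le_def by auto
      then have "real p ^ d \<le> (8 * r) ^ d" by (rule power_mono) simp
      then show "real (K * p ^ d) \<le> real (K * 8 ^ d * n)"
        by (simp add: power_mult_distrib rd mult.assoc mult_left_mono)
    qed
    moreover have "exp r \<le> ?C * real (\<Prod>(primes_le y))"
    proof -
      have "exp r \<le> exp ((1 / 8 + C0) + (real y / 8 - C0))" using yr(2) by simp
      also have "\<dots> \<le> ?C * real (\<Prod>(primes_le y))" unfolding exp_add[of "1 / 8 + C0"] by (intro mult_left_mono C0) simp
      finally show ?thesis .
    qed
    then have "ennreal (exp r) \<le> ennreal ?C * of_nat (\<Prod>(primes_le y))"
      unfolding ennreal_of_nat_eq_real_of_nat by (subst ennreal_mult'[symmetric]) (simp_all add: ennreal_leI del: of_nat_prod)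
    ultimately show ?thesis unfolding r_def[symmetric] by (meson mult_left_mono order_trans zero_le)
  qed
  then show thesis using that[of ?C "K * 8 ^ d"] K by simp
qed

section \<open>Assembling the growth rates\<close>

context SLk begin

text \<open>One group \<open>E m\<close> lies in all members of the family at once, because m =
  \<open>smooth_lcm x n\<close> depends only on the common bounds \<open>x\<close> and
  \<open>n\<close>.\<close>

lemma intersection_index_upper:
  assumes n: "n > 0" and sub: "\<And>H. P H (SL k) \<Longrightarrow> subgroup H (SL k)"
    and x: "\<And>H p F. P H (SL k) \<Longrightarrow> subgroup_index (SL k) H \<le> of_nat n \<Longrightarrow> prime p \<Longrightarrow>
      X 0 1 (int p * F) \<in> core H \<Longrightarrow> X 0 1 F \<notin> core H \<Longrightarrow> p \<le> x"
  shows "intersection_index P (SL k) (real n) \<le> of_nat (smooth_lcm x n ^ (k * k + 8))"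
proof -
  let ?I = "carrier (SL k) \<inter> \<Inter>{H. P H (SL k) \<and> subgroup_index (SL k) H \<le> ennreal (real n)}"
  let ?E = "E (int (smooth_lcm x n))"
  have ES: "subgroup ?E (SL k)" using E_normal by (rule normal_imp_subgroup)
  have "?E \<subseteq> H" if H: "P H (SL k)" "subgroup_index (SL k) H \<le> ennreal (real n)" for H
  proof -
    have "subgroup_index (SL k) H \<le> of_nat n" using H(2) by (simp add: ennreal_of_nat_eq_real_of_nat)
    then show ?thesis using E_subset_of_index[OF sub[OF H(1)] n] x[OF H(1)] by blast
  qed
  then have "?E \<subseteq> ?I" using subgroup.subset[OF ES] by blast
  moreover have "subgroup ?I (SL k)" by (rule subgroup_Inter_carrier) (use sub in blast)
  ultimately have "subgroup_index (SL k) ?I \<le> subgroup_index (SL k) ?E" by (intro subgroup_index_antimono ES)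
  also have "\<dots> \<le> of_nat (smooth_lcm x n ^ (k * k + 8))" by (rule index_E[OF smooth_lcm_pos])
  finally show ?thesis unfolding intersection_index_def .
qed

lemma i_normal_upper:
  assumes n: "n > 0" and x: "\<And>p. prime p \<Longrightarrow> p ^ (k * k - 1) \<le> k * 2 ^ (k - 1) * n \<Longrightarrow> p \<le> x"
  shows "i_normal (SL k) (real n) \<le> of_nat (smooth_lcm x n ^ (k * k + 8))"
  unfolding i_normal_def
proof (rule intersection_index_upper[OF n])
  fix H p F assume H: "H \<lhd> SL k" and ind: "subgroup_index (SL k) H \<le> of_nat n" and p: "prime p"
    and F: "X 0 1 (int p * F) \<in> core H" "X 0 1 F \<notin> core H"
  have "of_nat (p ^ (k * k - 1)) \<le> of_nat (k * 2 ^ (k - 1)) * subgroup_index (SL k) H"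
    by (rule normal_index_lower[OF p H]) (use normal_level[OF p H] F core_of_normal[OF H] in auto)
  also have "\<dots> \<le> of_nat (k * 2 ^ (k - 1)) * of_nat n" by (rule mult_left_mono[OF ind]) simp
  finally have "(of_nat (p ^ (k * k - 1)) :: ennreal) \<le> of_nat (k * 2 ^ (k - 1) * n)" by (simp only: of_nat_mult)
  then have "p ^ (k * k - 1) \<le> k * 2 ^ (k - 1) * n" by (simp only: of_nat_le_iff)
  then show "p \<le> x" by (rule x[OF p])
qed (rule normal_imp_subgroup)

lemma i_max_upper:
  assumes n: "n > 0" and x: "\<And>p. prime p \<Longrightarrow> p ^ (k - 1) \<le> 1 * n \<Longrightarrow> p \<le> x"
  shows "i_max (SL k) (real n) \<le> of_nat (smooth_lcm x n ^ (k * k + 8))"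
  unfolding i_max_def
proof (rule intersection_index_upper[OF n])
  fix H assume "maximal_subgroup H (SL k)"
  then show H: "subgroup H (SL k)" by (simp add: maximal_subgroup_def)
  fix p F assume ind: "subgroup_index (SL k) H \<le> of_nat n" and p: "prime p"
    and F: "X 0 1 (int p * F) \<in> core H" "X 0 1 F \<notin> core H"
  have "(of_nat (p ^ (k - 1)) :: ennreal) \<le> of_nat n"
    using subgroup_index_lower[OF p H F] ind by (rule order_trans)
  then have "p ^ (k - 1) \<le> 1 * n" by (simp only: of_nat_le_iff mult_1)
  then show "p \<le> x" by (rule x[OF p])
qed

lemma i_max_normal_le_i_normal: "i_max_normal (SL k) z \<le> i_normal (SL k) z"
  unfolding i_max_normal_def i_normal_def intersection_index_def
proof (rule subgroup_index_antimono)
  show "subgroup (carrier (SL k) \<inter> \<Inter>{H. H \<lhd> SL k \<and> subgroup_index (SL k) H \<le> ennreal z}) (SL k)"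
    by (rule subgroup_Inter_carrier) (auto intro: normal_imp_subgroup)
  show "subgroup (carrier (SL k) \<inter> \<Inter>{H. maximal_normal_subgroup H (SL k) \<and> subgroup_index (SL k) H \<le> ennreal z}) (SL k)"
    by (rule subgroup_Inter_carrier) (auto simp: maximal_normal_subgroup_def normal_imp_subgroup)
qed (unfold maximal_normal_subgroup_def, blast)

end

theorem theorem5p4:
  fixes k :: nat
  assumes "k \<ge> 3"
  shows "i_normal (SL k) \<sim>\<^sub>g i_max_normal (SL k)
    \<and> i_max_normal (SL k) \<sim>\<^sub>g (\<lambda>n. ennreal (exp (n powr (1 / (real k ^ 2 - 1)))))
    \<and> i_max (SL k) \<sim>\<^sub>g (\<lambda>n. ennreal (exp (n powr (1 / (real k - 1)))))"
proof -
  interpret SLk k by unfold_locales (rule assms)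
  have kk: "0 < k * k - 1" "0 < k - 1" "0 < k" using assms mult_le_mono[OF assms assms] by auto
  have real_k: "real k ^ 2 - 1 = real (k * k - 1)" "real k - 1 = real (k - 1)"
    using kk by (simp_all add: of_nat_diff power2_eq_square)
  have K: "0 < k * 2 ^ (k - 1)" using kk by simp
  let ?g = "\<lambda>n. ennreal (exp (n powr (1 / real (k * k - 1))))"
  let ?h = "\<lambda>n. ennreal (exp (n powr (1 / real (k - 1))))"
  obtain B where B: "B > 0" "\<And>n. n > 0 \<Longrightarrow> i_normal (SL k) (real n) \<le> ?g (real (B * n))"
    using growth_upper[OF kk(1) K i_normal_upper] by blast
  obtain C D where CD: "C > 0" "D > 0"
    "\<And>n. n > 0 \<Longrightarrow> ?g (real n) \<le> ennreal C * i_max_normal (SL k) (real (D * n))"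
    using growth_lower[where i = "i_max_normal (SL k)", OF kk(1) kk(3)] i_max_normal_lower by blast
  obtain B' where B': "B' > 0" "\<And>n. n > 0 \<Longrightarrow> i_max (SL k) (real n) \<le> ?h (real (B' * n))"
    using growth_upper[where K = 1 and i = "i_max (SL k)" and e = "k * k + 8", OF kk(2)] i_max_upper by auto
  obtain C' D' where CD': "C' > 0" "D' > 0"
    "\<And>n. n > 0 \<Longrightarrow> ?h (real n) \<le> ennreal C' * i_max (SL k) (real (D' * n))"
    using growth_lower[where i = "i_max (SL k)", OF kk(2) kk(3)] i_max_lower by blast
  have "i_normal (SL k) \<sim>\<^sub>g i_max_normal (SL k)"
    unfolding growth_equiv_def
  proof (intro exI conjI allI impI)
    fix n :: nat assume n: "n > 0"
    \<comment> \<open>\<open>B\<close> and \<open>D\<close> are natural numbers, so the lower bound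
      can be used at the positive integer \<open>B * n\<close>; composing the two bounds through the
      exponential compares the two index functions.\<close>
    have "i_normal (SL k) (real n) \<le> ennreal C * i_max_normal (SL k) (real (D * (B * n)))"
      using order_trans[OF B(2)[OF n] CD(3)[of "B * n"]] B(1) n by simp
    then show "i_normal (SL k) (real n) \<le> ennreal C * i_max_normal (SL k) (real (D * B) * real n)"
      by (simp add: mult.assoc)
    show "i_max_normal (SL k) (real n) \<le> ennreal 1 * i_normal (SL k) (1 * real n)"
      using i_max_normal_le_i_normal by simp
  qed (use B(1) CD in auto)
  moreover have "i_max_normal (SL k) \<sim>\<^sub>g ?g"
    unfolding growth_equiv_def
  proof (intro exI conjI allI impI)
    fix n :: nat assume n: "n > 0"
    show "i_max_normal (SL k) (real n) \<le> ennreal 1 * ?g (real B * real n)"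
      using order_trans[OF i_max_normal_le_i_normal B(2)[OF n]] by simp
    show "?g (real n) \<le> ennreal C * i_max_normal (SL k) (real D * real n)" using CD(3)[OF n] by simp
  qed (use B(1) CD in auto)
  moreover have "i_max (SL k) \<sim>\<^sub>g ?h"
    unfolding growth_equiv_def
  proof (intro exI conjI allI impI)
    fix n :: nat assume n: "n > 0"
    show "i_max (SL k) (real n) \<le> ennreal 1 * ?h (real B' * real n)" using B'(2)[OF n] by simp
    show "?h (real n) \<le> ennreal C' * i_max (SL k) (real D' * real n)" using CD'(3)[OF n] by simp
  qed (use B'(1) CD' in auto)
  ultimately show ?thesis unfolding real_k by blast
qed

end
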